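(* There exists an algorithm which, given as input a critical two-dimensional bootstrap percolation update family $\mathcal{U}$, computes its difficulty $\alpha$.
   Context: An update family is a finite set $\mathcal{U}$ of finite subsets (called rules) of $\mathbb{Z}^2\setminus\{0\}$. For $A\subseteq\mathbb{Z}^2$ set $A_0=A$, $A_{t+1}=A_t\cup\{x\in\mathbb{Z}^2:\exists U\in\mathcal{U},\ x+U\subseteq A_t\}$, and let the closure be $[A]=\bigcup_{t\ge0}A_t$. Identify the unit circle $S^1$ with $\mathbb{R}/2\pi\mathbb{Z}$, a direction $u$ corresponding to the unit vector $(\cos u,\sin u)$. Let $\mathbb{H}_u=\{x\in\mathbb{Z}^2:\langle x,u\rangle<0\}$ and $l_u=\{x\in\mathbb{Z}^2:\langle x,u\rangle=0\}$. A direction $u$ is unstable if some $U\in\mathcal{U}$ satisfies $U\subseteq\mathbb{H}_u$, and stable otherwise; the stable set is a finite union of closed intervals of $S^1$, and a stable direction forming a one-point interval is called isolated. $\mathcal{U}$ is supercritical if some open semicircle of $S^1$ consists of unstable directions; critical if it is not supercritical and some open semicircle contains only finitely many stable directions. For a critical $\mathcal{U}$ and a direction $u$: if $u$ is an isolated stable direction, $\alpha(u)$ is the minimum cardinality of a set $Z\subseteq\mathbb{Z}^2\setminus\mathbb{H}_u$ such that $\bar Z:=[\mathbb{H}_u\cup Z]\setminus\mathbb{H}_u$ is infinite; $\alpha(u)=0$ if $u$ is unstable; $\alpha(u)=\infty$ if $u$ is a non-isolated stable direction. The difficulty of $\mathcal{U}$ is $\alpha=\inf_{C}\sup_{u\in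 C}\alpha(u)$, the infimum over all open semicircles $C$ of $S^1$. The family $\mathcal{U}$ is given as input as a list of rules, each a list of integer coordinate pairs written in binary. *)

theory Defs
  imports
    "HOL-Analysis.Analysis"
    "HOL-Library.Product_Plus"
    "HOL-Library.Extended_Nat"
    "HOL-Library.Nat_Bijection"
begin

type_synonym site = "int \<times> int"

definition update_family :: "site set set \<Rightarrow> bool" where
  "update_family \<U> \<longleftrightarrow> finite \<U> \<and> (\<forall>U\<in>\<U>. finite U \<and> 0 \<notin> U)"

definition bp_step :: "site set set \<Rightarrow> site set \<Rightarrow> site set" where
  "bp_step \<U> A = A \<union> {x. \<exists>U\<in>\<U>. (\<lambda>y. x + y) ` U \<subseteq> A}"

definition bp_closure :: "site set set \<Rightarrow> site set \<Rightarrow> site set" where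
  "bp_closure \<U> A = (\<Union>t. (bp_step \<U> ^^ t) A)"

definition site_vec :: "site \<Rightarrow> real \<times> real" where
  "site_vec x = (real_of_int (fst x), real_of_int (snd x))"

text \<open>Directions are the unit vectors themselves rather than their angles modulo \<open>2 * pi\<close>.\<close>

abbreviation S1 :: "(real \<times> real) set" where
  "S1 \<equiv> sphere 0 1"

definition half_plane :: "real \<times> real \<Rightarrow> site set" where
  "half_plane u = {x. site_vec x \<bullet> u < 0}"

definition open_semicircle :: "real \<times> real \<Rightarrow> (real \<times> real) set" where
  "open_semicircle w = {u \<in> S1. u \<bullet> w > 0}"

definition unstable :: "site set set \<Rightarrow> real \<times> real \<Rightarrow> bool" where
  "unstable \<U> u \<longleftrightarrow> (\<exists>U\<in>\<U>. U \<subseteq> half_plane u)"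

definition stable_set :: "site set set \<Rightarrow> (real \<times> real) set" where
  "stable_set \<U> = {u \<in> S1. \<not> unstable \<U> u}"

text \<open>The intervals making up the stable set are its connected components.\<close>

definition isolated_stable :: "site set set \<Rightarrow> real \<times> real \<Rightarrow> bool" where
  "isolated_stable \<U> u \<longleftrightarrow>
     u \<in> stable_set \<U> \<and> connected_component_set (stable_set \<U>) u = {u}"

definition supercritical :: "site set set \<Rightarrow> bool" where
  "supercritical \<U> \<longleftrightarrow> (\<exists>w\<in>S1. \<forall>u\<in>open_semicircle w. unstable \<U> u)"

definition critical :: "site set set \<Rightarrow> bool" where
  "critical \<U> \<longleftrightarrow>
     \<not> supercritical \<U> \<and> (\<exists>w\<in>S1. finite (open_semicircle w \<inter> stable_set \<U>))"

text \<open>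
  Only finite \<open>Z\<close> are considered, because \<^const>\<open>card\<close> sends infinite sets to \<open>0\<close>; an infinite \<open>Z\<close>
  would contribute the value \<open>\<infinity>\<close>, which does not affect the infimum.
\<close>

definition direction_difficulty :: "site set set \<Rightarrow> real \<times> real \<Rightarrow> enat" where
  "direction_difficulty \<U> u =
     (if unstable \<U> u then 0
      else if isolated_stable \<U> u then
        (INF Z \<in> {Z. finite Z \<and> Z \<subseteq> - half_plane u \<and>
                     infinite (bp_closure \<U> (half_plane u \<union> Z) - half_plane u)}. enat (card Z))
      else \<infinity>)"

definition difficulty :: "site set set \<Rightarrow> enat" where
  "difficulty \<U> = (INF w\<in>S1. SUP u\<in>open_semicircle w. direction_difficulty \<U> u)"

text \<open>
  Algorithms are programs for partial (\<open>\<mu>\<close>-)recursive functions; \<open>eval p xs y\<close> means that \<open>p\<close>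
  halts on the arguments \<open>xs\<close> with output \<open>y\<close>.
\<close>

datatype recf =
    Zero
  | Succ
  | Proj nat
  | Comp recf "recf list"
  | PrimRec recf recf
  | Mu recf

inductive eval :: "recf \<Rightarrow> nat list \<Rightarrow> nat \<Rightarrow> bool" where
  eval_Zero: "eval Zero xs 0"
| eval_Succ: "eval Succ [x] (Suc x)"
| eval_Proj: "i < length xs \<Longrightarrow> eval (Proj i) xs (xs ! i)"
| eval_Comp: "list_all2 (\<lambda>g y. eval g xs y) gs ys \<Longrightarrow> eval f ys z \<Longrightarrow> eval (Comp f gs) xs z"
| eval_PrimRec_0: "eval f xs y \<Longrightarrow> eval (PrimRec f g) (0 # xs) y"
| eval_PrimRec_Suc:
    "eval (PrimRec f g) (n # xs) y \<Longrightarrow> eval g (n # y # xs) z \<Longrightarrow> eval (PrimRec f g) (Suc n # xs) z"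
| eval_Mu:
    "eval f (n # xs) 0 \<Longrightarrow> (\<forall>m<n. \<exists>k. eval f (m # xs) (Suc k)) \<Longrightarrow> eval (Mu f) xs n"
  monos list_all2_mono

inductive_cases eval_ZeroE: "eval Zero xs y"
inductive_cases eval_SuccE: "eval Succ xs y"
inductive_cases eval_ProjE: "eval (Proj i) xs y"
inductive_cases eval_CompE: "eval (Comp f gs) xs y"
inductive_cases eval_PrimRec_0E: "eval (PrimRec f g) (0 # xs) y"
inductive_cases eval_PrimRec_SucE: "eval (PrimRec f g) (Suc n # xs) y"
inductive_cases eval_MuE: "eval (Mu f) xs y"

lemma eval_deterministic: "eval p xs y \<Longrightarrow> eval p xs z \<Longrightarrow> y = z"
proof (induction arbitrary: z rule: eval.induct)
  case (eval_Comp xs gs ys f w)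
  from eval_Comp.prems obtain ys' where
    ys': "list_all2 (\<lambda>g y. eval g xs y) gs ys'" and w: "eval f ys' z"
    by (rule eval_CompE)
  have "ys = ys'"
  proof (rule nth_equalityI)
    show "length ys = length ys'"
      using list_all2_lengthD[OF eval_Comp.IH(1)] list_all2_lengthD[OF ys'] by simp
    show "ys ! i = ys' ! i" if "i < length ys" for i
      using list_all2_nthD2[OF eval_Comp.IH(1) that] list_all2_nthD[OF ys', of i]
        list_all2_lengthD[OF eval_Comp.IH(1)] that by auto
  qed
  then show ?case using eval_Comp.IH(2) w by blast
next
  case (eval_Mu f n xs)
  from eval_Mu.prems have z: "eval f (z # xs) 0" "\<forall>m<z. \<exists>k. eval f (m # xs) (Suc k)"
    by (blast elim: eval_MuE)+
  show ?case
  proof (cases n z rule: linorder_cases)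
    case less
    then obtain k where "eval f (n # xs) (Suc k)" using z(2) by blast
    then show ?thesis using eval_Mu.IH(1) by fastforce
  next
    case greater
    then obtain k where "\<forall>y. eval f (z # xs) y \<longrightarrow> Suc k = y" using eval_Mu.IH(2) by blast
    then show ?thesis using z(1) by fastforce
  qed auto
next
  case (eval_PrimRec_Suc f g n xs y w)
  from eval_PrimRec_Suc.prems obtain y' where "eval (PrimRec f g) (n # xs) y'" "eval g (n # y' # xs) z"
    by (rule eval_PrimRec_SucE)
  then show ?case using eval_PrimRec_Suc.IH by blast
qed (blast elim: eval_ZeroE eval_SuccE eval_ProjE eval_PrimRec_0E)+

text \<open>
  The input is a list of rules, each a list of pairs of integers. An integer is written as a sign bit
  followed by its binary digits, least significant first, and the resulting nested lists of bits are
  turned into a natural number by the standard pairing and list codings.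
\<close>

fun bits :: "nat \<Rightarrow> nat list" where
  "bits n = (if n = 0 then [] else n mod 2 # bits (n div 2))"

declare bits.simps [simp del]

definition int_bits :: "int \<Rightarrow> nat list" where
  "int_bits z = (if z < 0 then 1 else 0) # bits (nat \<bar>z\<bar>)"

definition encode_site :: "site \<Rightarrow> nat" where
  "encode_site x = prod_encode (list_encode (int_bits (fst x)), list_encode (int_bits (snd x)))"

definition encode_input :: "site list list \<Rightarrow> nat" where
  "encode_input rs = list_encode (map (\<lambda>r. list_encode (map encode_site r)) rs)"

definition family_of :: "site list list \<Rightarrow> site set set" where
  "family_of rs = set ` set rs"

lemma bits_inject: "bits m = bits n \<longleftrightarrow> m = n"
proof
  show "bits m = bits n \<Longrightarrow> m = n"
  proof (induction m arbitrary: n rule: bits.induct)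
    case (1 m)
    show ?case
    proof (cases "m = 0 \<or> n = 0")
      case True
      then show ?thesis using 1(2) by (auto simp: bits.simps[of m] bits.simps[of n] split: if_splits)
    next
      case False
      then have "m mod 2 = n mod 2" "bits (m div 2) = bits (n div 2)"
        using 1(2) by (auto simp: bits.simps[of m] bits.simps[of n])
      then show ?thesis using 1(1) False by (metis div_mult_mod_eq)
    qed
  qed
qed simp

lemma inj_encode_site: "inj encode_site"
proof -
  have "int_bits a = int_bits b \<Longrightarrow> a = b" for a b
    by (auto simp: int_bits_def bits_inject split: if_splits)
  then show ?thesis
    by (auto intro!: injI simp: encode_site_def list_encode_eq prod_eq_iff)
qed

lemma inj_encode_input: "inj encode_input"
proof (rule injI)
  fix rs rs' assume "encode_input rs = encode_input rs'"
  then have "map (\<lambda>r. list_encode (map encode_site r)) rs =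
      map (\<lambda>r. list_encode (map encode_site r)) rs'"
    by (simp add: encode_input_def list_encode_eq)
  moreover have "inj (\<lambda>r. list_encode (map encode_site r))"
    by (auto intro!: injI simp: list_encode_eq inj_map_eq_map[OF inj_encode_site])
  ultimately show "rs = rs'" by simp
qed

end

theory Submission imports Defs begin

text \<open>
  Stability of a direction depends only on the signs of its inner products with the elements of the
  rules. Hence it is constant on the open arcs cut out by the directions orthogonal to these elements,
  and every semicircle can be rotated, without increasing its difficulty, until its midpoint is
  parallel to an element of a rule. This leaves finitely many semicircles and finitely many
  isolated stable directions, all of them rational.

  For a rational stable direction \<open>u\<close>, both \<open>\<alpha>(u) \<le> k\<close> and \<open>\<alpha>(u) > k\<close> have finite certificates.
  The closure of the half plane and a finite \<open>Z\<close> stays in a strip, so by the pigeonhole principle it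
  is infinite iff it contains a finite set that generates a proper translate of itself. If on the other
  hand all sets of at most \<open>k\<close> sites have finite closures, then these closures stay within a uniform
  distance \<open>D\<close>: sets that split into distant clusters are handled cluster by cluster, and up to
  translation only finitely many unsplittable sets interact with the half plane; those that do not
  have finite closures because the family is not supercritical. For given \<open>D\<close> this is a statement about
  finitely many sets \<open>Z\<close>. The algorithm searches for \<open>k\<close> together with certificates that the
  difficulty is at most \<open>k\<close> and not at most \<open>k - 1\<close>.
\<close>

section \<open>Lattice geometry\<close>

text \<open>The obstacle is the lower bound: \<alpha>(u) > k speaks about infinitely many sets
  \<open>Z\<close>, and nothing bounds the size of their closures in advance. Taking
  \<open>u = 0\<close> makes the half plane empty, so percolation far away from the half plane is a
  special case of the same notions. Distances are measured from \<open>Z\<close> itself, and one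
  number \<open>D\<close> that also dominates the range of the rules and the size of
  \<open>u\<close> controls at once the closures, the gap at which clusters decouple, the height at
  which the half plane is no longer felt and the box of sets left to inspect. That \<open>D\<close>
  is searched for as part of the certificate.

  Each certificate depends on a bound \<open>b\<close>. Soundness holds for every \<open>b\<close>,
  completeness for all sufficiently large \<open>b\<close>; hence finitely many certificates share
  one bound, and a single natural number can code a candidate value together with \<open>b\<close>.
  Real vectors enter only to reduce the difficulty to finitely many integer directions and to prove
  closures finite; the checks use integers throughout.\<close>

definition idot :: "site \<Rightarrow> site \<Rightarrow> int" where
  "idot x u = fst x * fst u + snd x * snd u"

definition below :: "site \<Rightarrow> site set" where
  "below u = {x. idot x u < 0}"

definition rot :: "site \<Rightarrow> site" where
  "rot u = (- snd u, fst u)"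

definition nrm :: "site \<Rightarrow> int" where
  "nrm x = max \<bar>fst x\<bar> \<bar>snd x\<bar>"

text \<open>The norm dual to \<open>nrm\<close>: it controls how much \<open>idot\<close> can change
  over a given distance.\<close>

definition nrm1 :: "site \<Rightarrow> int" where
  "nrm1 x = \<bar>fst x\<bar> + \<bar>snd x\<bar>"

definition bp_closed :: "site set set \<Rightarrow> site set \<Rightarrow> bool" where
  "bp_closed \<U> A \<longleftrightarrow> (\<forall>U\<in>\<U>. \<forall>x. (\<forall>y\<in>U. x + y \<in> A) \<longrightarrow> x \<in> A)"

text \<open>For \<open>u = 0\<close> this says exactly that no rule is empty.\<close>

definition int_stable :: "site set set \<Rightarrow> site \<Rightarrow> bool" where
  "int_stable \<U> u \<longleftrightarrow> (\<forall>U\<in>\<U>. \<exists>y\<in>U. 0 \<le> idot y u)"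

definition range_le :: "site set set \<Rightarrow> int \<Rightarrow> bool" where
  "range_le \<U> R \<longleftrightarrow> (\<forall>U\<in>\<U>. \<forall>y\<in>U. nrm y \<le> R)"

lemma idot_add [simp]: "idot (x + y) u = idot x u + idot y u"
  by (simp add: idot_def algebra_simps)

lemma idot_diff [simp]: "idot (x - y) u = idot x u - idot y u"
  by (simp add: idot_def algebra_simps)

lemma idot_minus [simp]: "idot (- x) u = - idot x u"
  by (simp add: idot_def algebra_simps)

lemma idot_0 [simp]: "idot 0 u = 0" "idot x 0 = 0"
  by (simp_all add: idot_def)

text \<open>Through this equation, \<open>u = 0\<close> stands for percolation on the whole lattice
  without a half plane.\<close>

lemma below_0 [simp]: "below 0 = {}"
  by (simp add: below_def)

lemma nrm_nonneg [simp]: "0 \<le> nrm x"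
  by (simp add: nrm_def)

lemma nrm_triangle: "nrm (x + y) \<le> nrm x + nrm y"
  by (auto simp: nrm_def)

lemma nrm_minus_commute: "nrm (x - y) = nrm (y - x)"
  by (simp add: nrm_def abs_minus_commute)

lemma nrm_triangle_diff: "nrm (x - z) \<le> nrm (x - y) + nrm (y - z)"
  using nrm_triangle[of "x - y" "y - z"] by simp

lemma abs_idot_le: "\<bar>idot x u\<bar> \<le> nrm x * nrm1 u"
proof -
  have "\<bar>idot x u\<bar> \<le> \<bar>fst x\<bar> * \<bar>fst u\<bar> + \<bar>snd x\<bar> * \<bar>snd u\<bar>"
    unfolding idot_def by (metis abs_mult abs_triangle_ineq)
  also have "\<dots> \<le> nrm x * \<bar>fst u\<bar> + nrm x * \<bar>snd u\<bar>"
    by (intro add_mono mult_right_mono) (auto simp: nrm_def)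
  finally show ?thesis by (simp add: nrm1_def algebra_simps)
qed

lemma finite_box: "finite {x. nrm x \<le> M}"
proof (rule finite_subset)
  show "{x. nrm x \<le> M} \<subseteq> {-M..M} \<times> {-M..M}" by (auto simp: nrm_def)
qed simp

text \<open>Since \<open>u\<close> and \<open>rot u\<close> are orthogonal, \<open>|u|^2\<close>
  times a coordinate of \<open>x\<close> is a combination of the two inner products whose
  coefficients are, up to sign, coordinates of \<open>u\<close>. An integer is at most its own
  square in absolute value, so these coefficients are at most \<open>|u|^2\<close>, which
  cancels.\<close>

lemma nrm_le_frame:
  assumes "u \<noteq> 0"
  shows "nrm x \<le> \<bar>idot x u\<bar> + \<bar>idot x (rot u)\<bar>"
proof -
  obtain a b p q where x: "x = (a, b)" and u: "u = (p, q)" by (metis surj_pair)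
  let ?s = "idot x u" and ?t = "idot x (rot u)" and ?n = "p * p + q * q"
  have n: "?n > 0" using assms u by (auto simp: sum_squares_gt_zero_iff zero_prod_def)
  have pq: "\<bar>p\<bar> \<le> ?n" "\<bar>q\<bar> \<le> ?n"
  proof -
    have *: "\<bar>r\<bar> \<le> r * r" for r :: int
      using mult_left_mono[of 1 "\<bar>r\<bar>" "\<bar>r\<bar>"] by (cases "r = 0") auto
    show "\<bar>p\<bar> \<le> ?n" "\<bar>q\<bar> \<le> ?n" using *[of p] *[of q] by (simp_all add: add_increasing add_increasing2)
  qed
  have a: "?n * a = ?s * p - ?t * q" and b: "?n * b = ?s * q + ?t * p"
    by (simp_all add: x u idot_def rot_def algebra_simps)
  have key: "\<bar>c\<bar> \<le> \<bar>?s\<bar> + \<bar>?t\<bar>" if "?n * c = ?s * e + ?t * f" "\<bar>e\<bar> \<le> ?n" "\<bar>f\<bar> \<le> ?n" for c e f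
  proof -
    have "?n * \<bar>c\<bar> = \<bar>?s * e + ?t * f\<bar>" using that(1) n by (metis abs_mult abs_of_pos)
    also have "\<dots> \<le> \<bar>?s\<bar> * \<bar>e\<bar> + \<bar>?t\<bar> * \<bar>f\<bar>" by (metis abs_mult abs_triangle_ineq)
    also have "\<dots> \<le> \<bar>?s\<bar> * ?n + \<bar>?t\<bar> * ?n" using that by (intro add_mono mult_left_mono) auto
    finally have "?n * \<bar>c\<bar> \<le> ?n * (\<bar>?s\<bar> + \<bar>?t\<bar>)" by (simp add: algebra_simps)
    then show ?thesis using n by (simp add: mult_le_cancel_left)
  qed
  show ?thesis using key[of a p "-q"] key[of b q p] a b pq by (simp add: nrm_def x)
qed

section \<open>Closures\<close>

lemma bp_closure_superset: "A \<subseteq> bp_closure \<U> A"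
proof -
  have "(bp_step \<U> ^^ 0) A \<subseteq> bp_closure \<U> A" unfolding bp_closure_def by blast
  then show ?thesis by simp
qed

lemma bp_iter_mono: "s \<le> t \<Longrightarrow> (bp_step \<U> ^^ s) A \<subseteq> (bp_step \<U> ^^ t) A"
  by (induction rule: dec_induct) (auto simp: bp_step_def)

text \<open>Rules are finite, so the times at which the sites of \<open>x + U\<close> appear have a
  maximum, and \<open>x\<close> appears one step later.\<close>

lemma bp_closure_closed:
  assumes "update_family \<U>"
  shows "bp_closed \<U> (bp_closure \<U> A)"
  unfolding bp_closed_def
proof (intro ballI allI impI)
  fix U x assume U: "U \<in> \<U>" and x: "\<forall>y\<in>U. x + y \<in> bp_closure \<U> A"
  then obtain t where t: "\<forall>y\<in>U. x + y \<in> (bp_step \<U> ^^ (t y)) A"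
    by (auto simp: bp_closure_def bchoice_iff)
  have "finite U" using assms U by (simp add: update_family_def)
  then have "\<forall>y\<in>U. t y \<le> Max (t ` U)" by simp
  then have "\<forall>y\<in>U. x + y \<in> (bp_step \<U> ^^ Max (t ` U)) A"
    using t bp_iter_mono by blast
  then have "x \<in> (bp_step \<U> ^^ Suc (Max (t ` U))) A"
    using U by (auto simp: bp_step_def)
  then show "x \<in> bp_closure \<U> A" unfolding bp_closure_def by blast
qed

lemma bp_closure_least:
  assumes "A \<subseteq> B" "bp_closed \<U> B"
  shows "bp_closure \<U> A \<subseteq> B"
proof -
  have "(bp_step \<U> ^^ t) A \<subseteq> B" for t
  proof (induction t)
    case 0
    then show ?case using assms by simp
  next
    case (Suc t)
    have "x \<in> B" if "U \<in> \<U>" "(\<lambda>y. x + y) ` U \<subseteq> (bp_step \<U> ^^ t) A" for x U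
      using assms(2) that Suc unfolding bp_closed_def by blast
    moreover have "(bp_step \<U> ^^ Suc t) A =
        (bp_step \<U> ^^ t) A \<union> {x. \<exists>U\<in>\<U>. (\<lambda>y. x + y) ` U \<subseteq> (bp_step \<U> ^^ t) A}"
      by (simp add: bp_step_def)
    ultimately show ?case using Suc by blast
  qed
  then show ?thesis by (auto simp: bp_closure_def)
qed

lemma bp_closure_mono:
  assumes "update_family \<U>" "A \<subseteq> bp_closure \<U> B"
  shows "bp_closure \<U> A \<subseteq> bp_closure \<U> B"
  using assms by (intro bp_closure_least bp_closure_closed)

lemma bp_closed_translate:
  assumes "bp_closed \<U> A"
  shows "bp_closed \<U> ((+) v ` A)"
  unfolding bp_closed_def
proof (intro ballI allI impI)
  fix U x assume U: "U \<in> \<U>" and x: "\<forall>y\<in>U. x + y \<in> (+) v ` A"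
  have "\<forall>y\<in>U. (x - v) + y \<in> A" using x by (fastforce simp: algebra_simps)
  then have "x - v \<in> A" using assms U unfolding bp_closed_def by blast
  then show "x \<in> (+) v ` A" by (metis add.commute diff_add_cancel imageI)
qed

lemma bp_closure_translate:
  assumes "update_family \<U>" "x \<in> bp_closure \<U> A"
  shows "v + x \<in> bp_closure \<U> ((+) v ` A)"
proof -
  have "bp_closed \<U> ((+) (- v) ` bp_closure \<U> ((+) v ` A))"
    using assms by (intro bp_closed_translate bp_closure_closed)
  moreover have "A \<subseteq> (+) (- v) ` bp_closure \<U> ((+) v ` A)"
  proof
    fix a assume "a \<in> A"
    then have "v + a \<in> bp_closure \<U> ((+) v ` A)" using bp_closure_superset by blast
    then show "a \<in> (+) (- v) ` bp_closure \<U> ((+) v ` A)" by (rule rev_image_eqI) simp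
  qed
  ultimately have "x \<in> (+) (- v) ` bp_closure \<U> ((+) v ` A)"
    using bp_closure_least assms(2) by blast
  then show ?thesis by auto
qed

text \<open>Every rule has an element \<open>y\<close> with nonnegative \<open>idot y u\<close>, so
  a new site \<open>x\<close> is never higher than the present site \<open>x + y\<close>.\<close>

lemma bp_closed_below:
  assumes "int_stable \<U> u"
  shows "bp_closed \<U> {x. idot x u < c}"
  using assms unfolding bp_closed_def int_stable_def
  by (smt (verit, ccfv_SIG) idot_add mem_Collect_eq)

lemma below_translate:
  assumes "idot v u = 0"
  shows "(+) v ` below u = below u"
proof
  show "below u \<subseteq> (+) v ` below u"
  proof
    fix x assume "x \<in> below u"
    then show "x \<in> (+) v ` below u"
      using assms by (intro image_eqI[of _ _ "x - v"]) (auto simp: below_def)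
  qed
qed (use assms in \<open>auto simp: below_def\<close>)

section \<open>Infinite closures\<close>

text \<open>Translation by multiples of \<open>v\<close> preserves the half plane, so the step from
  \<open>W\<close> to \<open>W + v\<close> can be repeated from each translate; the closure then
  contains \<open>W + n v\<close> for every \<open>n\<close>.\<close>

lemma infinite_closureI:
  assumes fam: "update_family \<U>"
    and W: "W \<noteq> {}" "W \<inter> below u = {}" "W \<subseteq> bp_closure \<U> (below u \<union> Z)"
    and v: "idot v u = 0" "v \<noteq> 0"
    and shift: "\<And>w. w \<in> W \<Longrightarrow> w + v \<in> bp_closure \<U> (below u \<union> W)"
  shows "infinite (bp_closure \<U> (below u \<union> Z) - below u)"
proof -
  define sh where "sh n = (int n * fst v, int n * snd v)" for n
  have sh0: "sh 0 = 0" and shS: "sh (Suc n) = sh n + v" for n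
    by (simp_all add: sh_def zero_prod_def algebra_simps prod_eq_iff)
  have shu: "idot (sh n) u = 0" for n
    by (induction n) (simp_all add: sh0 shS v)
  have *: "\<forall>w\<in>W. sh n + w \<in> bp_closure \<U> (below u \<union> Z)" for n
  proof (induction n)
    case 0
    then show ?case using W by (auto simp: sh0)
  next
    case (Suc n)
    have eq: "(+) (sh n) ` (below u \<union> W) = below u \<union> (+) (sh n) ` W"
      by (simp add: image_Un below_translate shu)
    have "bp_closure \<U> ((+) (sh n) ` (below u \<union> W)) \<subseteq> bp_closure \<U> (below u \<union> Z)"
      unfolding eq using Suc bp_closure_superset[of "below u \<union> Z" \<U>] by (intro bp_closure_mono[OF fam]) auto
    then show ?case
      using bp_closure_translate[OF fam shift, of _ "sh n"] by (auto simp: shS algebra_simps)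
  qed
  obtain w where w: "w \<in> W" using W by blast
  have "inj (\<lambda>n. sh n + w)"
    using v(2) by (auto intro!: injI simp: sh_def prod_eq_iff)
  then have "infinite (range (\<lambda>n. sh n + w))" using finite_imageD by blast
  moreover have "range (\<lambda>n. sh n + w) \<subseteq> bp_closure \<U> (below u \<union> Z) - below u"
    using * w W(2) by (auto simp: below_def shu)
  ultimately show ?thesis using infinite_super by blast
qed

lemma idot_frame_eq_0:
  assumes "u \<noteq> 0" "idot x u = 0" "idot x (rot u) = 0"
  shows "x = 0"
  using nrm_le_frame[OF assms(1), of x] assms(2,3) by (auto simp: nrm_def prod_eq_iff)

lemma rot_nonzero [simp]: "rot u = 0 \<longleftrightarrow> u = 0"
  by (auto simp: rot_def prod_eq_iff)

lemma idot_rot_self [simp]: "idot (rot u) u = 0" "idot u (rot u) = 0"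
  by (simp_all add: idot_def rot_def)

lemma idot_self_pos: "u \<noteq> 0 \<Longrightarrow> idot u u > 0"
  by (auto simp: idot_def sum_squares_gt_zero_iff prod_eq_iff)

text \<open>By stability, the half plane raised just above the highest site of \<open>Z\<close> is
  closed. The inserted \<open>0\<close> ensures that it contains the original half plane.\<close>

lemma closure_height:
  assumes st: "int_stable \<U> u" and Z: "finite Z"
  obtains h where "0 \<le> h" "\<And>x. x \<in> bp_closure \<U> (below u \<union> Z) - below u \<Longrightarrow> 0 \<le> idot x u \<and> idot x u \<le> h"
proof -
  define h where "h = Max (insert 0 ((\<lambda>z. idot z u) ` Z))"
  have zh: "idot z u \<le> h" if "z \<in> Z" for z
    using that Z by (simp add: h_def)
  have h0: "h \<ge> 0" using Z by (simp add: h_def)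
  have "bp_closure \<U> (below u \<union> Z) \<subseteq> {x. idot x u < h + 1}"
    by (rule bp_closure_least[OF _ bp_closed_below[OF st]]) (use zh h0 in \<open>force simp: below_def\<close>)
  then have "0 \<le> idot x u \<and> idot x u \<le> h" if "x \<in> bp_closure \<U> (below u \<union> Z) - below u" for x
    using that by (auto simp: below_def)
  then show thesis using that h0 by blast
qed

text \<open>
  Beyond \<open>Z\<close>, the part of the closure to one side of a window at least as wide as the range of the
  rules is generated by the window alone. Since the strip of possible heights is finite, two windows
  agree up to translation, and such a window reproduces itself.
\<close>

lemma infinite_closure_side:
  assumes fam: "update_family \<U>" and st: "int_stable \<U> u" and u: "u \<noteq> 0"
    and Z: "finite Z"
    and q: "q = rot u \<or> q = - rot u"
    and unb: "\<And>P. \<exists>x \<in> bp_closure \<U> (below u \<union> Z) - below u. idot x q \<ge> P"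
  shows "\<exists>W v. finite W \<and> W \<noteq> {} \<and> W \<inter> below u = {} \<and> W \<subseteq> bp_closure \<U> (below u \<union> Z) \<and>
     idot v u = 0 \<and> v \<noteq> 0 \<and> (\<forall>w\<in>W. w + v \<in> bp_closure \<U> (below u \<union> W))"
proof -
  define Y where "Y = bp_closure \<U> (below u \<union> Z) - below u"
  obtain h where Yh: "\<And>x. x \<in> Y \<Longrightarrow> 0 \<le> idot x u \<and> idot x u \<le> h"
    unfolding Y_def using closure_height[OF st Z] by metis
  have qu: "idot q u = 0" using q by auto
  have q0: "q \<noteq> 0" using q u by auto
  define N where "N = idot q q"
  have N: "N > 0" unfolding N_def using idot_self_pos q0 by blast
  have finY: "finite (\<Union>\<U>)" using fam by (auto simp: update_family_def)
  \<comment> \<open>The reach of a rule along \<open>q\<close>; the inserted \<open>1\<close> gives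
    the windows positive width.\<close>
  define m where "m = nat (Max (insert 1 ((\<lambda>y. \<bar>idot y q\<bar>) ` \<Union>\<U>)))"
  have m1: "m \<ge> 1"
  proof -
    have "1 \<le> Max (insert 1 ((\<lambda>y. \<bar>idot y q\<bar>) ` \<Union>\<U>))" using finY by (intro Max_ge) auto
    then show ?thesis by (simp add: m_def)
  qed
  have my: "\<bar>idot y q\<bar> \<le> int m" if "U \<in> \<U>" "y \<in> U" for y U
  proof -
    have "\<bar>idot y q\<bar> \<le> Max (insert 1 ((\<lambda>y. \<bar>idot y q\<bar>) ` \<Union>\<U>))"
      using that finY by (intro Max_ge) auto
    then show ?thesis unfolding m_def by linarith
  qed
  \<comment> \<open>A window must be at least as wide as \<open>m\<close>, and consecutive windows
    must differ by a lattice translation along the boundary. Translating by \<open>m\<close> times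
    \<open>q\<close> moves the inner product with \<open>q\<close> by exactly
    \<open>m * N\<close>.\<close>
  define r where "r = int m * N"
  have r: "r \<ge> int m" "r > 0" using N m1 by (simp_all add: r_def mult_le_cancel_left1)
  define P0 where "P0 = Max (insert 0 ((\<lambda>z. idot z q) ` Z)) + 1"
  have P0: "idot z q < P0" if "z \<in> Z" for z
    unfolding P0_def using that Z by (simp add: less_add_one order_le_less_trans zle_add1_eq_le)
  define win where "win i = {x \<in> Y. P0 + int i * r \<le> idot x q \<and> idot x q < P0 + int (Suc i) * r}" for i
  have gen: "x \<in> bp_closure \<U> (below u \<union> win i)" if "x \<in> Y" "P0 + int i * r \<le> idot x q" for x i
  proof -
    \<comment> \<open>The set of closure sites that are generated by window \<open>i\<close>
      whenever they lie past its near edge is closed: a site inside the window is given, and a rule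
      applied beyond the window cannot reach back across it.\<close>
    have "bp_closed \<U> {x \<in> bp_closure \<U> (below u \<union> Z). P0 + int i * r \<le> idot x q \<longrightarrow>
        x \<in> bp_closure \<U> (below u \<union> win i)}" (is "bp_closed \<U> ?C")
      unfolding bp_closed_def
    proof (intro ballI allI impI)
      fix U x assume U: "U \<in> \<U>" and x: "\<forall>y\<in>U. x + y \<in> ?C"
      have xc: "x \<in> bp_closure \<U> (below u \<union> Z)"
        using bp_closure_closed[OF fam] x U unfolding bp_closed_def by blast
      moreover have "x \<in> bp_closure \<U> (below u \<union> win i)" if xi: "P0 + int i * r \<le> idot x q"
      proof (cases "idot x q < P0 + int (Suc i) * r")
        case True
        then have "x \<in> below u \<union> win i" using xi xc by (auto simp: win_def Y_def)
        then show ?thesis using bp_closure_superset by blast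
      next
        case False
        have "x + y \<in> bp_closure \<U> (below u \<union> win i)" if "y \<in> U" for y
        proof -
          have "P0 + int i * r \<le> idot (x + y) q"
            using False my[OF U that] r by (simp add: algebra_simps)
          then show ?thesis using x that by blast
        qed
        then show ?thesis using bp_closure_closed[OF fam] U unfolding bp_closed_def by blast
      qed
      ultimately show "x \<in> ?C" by blast
    qed
    moreover have "below u \<union> Z \<subseteq> ?C"
    proof
      fix z assume z: "z \<in> below u \<union> Z"
      moreover have "z \<in> below u" if "P0 + int i * r \<le> idot z q"
      proof -
        have "0 \<le> int i * r" using r by simp
        then show ?thesis using P0[of z] that z by fastforce
      qed
      ultimately show "z \<in> ?C" using bp_closure_superset by blast
    qed
    ultimately have "bp_closure \<U> (below u \<union> Z) \<subseteq> ?C" by (rule bp_closure_least[rotated])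
    then show ?thesis using that by (auto simp: Y_def)
  qed
  have bH: "bp_closure \<U> (below u) = below u"
    unfolding below_def
    by (intro antisym bp_closure_least[OF subset_refl bp_closed_below[OF st]] bp_closure_superset)
  \<comment> \<open>With an empty window everything past it would be generated by the half plane
    alone, which is already closed.\<close>
  have ne: "win i \<noteq> {}" for i
  proof
    assume "win i = {}"
    obtain x where "x \<in> Y" "idot x q \<ge> P0 + int i * r" using unb unfolding Y_def by blast
    then have "x \<in> below u" using gen[of x i] \<open>win i = {}\<close> bH by simp
    then show False using \<open>x \<in> Y\<close> by (simp add: Y_def)
  qed
  define sh where "sh i = (int i * int m * fst q, int i * int m * snd q)" for i
  have shu: "idot (sh i) u = 0" for i
  proof -
    have "idot (sh i) u = int i * int m * idot q u" by (simp add: sh_def idot_def algebra_simps)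
    then show ?thesis by (simp add: qu)
  qed
  have shq: "idot (sh i) q = int i * r" for i
    by (simp add: sh_def idot_def N_def r_def algebra_simps)
  define B where "B = {x. 0 \<le> idot x u \<and> idot x u \<le> h \<and> P0 \<le> idot x q \<and> idot x q \<le> P0 + r}"
  have qr: "\<bar>idot x q\<bar> = \<bar>idot x (rot u)\<bar>" for x
    using q by (auto simp: idot_def)
  have "B \<subseteq> {x. nrm x \<le> h + \<bar>P0\<bar> + r}"
  proof
    fix x assume "x \<in> B"
    then have "\<bar>idot x u\<bar> \<le> h" "\<bar>idot x q\<bar> \<le> \<bar>P0\<bar> + r" by (auto simp: B_def)
    then show "x \<in> {x. nrm x \<le> h + \<bar>P0\<bar> + r}"
      using nrm_le_frame[OF u, of x] qr[of x] by simp
  qed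
  then have finB: "finite B" using finite_box finite_subset by blast
  have winB: "(\<lambda>x. x - sh i) ` win i \<subseteq> B" for i
  proof (rule image_subsetI)
    fix x assume "x \<in> win i"
    then show "x - sh i \<in> B" using Yh[of x] by (simp add: B_def win_def shu shq algebra_simps)
  qed
  have "\<not> inj (\<lambda>i. (\<lambda>x. x - sh i) ` win i)"
  proof
    assume "inj (\<lambda>i. (\<lambda>x. x - sh i) ` win i)"
    then have "infinite (range (\<lambda>i. (\<lambda>x. x - sh i) ` win i))" using finite_imageD by blast
    moreover have "range (\<lambda>i. (\<lambda>x. x - sh i) ` win i) \<subseteq> Pow B" using winB by blast
    ultimately show False using finB by (meson finite_Pow_iff finite_subset)
  qed
  then obtain i j where ij: "i < j" "(\<lambda>x. x - sh i) ` win i = (\<lambda>x. x - sh j) ` win j"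
    using linorder_injI[of "\<lambda>i. (\<lambda>x. x - sh i) ` win i"] by blast
  let ?W = "win i" and ?v = "sh j - sh i"
  have "finite ((\<lambda>x. x - sh i) ` ?W)" using winB[of i] finB by (rule finite_subset)
  then have "finite ?W" by (rule finite_imageD) (simp add: inj_on_def)
  moreover have "?W \<inter> below u = {}" "?W \<subseteq> bp_closure \<U> (below u \<union> Z)"
    by (auto simp: win_def Y_def)
  moreover have "idot ?v u = 0" by (simp add: shu)
  moreover have "?v \<noteq> 0"
  proof
    assume "?v = 0"
    then have "idot ?v q = 0" by simp
    then show False using shq ij r by simp
  qed
  \<comment> \<open>The translated site lies in window \<open>j\<close>, which is past the near edge
    of window \<open>i\<close>, so window \<open>i\<close> generates it.\<close>
  moreover have "w + ?v \<in> bp_closure \<U> (below u \<union> win i)" if "w \<in> ?W" for w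
  proof -
    have "w - sh i \<in> (\<lambda>x. x - sh j) ` win j" using that ij by blast
    then obtain x where x: "x \<in> win j" "w - sh i = x - sh j" by blast
    then have xe: "x = w + ?v" by (simp add: algebra_simps)
    have "int i * r \<le> int j * r" using ij r by simp
    then have "P0 + int i * r \<le> idot x q" "x \<in> Y" using x by (auto simp: win_def)
    then show ?thesis using gen xe by blast
  qed
  ultimately show ?thesis using ne[of i] by (intro exI[of _ ?W] exI[of _ ?v] conjI) simp_all
qed

text \<open>Heights in the closure are bounded, so an infinite closure must be unbounded towards one
  of the two ends of the strip.\<close>

lemma infinite_closureD:
  assumes fam: "update_family \<U>" and st: "int_stable \<U> u" and u: "u \<noteq> 0" and Z: "finite Z"
    and inf: "infinite (bp_closure \<U> (below u \<union> Z) - below u)"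
  shows "\<exists>W v. finite W \<and> W \<noteq> {} \<and> W \<inter> below u = {} \<and> W \<subseteq> bp_closure \<U> (below u \<union> Z) \<and>
     idot v u = 0 \<and> v \<noteq> 0 \<and> (\<forall>w\<in>W. w + v \<in> bp_closure \<U> (below u \<union> W))"
proof -
  let ?Y = "bp_closure \<U> (below u \<union> Z) - below u"
  obtain h where Yh': "\<And>x. x \<in> ?Y \<Longrightarrow> 0 \<le> idot x u \<and> idot x u \<le> h"
    using closure_height[OF st Z] by metis
  then have Yh: "\<bar>idot x u\<bar> \<le> h" if "x \<in> ?Y" for x
    using Yh'[OF that] by linarith
  have "(\<forall>P. \<exists>x\<in>?Y. idot x (rot u) \<ge> P) \<or> (\<forall>P. \<exists>x\<in>?Y. idot x (- rot u) \<ge> P)"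
  proof (rule ccontr)
    assume "\<not> ?thesis"
    then obtain P Q where PQ: "\<forall>x\<in>?Y. idot x (rot u) < P" "\<forall>x\<in>?Y. idot x (- rot u) < Q"
      by (meson not_le)
    have "?Y \<subseteq> {x. nrm x \<le> h + \<bar>P\<bar> + \<bar>Q\<bar>}"
    proof
      fix x assume x: "x \<in> ?Y"
      have "idot x (- rot u) = - idot x (rot u)" by (simp add: idot_def)
      then have "\<bar>idot x (rot u)\<bar> \<le> \<bar>P\<bar> + \<bar>Q\<bar>" using PQ(1)[rule_format, OF x] PQ(2)[rule_format, OF x] by linarith
      then show "x \<in> {x. nrm x \<le> h + \<bar>P\<bar> + \<bar>Q\<bar>}"
        using nrm_le_frame[OF u, of x] Yh[OF x] by simp
    qed
    then show False using inf finite_box finite_subset by blast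
  qed
  then show ?thesis
    using infinite_closure_side[OF fam st u Z, of "rot u"] infinite_closure_side[OF fam st u Z, of "- rot u"]
    by blast
qed

section \<open>Uniformly finite closures\<close>

text \<open>Any closed superset close to \<open>Z\<close> may serve as \<open>W\<close>, not only
  the closure itself, so a finite candidate can be verified without computing a closure. Distances
  refer to some site of \<open>Z\<close>, which keeps the bound meaningful for widely scattered
  \<open>Z\<close>.\<close>

definition contained :: "site set set \<Rightarrow> site \<Rightarrow> int \<Rightarrow> site set \<Rightarrow> bool" where
  "contained \<U> u D Z \<longleftrightarrow>
     (\<exists>W. Z \<subseteq> W \<and> (\<forall>x\<in>W. \<exists>z\<in>Z. nrm (x - z) \<le> D) \<and> bp_closed \<U> (below u \<union> W))"

lemma contained_mono: "contained \<U> u D Z \<Longrightarrow> D \<le> D' \<Longrightarrow> contained \<U> u D' Z"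
  unfolding contained_def by (meson order_trans)

lemma bp_closed_below': "int_stable \<U> u \<Longrightarrow> bp_closed \<U> (below u)"
  unfolding below_def by (rule bp_closed_below)

lemma contained_empty: "int_stable \<U> u \<Longrightarrow> contained \<U> u D {}"
  unfolding contained_def using bp_closed_below' by (intro exI[of _ "{}"]) auto

lemma finite_thickening:
  assumes "finite Z" "\<forall>x\<in>W. \<exists>z\<in>Z. nrm (x - z) \<le> D"
  shows "finite W"
proof (rule finite_subset)
  show "W \<subseteq> (\<Union>z\<in>Z. (+) z ` {x. nrm x \<le> D})"
  proof
    fix x assume "x \<in> W"
    then obtain z where z: "z \<in> Z" "nrm (x - z) \<le> D" using assms by blast
    have "x = z + (x - z)" by simp
    then show "x \<in> (\<Union>z\<in>Z. (+) z ` {x. nrm x \<le> D})" using z by blast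
  qed
  show "finite (\<Union>z\<in>Z. (+) z ` {x. nrm x \<le> D})" using assms finite_box by blast
qed

lemma contained_finite:
  assumes "contained \<U> u D Z" "finite Z"
  shows "finite (bp_closure \<U> (below u \<union> Z) - below u)"
proof -
  obtain W where W: "Z \<subseteq> W" "\<forall>x\<in>W. \<exists>z\<in>Z. nrm (x - z) \<le> D" "bp_closed \<U> (below u \<union> W)"
    using assms(1) unfolding contained_def by blast
  have "bp_closure \<U> (below u \<union> Z) \<subseteq> below u \<union> W" using W by (intro bp_closure_least) auto
  moreover have "finite W" using W assms finite_thickening by blast
  ultimately show ?thesis by (meson Diff_subset_conv finite_subset)
qed

lemma finite_contained:
  assumes fam: "update_family \<U>" and st: "int_stable \<U> u"
    and Z: "finite Z" "Z \<inter> below u = {}"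
    and fin: "finite (bp_closure \<U> (below u \<union> Z) - below u)"
  shows "\<exists>D. contained \<U> u D Z"
proof (cases "Z = {}")
  case True
  then show ?thesis using contained_empty[OF st] by blast
next
  case False
  then obtain z where z: "z \<in> Z" by blast
  let ?W = "bp_closure \<U> (below u \<union> Z) - below u"
  let ?D = "Max ((\<lambda>x. nrm (x - z)) ` ?W)"
  have "Z \<subseteq> ?W" using Z bp_closure_superset[of "below u \<union> Z" \<U>] by blast
  moreover have "\<forall>x\<in>?W. \<exists>z\<in>Z. nrm (x - z) \<le> ?D" using z fin by (metis Max_ge finite_imageI imageI)
  moreover have "below u \<union> ?W = bp_closure \<U> (below u \<union> Z)"
    using bp_closure_superset[of "below u \<union> Z" \<U>] by blast
  then have "bp_closed \<U> (below u \<union> ?W)" using bp_closure_closed[OF fam] by simp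
  ultimately show ?thesis unfolding contained_def by blast
qed

text \<open>A rule application using sites of both \<open>W1\<close> and \<open>W2\<close> would
  place some \<open>z1\<close> and \<open>z2\<close> each within \<open>D + R\<close> of the same
  site. Beyond the distance \<open>2 * D + 2 * R\<close> every application therefore lives in one of
  the two parts.\<close>

lemma contained_Un:
  assumes st: "int_stable \<U> u" and R: "range_le \<U> R"
    and Z: "contained \<U> u D Z1" "contained \<U> u D Z2"
    and far: "\<And>z1 z2. z1 \<in> Z1 \<Longrightarrow> z2 \<in> Z2 \<Longrightarrow> nrm (z1 - z2) > 2 * D + 2 * R"
  shows "contained \<U> u D (Z1 \<union> Z2)"
proof -
  obtain W1 where W1: "Z1 \<subseteq> W1" "\<forall>x\<in>W1. \<exists>z\<in>Z1. nrm (x - z) \<le> D" "bp_closed \<U> (below u \<union> W1)"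
    using Z unfolding contained_def by blast
  obtain W2 where W2: "Z2 \<subseteq> W2" "\<forall>x\<in>W2. \<exists>z\<in>Z2. nrm (x - z) \<le> D" "bp_closed \<U> (below u \<union> W2)"
    using Z unfolding contained_def by blast
  have sep: False if U: "U \<in> \<U>" "y1 \<in> U" "y2 \<in> U" "x + y1 \<in> W1" "x + y2 \<in> W2" for U x y1 y2
  proof -
    obtain z1 where z1: "z1 \<in> Z1" "nrm (x + y1 - z1) \<le> D" using bspec[OF W1(2) U(4)] by blast
    obtain z2 where z2: "z2 \<in> Z2" "nrm (x + y2 - z2) \<le> D" using bspec[OF W2(2) U(5)] by blast
    note z = z1(1) z2(1) z1(2) z2(2)
    have y: "nrm y1 \<le> R" "nrm y2 \<le> R" using R U by (auto simp: range_le_def)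
    have "nrm (z1 - x) \<le> D + R"
      using nrm_triangle[of "z1 - (x + y1)" y1] z y nrm_minus_commute[of z1 "x + y1"] by (simp add: algebra_simps)
    moreover have "nrm (x - z2) \<le> D + R"
      using nrm_triangle[of "x + y2 - z2" "- y2"] z y nrm_minus_commute[of 0 "y2"] by (simp add: algebra_simps)
    ultimately show False using far[OF z(1,2)] nrm_triangle_diff[of z1 z2 x] by linarith
  qed
  have "bp_closed \<U> (below u \<union> (W1 \<union> W2))"
    unfolding bp_closed_def
  proof (intro ballI allI impI)
    fix U x assume U: "U \<in> \<U>" and x: "\<forall>y\<in>U. x + y \<in> below u \<union> (W1 \<union> W2)"
    have "(\<forall>y\<in>U. x + y \<in> below u \<union> W1) \<or> (\<forall>y\<in>U. x + y \<in> below u \<union> W2)"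
      using sep[OF U] x by blast
    then show "x \<in> below u \<union> (W1 \<union> W2)" using W1(3) W2(3) U unfolding bp_closed_def by blast
  qed
  moreover have "\<forall>x\<in>W1 \<union> W2. \<exists>z\<in>Z1 \<union> Z2. nrm (x - z) \<le> D" using W1(2) W2(2) by blast
  ultimately show ?thesis using W1(1) W2(1) unfolding contained_def by (intro exI[of _ "W1 \<union> W2"]) blast
qed

lemma contained_translate:
  assumes "contained \<U> u D Z" "idot v u = 0"
  shows "contained \<U> u D ((+) v ` Z)"
proof -
  obtain W where W: "Z \<subseteq> W" "\<forall>x\<in>W. \<exists>z\<in>Z. nrm (x - z) \<le> D" "bp_closed \<U> (below u \<union> W)"
    using assms(1) unfolding contained_def by blast
  have "bp_closed \<U> (below u \<union> (+) v ` W)"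
    using bp_closed_translate[OF W(3), of v] by (simp add: image_Un below_translate assms(2))
  then show ?thesis using W(1,2) unfolding contained_def by (intro exI[of _ "(+) v ` W"]) auto
qed

text \<open>\<open>W\<close> descends at most \<open>D\<close> below \<open>Z\<close>, and two sites
  of one rule are at most \<open>2 * R\<close> apart. At this height no rule can touch
  \<open>W\<close> and the half plane at the same time.\<close>

lemma contained_high:
  assumes st: "int_stable \<U> u" and R: "range_le \<U> R"
    and Z: "contained \<U> 0 D Z" and high: "\<And>z. z \<in> Z \<Longrightarrow> idot z u \<ge> (D + 2 * R) * nrm1 u"
  shows "contained \<U> u D Z"
proof -
  obtain W where W: "Z \<subseteq> W" "\<forall>x\<in>W. \<exists>z\<in>Z. nrm (x - z) \<le> D" "bp_closed \<U> W"
    using Z unfolding contained_def by auto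
  have n1: "nrm1 u \<ge> 0" by (simp add: nrm1_def)
  have "bp_closed \<U> (below u \<union> W)"
    unfolding bp_closed_def
  proof (intro ballI allI impI)
    fix U x assume U: "U \<in> \<U>" and x: "\<forall>y\<in>U. x + y \<in> below u \<union> W"
    show "x \<in> below u \<union> W"
    proof (cases "\<exists>y\<in>U. x + y \<in> W")
      case False
      then show ?thesis using bp_closed_below'[OF st] U x unfolding bp_closed_def by blast
    next
      case True
      then obtain y z where y: "y \<in> U" "z \<in> Z" "nrm (x + y - z) \<le> D" using W(2) by blast
      have "x + y' \<notin> below u" if y': "y' \<in> U" for y'
      proof -
        have "\<bar>idot (x + y - z) u\<bar> \<le> D * nrm1 u"
          using abs_idot_le[of "x + y - z" u] mult_right_mono[OF y(3) n1] by linarith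
        moreover have "\<bar>idot y u\<bar> \<le> R * nrm1 u" "\<bar>idot y' u\<bar> \<le> R * nrm1 u"
          using R U y(1) y' abs_idot_le[of y u] abs_idot_le[of y' u] n1
          unfolding range_le_def by (meson mult_right_mono order_trans)+
        moreover have "idot z u \<ge> D * nrm1 u + 2 * (R * nrm1 u)" using high[OF y(2)] by (simp add: algebra_simps)
        ultimately show ?thesis by (simp add: below_def)
      qed
      then show ?thesis using x W(3) U unfolding bp_closed_def by blast
    qed
  qed
  then show ?thesis using W unfolding contained_def by blast
qed

text \<open>Let the radius around \<open>z0\<close> grow in steps of \<open>L\<close>. If a step
  adds no site, the ball and its complement in \<open>Z\<close> are more than \<open>L\<close>
  apart; and before \<open>card Z\<close> steps are over, some step must add none.\<close>

lemma split_or_close: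
  fixes L :: int
  assumes Z: "finite Z" "z0 \<in> Z" and L: "L \<ge> 0"
  shows "(\<exists>Z1 Z2. Z1 \<union> Z2 = Z \<and> Z1 \<inter> Z2 = {} \<and> Z1 \<noteq> {} \<and> Z2 \<noteq> {} \<and>
            (\<forall>z1\<in>Z1. \<forall>z2\<in>Z2. nrm (z1 - z2) > L)) \<or>
         (\<forall>z\<in>Z. nrm (z - z0) \<le> int (card Z) * L)"
proof -
  define B where "B i = {z \<in> Z. nrm (z - z0) \<le> int i * L}" for i
  have BZ: "B i \<subseteq> Z" and z0: "z0 \<in> B i" for i
    using Z L by (auto simp: B_def nrm_def)
  have mono: "B i \<subseteq> B (Suc i)" for i
    using L by (auto simp: B_def algebra_simps)
  show ?thesis
  proof (cases "\<exists>i<card Z. B (Suc i) = B i")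
    case True
    then obtain i where i: "i < card Z" "B (Suc i) = B i" by blast
    have far: "nrm (z1 - z2) > L" if "z1 \<in> B i" "z2 \<in> Z - B i" for z1 z2
    proof -
      have "z2 \<in> Z" "z2 \<notin> B (Suc i)" using that i(2) by simp_all
      then have "nrm (z2 - z0) > int (Suc i) * L" unfolding B_def by simp
      moreover have "nrm (z1 - z0) \<le> int i * L" using that(1) unfolding B_def by simp
      moreover have "int (Suc i) * L = int i * L + L" by (simp add: algebra_simps)
      ultimately show ?thesis
        using nrm_triangle_diff[of z2 z0 z1] nrm_minus_commute[of z1 z2] by linarith
    qed
    show ?thesis
    proof (cases "B i = Z")
      case True
      have "int i * L \<le> int (card Z) * L" using i L by (intro mult_right_mono) auto
      moreover have "nrm (z - z0) \<le> int i * L" if "z \<in> Z" for z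
        using that True unfolding B_def by blast
      ultimately show ?thesis by (meson order_trans)
    next
      case False
      have "B i \<union> (Z - B i) = Z" "B i \<inter> (Z - B i) = {}" "B i \<noteq> {}" "Z - B i \<noteq> {}"
        using False BZ[of i] z0[of i] by blast+
      then show ?thesis using far
        by (intro disjI1 exI[of _ "B i"] exI[of _ "Z - B i"]) simp
    qed
  next
    case False
    \<comment> \<open>If no step stalled, ball number \<open>card Z\<close> would have more sites
      than \<open>Z\<close>.\<close>
    have "i \<le> card Z \<Longrightarrow> Suc i \<le> card (B i)" for i
    proof (induction i)
      case 0
      have "0 < card (B 0)" using z0[of 0] finite_subset[OF BZ[of 0] Z(1)] card_gt_0_iff by blast
      then show ?case by simp
    next
      case (Suc i)
      have "B (Suc i) \<noteq> B i" using False Suc.prems by simp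
      then have "B i \<subset> B (Suc i)" using mono[of i] by blast
      then have "card (B i) < card (B (Suc i))"
        using Z(1) BZ[of "Suc i"] by (meson finite_subset psubset_card_mono)
      then show ?case using Suc by simp
    qed
    from this[of "card Z"] have False
      using card_mono[OF Z(1) BZ[of "card Z"]] by simp
    then show ?thesis ..
  qed
qed

text \<open>The induction step on the number of sites. A set that splits is handled by the
  hypothesis for fewer sites; any other set has bounded diameter. If it is high, it is compared with
  percolation without a half plane; if it has a low site, it can be slid along the boundary into a
  fixed box. \<open>M\<close> adds up the diameter, the height of the low site and the error
  \<open>idot u u\<close> of sliding by whole multiples of \<open>rot u\<close>.\<close>

lemma contained_Suc:
  assumes st: "int_stable \<U> u" and R: "range_le \<U> R" "0 \<le> R" and D: "0 \<le> D" "D \<le> D1" "D1 \<le> D2"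
    and IH: "\<And>Z. finite Z \<Longrightarrow> Z \<inter> below u = {} \<Longrightarrow> card Z \<le> k \<Longrightarrow> contained \<U> u D Z"
    and shape: "\<And>Z. Z \<subseteq> {x. nrm x \<le> int (Suc k) * (2 * D + 2 * R)} \<Longrightarrow> card Z \<le> Suc k \<Longrightarrow>
      contained \<U> 0 D1 Z"
    and low: "\<And>Z. Z \<subseteq> {x. nrm x \<le> M} \<Longrightarrow> Z \<inter> below u = {} \<Longrightarrow> card Z \<le> Suc k \<Longrightarrow>
      contained \<U> u D2 Z"
    and M: "int (Suc k) * (2 * D + 2 * R) + (D1 + 2 * R) * nrm1 u + idot u u \<le> M"
    and Z: "finite Z" "Z \<inter> below u = {}" "card Z \<le> Suc k"
  shows "contained \<U> u D2 Z"
proof (cases "\<exists>Z1 Z2. Z1 \<union> Z2 = Z \<and> Z1 \<inter> Z2 = {} \<and> Z1 \<noteq> {} \<and> Z2 \<noteq> {} \<and>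
            (\<forall>z1\<in>Z1. \<forall>z2\<in>Z2. nrm (z1 - z2) > 2 * D + 2 * R)")
  case True
  then obtain Z1 Z2 where Z12: "Z1 \<union> Z2 = Z" "Z1 \<inter> Z2 = {}" "Z1 \<noteq> {}" "Z2 \<noteq> {}"
    "\<forall>z1\<in>Z1. \<forall>z2\<in>Z2. nrm (z1 - z2) > 2 * D + 2 * R" by blast
  have f: "finite Z1" "finite Z2" using Z12(1) Z(1) by auto
  then have c: "card Z1 > 0" "card Z2 > 0" using Z12 by (auto simp: card_gt_0_iff)
  have "card Z = card Z1 + card Z2" using card_Un_disjoint[OF f Z12(2)] Z12(1) by simp
  then have "contained \<U> u D Z1" "contained \<U> u D Z2"
    using IH[OF f(1)] IH[OF f(2)] c Z Z12(1) by auto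
  then have "contained \<U> u D Z" using contained_Un[OF st R(1), of D Z1 Z2] Z12(1,5) by simp
  then show ?thesis using D contained_mono by (meson order_trans)
next
  case nosplit: False
  have close: "nrm (z - z0) \<le> int (Suc k) * (2 * D + 2 * R)" if "z0 \<in> Z" "z \<in> Z" for z z0
  proof -
    have L: "2 * D + 2 * R \<ge> 0" using D R by simp
    have "nrm (z - z0) \<le> int (card Z) * (2 * D + 2 * R)"
      using split_or_close[OF Z(1) that(1) L] nosplit that(2) by blast
    also have "\<dots> \<le> int (Suc k) * (2 * D + 2 * R)" using Z(3) L by (intro mult_right_mono) auto
    finally show ?thesis .
  qed
  have card_tr: "card ((+) v ` Z) \<le> Suc k" for v using card_image_le[OF Z(1)] Z(3) order_trans by blast
  have tr_tr: "(+) v ` (+) (- v) ` A = A" for v and A :: "site set"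
    by (simp add: image_image)
  show ?thesis
  proof (cases "\<forall>z\<in>Z. idot z u \<ge> (D1 + 2 * R) * nrm1 u")
    case True
    show ?thesis
    proof (cases "Z = {}")
      case True
      then show ?thesis using contained_empty[OF st] by simp
    next
      case False
      then obtain z0 where z0: "z0 \<in> Z" by blast
      \<comment> \<open>Without a half plane every translation is allowed, so one site of the set is
        moved to the origin.\<close>
      have "contained \<U> 0 D1 ((+) (- z0) ` Z)"
      proof (rule shape[OF _ card_tr])
        show "(+) (- z0) ` Z \<subseteq> {x. nrm x \<le> int (Suc k) * (2 * D + 2 * R)}"
        proof (rule image_subsetI)
          fix z assume "z \<in> Z"
          then show "- z0 + z \<in> {x. nrm x \<le> int (Suc k) * (2 * D + 2 * R)}" using close[OF z0, of z] by simp
        qed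
      qed
      then have "contained \<U> 0 D1 Z" using contained_translate[of \<U> 0 D1 "(+) (- z0) ` Z" z0] unfolding tr_tr by simp
      then have "contained \<U> u D1 Z" using contained_high[OF st R(1), of D1 Z] True by simp
      then show ?thesis using D contained_mono by blast
    qed
  next
    case False
    then obtain z0 where z0: "z0 \<in> Z" "idot z0 u < (D1 + 2 * R) * nrm1 u" by force
    have z0b: "idot z0 u \<ge> 0" using z0 Z(2) by (auto simp: below_def)
    have u: "u \<noteq> 0" using z0(2) by (auto simp: nrm1_def)
    define n where "n = idot u u"
    have n: "n > 0" unfolding n_def using idot_self_pos u by blast
    \<comment> \<open>Rounded division: subtracting \<open>m\<close> copies of \<open>rot u\<close>
      leaves an offset along the boundary smaller than \<open>|u|^2\<close>.\<close>
    define m where "m = idot z0 (rot u) div n"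
    define v where "v = (m * fst (rot u), m * snd (rot u))"
    have vu: "idot v u = 0" by (simp add: v_def idot_def rot_def)
    have vq: "idot v (rot u) = m * n" by (simp add: v_def idot_def rot_def n_def algebra_simps)
    have z1: "\<bar>idot (z0 - v) (rot u)\<bar> \<le> n"
      using n pos_mod_bound[OF n, of "idot z0 (rot u)"] pos_mod_sign[OF n, of "idot z0 (rot u)"]
      by (simp add: vq m_def minus_div_mult_eq_mod)
    have z1n: "nrm (z0 - v) \<le> (D1 + 2 * R) * nrm1 u + n"
      using nrm_le_frame[OF u, of "z0 - v"] z1 z0(2) z0b vu by simp
    have "(+) (- v) ` Z \<subseteq> {x. nrm x \<le> M}"
    proof
      fix x assume "x \<in> (+) (- v) ` Z"
      then obtain z where z: "z \<in> Z" "x = z - v" by auto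
      have "nrm x \<le> nrm (z - z0) + nrm (z0 - v)" using nrm_triangle_diff z by blast
      then show "x \<in> {x. nrm x \<le> M}" using close[OF z0(1) z(1)] z1n M by (simp add: n_def)
    qed
    moreover have "(+) (- v) ` Z \<inter> below u = {}" using Z(2) vu by (auto simp: below_def)
    ultimately have "contained \<U> u D2 ((+) (- v) ` Z)" by (rule low[OF _ _ card_tr])
    then show ?thesis using contained_translate[of \<U> u D2 "(+) (- v) ` Z" v] vu unfolding tr_tr by simp
  qed
qed

lemma uniform_bound:
  fixes P :: "int \<Rightarrow> 'a \<Rightarrow> bool"
  assumes "finite F" "\<And>Z. Z \<in> F \<Longrightarrow> \<exists>D. P D Z" "\<And>D D' Z. P D Z \<Longrightarrow> D \<le> D' \<Longrightarrow> P D' Z"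
  shows "\<exists>D\<ge>D0. \<forall>Z\<in>F. P D Z"
  using assms(1,2)
proof (induction F rule: finite_induct)
  case (insert Z F)
  then obtain D where D: "D \<ge> D0" "\<forall>Z\<in>F. P D Z" by auto
  obtain D' where "P D' Z" using insert by blast
  then show ?case using D assms(3) by (intro exI[of _ "max D D'"]) (auto intro: assms(3))
qed auto

text \<open>Each additional site leaves only finitely many new configurations to bound. The
  distances \<open>D\<close>, \<open>D1\<close>, \<open>D2\<close> grow in this order because the
  set of shapes depends on \<open>D\<close> and the box depends on \<open>D1\<close>.\<close>

lemma contained_exists:
  assumes fam: "update_family \<U>" and st: "int_stable \<U> u" "int_stable \<U> 0"
    and fin0: "\<And>Z. finite Z \<Longrightarrow> finite (bp_closure \<U> Z)"
    and finu: "\<And>Z. finite Z \<Longrightarrow> Z \<inter> below u = {} \<Longrightarrow> card Z \<le> k \<Longrightarrow>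
       finite (bp_closure \<U> (below u \<union> Z) - below u)"
  shows "\<exists>D\<ge>0. \<forall>Z. finite Z \<longrightarrow> Z \<inter> below u = {} \<longrightarrow> card Z \<le> k \<longrightarrow> contained \<U> u D Z"
  using finu
proof (induction k)
  case 0
  then show ?case using contained_empty[OF st(1)] by (intro exI[of _ 0]) auto
next
  case (Suc k)
  then obtain D where D: "D \<ge> 0"
    "\<And>Z. finite Z \<Longrightarrow> Z \<inter> below u = {} \<Longrightarrow> card Z \<le> k \<Longrightarrow> contained \<U> u D Z"
    by (metis le_SucI)
  have "finite (\<Union>\<U>)" using fam by (auto simp: update_family_def)
  then have "\<exists>R\<ge>0. \<forall>y\<in>\<Union>\<U>. nrm y \<le> R" by (rule uniform_bound) auto
  then obtain R where R: "R \<ge> 0" "\<forall>y\<in>\<Union>\<U>. nrm y \<le> R" by blast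
  then have Rr: "range_le \<U> R" by (auto simp: range_le_def)
  let ?K = "int (Suc k) * (2 * D + 2 * R)"
  have "\<exists>D1\<ge>D. \<forall>Z\<in>Pow {x. nrm x \<le> ?K}. contained \<U> 0 D1 Z"
  proof (rule uniform_bound)
    fix Z assume "Z \<in> Pow {x. nrm x \<le> ?K}"
    then have "finite Z" using finite_subset[OF _ finite_box] by simp
    then show "\<exists>D. contained \<U> 0 D Z" using fin0 by (intro finite_contained[OF fam st(2)]) auto
  qed (use finite_box contained_mono in auto)
  then obtain D1 where D1: "D1 \<ge> D" "\<forall>Z\<in>Pow {x. nrm x \<le> ?K}. contained \<U> 0 D1 Z" by blast
  let ?M = "?K + (D1 + 2 * R) * nrm1 u + idot u u"
  let ?F = "{Z. Z \<subseteq> {x. nrm x \<le> ?M} \<and> Z \<inter> below u = {} \<and> card Z \<le> Suc k}"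
  have "\<exists>D2\<ge>D1. \<forall>Z\<in>?F. contained \<U> u D2 Z"
  proof (rule uniform_bound)
    have "?F \<subseteq> Pow {x. nrm x \<le> ?M}" by blast
    then show "finite ?F" by (rule finite_subset) (intro finite_Pow_iff[THEN iffD2] finite_box)
    fix Z assume Z: "Z \<in> ?F"
    then have "Z \<subseteq> {x. nrm x \<le> ?M}" by blast
    then have "finite Z" by (rule finite_subset[OF _ finite_box])
    then show "\<exists>D. contained \<U> u D Z" using Suc.prems Z by (intro finite_contained[OF fam st(1)]) auto
  qed (use contained_mono in auto)
  then obtain D2 where D2: "D2 \<ge> D1" "\<forall>Z\<in>?F. contained \<U> u D2 Z" by blast
  have "contained \<U> u D2 Z" if "finite Z" "Z \<inter> below u = {}" "card Z \<le> Suc k" for Z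
    by (rule contained_Suc[OF st(1) Rr R(1) D(1) D1(1) D2(1) D(2) _ _ order_refl that])
      (use D1 D2 in auto)
  then show ?case using D D1 D2 by (intro exI[of _ D2]) auto
qed

text \<open>The verifiable counterpart of the existence result: all distances and the range are
  taken to be the same \<open>D\<close>, so one box serves every cardinality up to \<open>k\<close>.
  The diameter contributes \<open>4 * k * D\<close>, the height of a low site at most
  \<open>3 * D * D\<close>, and \<open>idot u u\<close> at most \<open>D * D\<close>.\<close>

lemma contained_from_box:
  assumes st: "int_stable \<U> u" and R: "range_le \<U> D" and D: "nrm1 u \<le> D"
    and M: "4 * int k * D + 4 * D * D \<le> M"
    and shape: "\<And>Z. Z \<subseteq> {x. nrm x \<le> M} \<Longrightarrow> card Z \<le> k \<Longrightarrow> contained \<U> 0 D Z"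
    and low: "\<And>Z. Z \<subseteq> {x. nrm x \<le> M} \<Longrightarrow> Z \<inter> below u = {} \<Longrightarrow> card Z \<le> k \<Longrightarrow> contained \<U> u D Z"
    and Z: "finite Z" "Z \<inter> below u = {}" "card Z \<le> k"
  shows "contained \<U> u D Z"
proof -
  have D0: "0 \<le> D" using D by (simp add: nrm1_def)
  have uu: "idot u u \<le> D * D"
  proof -
    have "idot u u \<le> nrm u * nrm1 u" using abs_idot_le[of u u] by simp
    also have "\<dots> \<le> D * D" using D D0 by (intro mult_mono) (auto simp: nrm_def nrm1_def)
    finally show ?thesis .
  qed
  have uD: "(D + 2 * D) * nrm1 u \<le> 3 * D * D" using D D0 mult_left_mono[OF D, of "3 * D"] by simp
  have "\<forall>Z. finite Z \<longrightarrow> Z \<inter> below u = {} \<longrightarrow> card Z \<le> j \<longrightarrow> contained \<U> u D Z" if "j \<le> k" for j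
    using that
  proof (induction j)
    case 0
    then show ?case using contained_empty[OF st(1)] by auto
  next
    case (Suc j)
    have jk: "int (Suc j) * (2 * D + 2 * D) \<le> 4 * int k * D"
      using Suc.prems D0 mult_right_mono[of "int (Suc j)" "int k" "4 * D"] by simp
    have jM: "int (Suc j) * (2 * D + 2 * D) \<le> M"
    proof -
      have "0 \<le> D * D" by simp
      then show ?thesis using jk M by linarith
    qed
    have M': "int (Suc j) * (2 * D + 2 * D) + (D + 2 * D) * nrm1 u + idot u u \<le> M"
      using jk M uu uD by linarith
    show ?case
    proof (intro allI impI)
      fix Z assume Z: "finite Z" "Z \<inter> below u = {}" "card Z \<le> Suc j"
      show "contained \<U> u D Z"
      proof (rule contained_Suc[OF st R D0 D0 order_refl order_refl _ _ _ M' Z])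
        show "contained \<U> u D Z" if "finite Z" "Z \<inter> below u = {}" "card Z \<le> j" for Z
          using Suc that by simp
        show "contained \<U> 0 D Z"
          if "Z \<subseteq> {x. nrm x \<le> int (Suc j) * (2 * D + 2 * D)}" "card Z \<le> Suc j" for Z
          using that jM Suc.prems by (intro shape) auto
        show "contained \<U> u D Z" if "Z \<subseteq> {x. nrm x \<le> M}" "Z \<inter> below u = {}" "card Z \<le> Suc j" for Z
          using that Suc.prems by (intro low) auto
      qed
    qed
  qed
  then show ?thesis using Z by blast
qed

section \<open>Directions\<close>

text \<open>For nonzero vectors this is positive exactly when \<open>b\<close> lies counterclockwise
  of \<open>a\<close> by less than a half turn.\<close>

definition det2 :: "real \<times> real \<Rightarrow> real \<times> real \<Rightarrow> real" where
  "det2 a b = fst a * snd b - snd a * fst b"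

definition rrot :: "real \<times> real \<Rightarrow> real \<times> real" where
  "rrot u = (- snd u, fst u)"

text \<open>Symmetric under negation, so that the \<open>rot\<close> images contain both directions
  orthogonal to each rule element; these are the endpoints of the arcs. The elements of
  \<open>dirs\<close> themselves are the candidate midpoints of semicircles.\<close>

definition dirs :: "site set set \<Rightarrow> site set" where
  "dirs \<U> = \<Union>\<U> \<union> uminus ` \<Union>\<U>"

definition generic :: "site set set \<Rightarrow> real \<times> real \<Rightarrow> bool" where
  "generic \<U> u \<longleftrightarrow> (\<forall>y\<in>\<Union>\<U>. site_vec y \<bullet> u \<noteq> 0)"

text \<open>
  The signs of \<open>idot y e\<close> and \<open>idot y (rot e)\<close>, compared lexicographically, give the sign of \<open>y\<close>
  on the directions just counterclockwise of \<open>e\<close>.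
\<close>

definition lex_unstable :: "site set set \<Rightarrow> site \<Rightarrow> bool" where
  "lex_unstable \<U> e \<longleftrightarrow> (\<exists>U\<in>\<U>. \<forall>y\<in>U. idot y e < 0 \<or> idot y e = 0 \<and> idot y (rot e) < 0)"

definition spread :: "site set set \<Rightarrow> site \<Rightarrow> nat \<Rightarrow> bool" where
  "spread \<U> e k \<longleftrightarrow> (\<exists>Z. finite Z \<and> Z \<inter> below e = {} \<and> card Z \<le> k \<and>
     infinite (bp_closure \<U> (below e \<union> Z) - below e))"

text \<open>The first clause makes every open arc that meets the semicircle around \<open>w\<close>
  unstable, each arc being named by its clockwise endpoint \<open>e\<close>; the case of inner
  product zero is the arc starting at the end of the semicircle. The second clause treats the
  remaining stable directions, which are arc endpoints.\<close>

definition good :: "site set set \<Rightarrow> nat \<Rightarrow> site \<Rightarrow> bool" where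
  "good \<U> k w \<longleftrightarrow>
     (\<forall>e\<in>rot ` dirs \<U>. idot w e > 0 \<or> idot w e = 0 \<and> idot w (rot e) > 0 \<longrightarrow> lex_unstable \<U> e) \<and>
     (\<forall>e\<in>rot ` dirs \<U>. idot w e > 0 \<and> int_stable \<U> e \<longrightarrow> spread \<U> e k)"

section \<open>Real directions and integer vectors\<close>

lemma inner_prod2: "(a::real \<times> real) \<bullet> b = fst a * fst b + snd a * snd b"
  by (simp add: inner_prod_def)

lemma inner_site_vec: "site_vec x \<bullet> site_vec u = of_int (idot x u)"
  by (simp add: site_vec_def idot_def inner_prod2)

lemma site_vec_minus: "site_vec (- x) = - site_vec x"
  by (simp add: site_vec_def)

lemma site_vec_rot: "site_vec (rot x) = rrot (site_vec x)"
  by (simp add: site_vec_def rot_def rrot_def)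

lemma site_vec_eq_0 [simp]: "site_vec x = 0 \<longleftrightarrow> x = 0"
  by (simp add: site_vec_def prod_eq_iff)

lemma rot_minus: "rot (- x) = - rot x"
  by (simp add: rot_def)

lemma half_plane_scale: "c > 0 \<Longrightarrow> half_plane (c *\<^sub>R u) = half_plane u"
  by (simp add: half_plane_def mult_less_0_iff)

lemma half_plane_site: "half_plane (site_vec e) = below e"
  by (simp add: half_plane_def below_def inner_site_vec)

lemma unstable_scale: "c > 0 \<Longrightarrow> unstable \<U> (c *\<^sub>R u) \<longleftrightarrow> unstable \<U> u"
  by (simp add: unstable_def half_plane_scale)

lemma unstable_site: "unstable \<U> (site_vec e) \<longleftrightarrow> \<not> int_stable \<U> e"
  by (auto simp: unstable_def half_plane_site int_stable_def below_def not_le subset_iff)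
     (metis not_le surj_pair)+

lemma unstable_cong:
  assumes "\<And>y. y \<in> \<Union>\<U> \<Longrightarrow> site_vec y \<bullet> u < 0 \<longleftrightarrow> site_vec y \<bullet> u' < 0"
  shows "unstable \<U> u \<longleftrightarrow> unstable \<U> u'"
proof -
  have "U \<subseteq> half_plane u \<longleftrightarrow> U \<subseteq> half_plane u'" if "U \<in> \<U>" for U
  proof -
    have "site_vec y \<bullet> u < 0 \<longleftrightarrow> site_vec y \<bullet> u' < 0" if "y \<in> U" for y
      using assms[of y] that \<open>U \<in> \<U>\<close> by blast
    then show ?thesis unfolding half_plane_def by blast
  qed
  then show ?thesis unfolding unstable_def by blast
qed

lemma generic_scale: "c > 0 \<Longrightarrow> generic \<U> (c *\<^sub>R u) \<longleftrightarrow> generic \<U> u"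
  by (simp add: generic_def)

lemma open_semicircle_scale: "c > 0 \<Longrightarrow> open_semicircle (c *\<^sub>R w) = open_semicircle w"
  by (simp add: open_semicircle_def zero_less_mult_iff)

lemma eventually_lex_less:
  fixes a b :: real
  shows "\<forall>\<^sub>F t in at_right 0. (a + t * b < 0) \<longleftrightarrow> (a < 0 \<or> a = 0 \<and> b < 0)"
proof -
  have lim: "((\<lambda>t. a + t * b) \<longlongrightarrow> a + 0 * b) (at_right 0)"
    by (intro tendsto_intros)
  consider "a < 0" | "a > 0" | "a = 0" by linarith
  then show ?thesis
  proof cases
    case 1
    then have "\<forall>\<^sub>F t in at_right 0. a + t * b < 0" using order_tendstoD(2)[OF lim, of 0] by simp
    then show ?thesis by eventually_elim (use 1 in simp)
  next
    case 2
    then have "\<forall>\<^sub>F t in at_right 0. a + t * b > 0" using order_tendstoD(1)[OF lim, of 0] by simp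
    then show ?thesis by eventually_elim (use 2 in simp)
  next
    case 3
    have "\<forall>\<^sub>F t :: real in at_right 0. t > 0" by (rule eventually_at_right_less)
    then show ?thesis by eventually_elim (use 3 in \<open>simp add: mult_less_0_iff\<close>)
  qed
qed

lemma eventually_sign_less:
  assumes "finite F"
  shows "\<forall>\<^sub>F t in at_right 0. \<forall>y\<in>F. (site_vec y \<bullet> (a + t *\<^sub>R b) < 0) \<longleftrightarrow>
    (site_vec y \<bullet> a < 0 \<or> site_vec y \<bullet> a = 0 \<and> site_vec y \<bullet> b < 0)"
  using assms eventually_lex_less by (intro eventually_ball_finite) (simp_all add: inner_add_right)

lemma finite_dirs: "update_family \<U> \<Longrightarrow> finite (dirs \<U>)"
  by (auto simp: update_family_def dirs_def)

lemma dirs_iff: "y \<in> dirs \<U> \<longleftrightarrow> y \<in> \<Union>\<U> \<or> - y \<in> \<Union>\<U>"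
proof -
  have "y \<in> uminus ` A \<longleftrightarrow> - y \<in> A" for A by (metis image_iff minus_minus)
  then show ?thesis unfolding dirs_def by simp
qed

lemma dirs_nonzero: "update_family \<U> \<Longrightarrow> y \<in> dirs \<U> \<Longrightarrow> y \<noteq> 0"
  unfolding update_family_def dirs_iff by (metis UnionE minus_zero)

lemma dirs_minus: "y \<in> dirs \<U> \<Longrightarrow> - y \<in> dirs \<U>"
  unfolding dirs_iff by auto

lemma generic_dirs: "generic \<U> u \<Longrightarrow> y \<in> dirs \<U> \<Longrightarrow> site_vec y \<bullet> u \<noteq> 0"
  unfolding generic_def dirs_iff by (metis inner_minus_left neg_equal_0_iff_equal site_vec_minus)

lemma Union_dirs: "y \<in> \<Union>\<U> \<Longrightarrow> y \<in> dirs \<U>"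
  by (simp add: dirs_iff)

lemma rrot_inner [simp]: "rrot u \<bullet> u = 0" "u \<bullet> rrot u = 0" "rrot u \<bullet> rrot u = u \<bullet> u"
  by (simp_all add: rrot_def inner_prod2)

text \<open>Finitely many nonzero inner products keep their signs under a small rotation, so
  stability persists on a short arc starting at \<open>u\<close>, which also stays in the open
  semicircle.\<close>

lemma generic_stable_arc:
  assumes fam: "update_family \<U>" and u: "u \<in> S1" "generic \<U> u" "\<not> unstable \<U> u"
    and w: "u \<bullet> w > 0"
  shows "\<exists>T. connected T \<and> u \<in> T \<and> infinite T \<and> T \<subseteq> stable_set \<U> \<and> T \<subseteq> open_semicircle w"
proof -
  have uu: "u \<bullet> u = 1" using u(1) by (simp add: dot_square_norm)
  define g where "g s = u + s *\<^sub>R rrot u" for s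
  have gu: "g s \<bullet> u = 1" "g s \<bullet> rrot u = s" for s
    using uu by (simp_all add: g_def inner_add_left)
  have g0: "g s \<noteq> 0" for s using gu(1)[of s] by auto
  have finY: "finite (dirs \<U>)" using fam finite_dirs by blast
  have "\<forall>\<^sub>F s in at_right 0. \<forall>y\<in>dirs \<U>. (site_vec y \<bullet> g s < 0) \<longleftrightarrow>
      (site_vec y \<bullet> u < 0 \<or> site_vec y \<bullet> u = 0 \<and> site_vec y \<bullet> rrot u < 0)"
    unfolding g_def by (rule eventually_sign_less[OF finY])
  moreover have "\<forall>\<^sub>F s in at_right 0. g s \<bullet> w > 0"
  proof -
    have "((\<lambda>s. g s \<bullet> w) \<longlongrightarrow> g 0 \<bullet> w) (at_right 0)"
      unfolding g_def by (intro tendsto_intros)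
    then show ?thesis using w order_tendstoD(1)[of "\<lambda>s. g s \<bullet> w" "g 0 \<bullet> w" "at_right 0" 0]
      by (simp add: g_def)
  qed
  ultimately have "\<forall>\<^sub>F s in at_right 0. (\<forall>y\<in>dirs \<U>. (site_vec y \<bullet> g s < 0) \<longleftrightarrow>
      (site_vec y \<bullet> u < 0)) \<and> g s \<bullet> w > 0"
    by eventually_elim (use generic_dirs[OF u(2)] in auto)
  then obtain d where d: "d > 0" "\<And>s. 0 < s \<Longrightarrow> s < d \<Longrightarrow>
      (\<forall>y\<in>dirs \<U>. (site_vec y \<bullet> g s < 0) \<longleftrightarrow> (site_vec y \<bullet> u < 0)) \<and> g s \<bullet> w > 0"
    unfolding eventually_at_right_field by blast
  have g00: "g 0 = u" by (simp add: g_def)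
  have d': "(\<forall>y\<in>dirs \<U>. (site_vec y \<bullet> g s < 0) \<longleftrightarrow> (site_vec y \<bullet> u < 0)) \<and> g s \<bullet> w > 0"
    if "s \<in> {0..d/2}" for s
  proof (cases "s = 0")
    case True
    then show ?thesis using w g00 by simp
  next
    case False
    then show ?thesis using d that by simp
  qed
  define T where "T = (\<lambda>s. g s /\<^sub>R norm (g s)) ` {0..d/2}"
  have "connected T" unfolding T_def g_def
    using g0 unfolding g_def by (intro connected_continuous_image continuous_intros) auto
  moreover have "u \<in> T"
  proof -
    have "u = g 0 /\<^sub>R norm (g 0)" using u(1) by (simp add: g00)
    then show ?thesis unfolding T_def using d(1) by (intro image_eqI[of _ _ 0]) auto
  qed
  moreover have "infinite T"
  proof -
    have "inj_on (\<lambda>s. g s /\<^sub>R norm (g s)) {0..d/2}"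
    proof (rule inj_onI)
      fix s t assume eq: "g s /\<^sub>R norm (g s) = g t /\<^sub>R norm (g t)"
      \<comment> \<open>The quotient of the inner products with \<open>rrot u\<close> and with
        \<open>u\<close> recovers \<open>s\<close>, hence distinct parameters give distinct
        directions.\<close>
      have "(g s /\<^sub>R norm (g s)) \<bullet> u = 1 / norm (g s)" "(g s /\<^sub>R norm (g s)) \<bullet> rrot u = s / norm (g s)" for s
        using gu[of s] by (simp_all add: divide_simps)
      then have "1 / norm (g s) = 1 / norm (g t)" "s / norm (g s) = t / norm (g t)" using eq by metis+
      then show "s = t" using g0[of s] g0[of t] by simp
    qed
    moreover have "infinite {0..d/2}" using d(1) by (simp add: infinite_Icc)
    ultimately show ?thesis unfolding T_def using finite_imageD by blast
  qed
  moreover have "T \<subseteq> stable_set \<U> \<inter> open_semicircle w"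
  proof
    fix x assume "x \<in> T"
    then obtain s where s: "s \<in> {0..d/2}" "x = g s /\<^sub>R norm (g s)" by (auto simp: T_def)
    have c: "inverse (norm (g s)) > 0" using g0[of s] by simp
    have "x \<in> S1" using g0[of s] by (simp add: s)
    moreover have "unstable \<U> (g s) \<longleftrightarrow> unstable \<U> u"
      using d'[OF s(1)] Union_dirs by (intro unstable_cong) blast
    then have "\<not> unstable \<U> x" using u(3) unstable_scale[OF c] s(2) by simp
    moreover have "x \<bullet> w > 0" using d'[OF s(1)] c by (simp add: s(2))
    ultimately show "x \<in> stable_set \<U> \<inter> open_semicircle w"
      by (simp add: stable_set_def open_semicircle_def)
  qed
  ultimately show ?thesis by blast
qed

lemma difficulty_generic_stable:
  assumes fam: "update_family \<U>" and u: "u \<in> S1" "generic \<U> u" "\<not> unstable \<U> u"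
  shows "direction_difficulty \<U> u = \<infinity>"
proof -
  have "u \<bullet> u > 0" using u(1) by (simp add: dot_square_norm)
  then obtain T where T: "connected T" "u \<in> T" "infinite T" "T \<subseteq> stable_set \<U>"
    using generic_stable_arc[OF fam u] by blast
  have "T \<subseteq> connected_component_set (stable_set \<U>) u"
    using T by (intro connected_component_maximal) auto
  then have "connected_component_set (stable_set \<U>) u \<noteq> {u}"
    using T(3) finite_subset[of T "{u}"] by auto
  then show ?thesis using u(3) by (simp add: direction_difficulty_def isolated_stable_def)
qed

lemma parallel_rep:
  assumes "a \<noteq> 0" "det2 a b = 0" "b \<noteq> 0"
  shows "\<exists>c. c \<noteq> 0 \<and> b = c *\<^sub>R a"
proof -
  let ?c = "(a \<bullet> b) / (a \<bullet> a)"
  have aa: "a \<bullet> a \<noteq> 0" using assms by simp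
  have "(a \<bullet> a) *\<^sub>R b = (a \<bullet> b) *\<^sub>R a"
    using assms(2) by (simp add: prod_eq_iff inner_prod2 det2_def algebra_simps)
  then have "b = ?c *\<^sub>R a" using aa
    by (metis (no_types, lifting) divide_inverse mult.commute scaleR_one scaleR_scaleR right_inverse)
  moreover from this have "?c \<noteq> 0" using assms(3) by auto
  ultimately show ?thesis by blast
qed

text \<open>Such a \<open>u\<close> is orthogonal to a rule element \<open>y\<close>, hence a
  multiple of \<open>rot y\<close>; a negative factor is absorbed by replacing \<open>y\<close> with
  \<open>- y\<close>.\<close>

lemma nongeneric_rep:
  assumes fam: "update_family \<U>" and u: "u \<noteq> 0" "\<not> generic \<U> u"
  shows "\<exists>e\<in>rot ` dirs \<U>. \<exists>c>0. u = c *\<^sub>R site_vec e"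
proof -
  obtain y where y: "y \<in> \<Union>\<U>" "site_vec y \<bullet> u = 0" using u(2) by (auto simp: generic_def)
  have y0: "y \<noteq> 0" using dirs_nonzero[OF fam Union_dirs[OF y(1)]] .
  have "det2 (site_vec (rot y)) u = 0" using y(2) by (simp add: site_vec_rot det2_def rrot_def inner_prod2)
  then obtain c where c: "c \<noteq> 0" "u = c *\<^sub>R site_vec (rot y)"
    using parallel_rep[of "site_vec (rot y)" u] y0 u(1) by auto
  show ?thesis
  proof (cases "c > 0")
    case True
    then show ?thesis using c y(1) Union_dirs by blast
  next
    case False
    have "u = (- c) *\<^sub>R site_vec (rot (- y))" using c by (simp add: rot_minus site_vec_minus)
    moreover have "rot (- y) \<in> rot ` dirs \<U>" using y(1) Union_dirs dirs_minus by blast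
    moreover have "- c > 0" using False c by simp
    ultimately show ?thesis by blast
  qed
qed

text \<open>\<open>?cot f\<close> is the cotangent of the angle from \<open>f\<close>
  counterclockwise to \<open>w\<close>. The cotangent decreases on the interval from 0 to a half
  turn, so its maximum belongs to the vector closest to \<open>w\<close> on the clockwise
  side.\<close>

lemma nearest_clockwise:
  fixes w :: "real \<times> real"
  assumes F: "finite F" "F \<noteq> {}" "\<And>f. f \<in> F \<Longrightarrow> - f \<in> F" "\<And>f. f \<in> F \<Longrightarrow> det2 f w \<noteq> 0"
  shows "\<exists>e\<in>F. det2 e w > 0 \<and> (\<forall>f\<in>F. det2 f w > 0 \<longrightarrow> det2 f e \<ge> 0)"
proof -
  let ?P = "{f \<in> F. det2 f w > 0}" and ?cot = "\<lambda>f. (f \<bullet> w) / det2 f w"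
  obtain f0 where f0: "f0 \<in> F" using F(2) by blast
  have "det2 (- f0) w = - det2 f0 w" by (simp add: det2_def)
  then have "f0 \<in> ?P \<or> - f0 \<in> ?P" using F(3)[OF f0] F(4)[OF f0] f0 by auto
  then have ne: "?P \<noteq> {}" by blast
  have finP: "finite ?P" using F(1) by simp
  have "Max (?cot ` ?P) \<in> ?cot ` ?P" using ne finP by (intro Max_in) auto
  then obtain e where e: "e \<in> ?P" "?cot e = Max (?cot ` ?P)" by auto
  have "det2 f e \<ge> 0" if f: "f \<in> ?P" for f
  proof -
    have "?cot f \<le> ?cot e" unfolding e(2) using f finP by (intro Max_ge) auto
    then have "(f \<bullet> w) * det2 e w \<le> (e \<bullet> w) * det2 f w"
      using f e(1) by (simp add: frac_le_eq divide_le_eq pos_le_divide_eq mult.commute)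
    moreover have "(e \<bullet> w) * det2 f w - (f \<bullet> w) * det2 e w = (w \<bullet> w) * det2 f e"
      by (simp add: inner_prod2 det2_def algebra_simps)
    ultimately have "(w \<bullet> w) * det2 f e \<ge> 0" by linarith
    moreover have "w \<bullet> w > 0" using f by (auto simp: det2_def)
    ultimately show ?thesis by (simp add: zero_le_mult_iff)
  qed
  then show ?thesis using e(1) by blast
qed

text \<open>The arc of \<open>u\<close> is named by its clockwise endpoint \<open>e\<close>. No rule
  element becomes orthogonal strictly between \<open>e\<close> and \<open>u\<close>, so the signs at
  \<open>u\<close> are those just counterclockwise of \<open>e\<close>.\<close>

lemma arc_rep:
  assumes fam: "update_family \<U>" and ne: "\<Union>\<U> \<noteq> {}" and u: "generic \<U> u"
  shows "\<exists>e\<in>rot ` dirs \<U>. \<forall>y\<in>dirs \<U>.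
    (site_vec y \<bullet> u < 0 \<longleftrightarrow> idot y e < 0 \<or> idot y e = 0 \<and> idot y (rot e) < 0)"
proof -
  let ?F = "site_vec ` rot ` dirs \<U>"
  have det: "det2 (site_vec (rot y)) u = - (site_vec y \<bullet> u)" for y
    by (simp add: site_vec_rot rrot_def det2_def inner_prod2)
  have "\<exists>e\<in>?F. det2 e u > 0 \<and> (\<forall>f\<in>?F. det2 f u > 0 \<longrightarrow> det2 f e \<ge> 0)"
  proof (rule nearest_clockwise)
    show "?F \<noteq> {}" using ne by (simp add: dirs_def)
    show "- f \<in> ?F" if f: "f \<in> ?F" for f
    proof -
      obtain y where y: "y \<in> dirs \<U>" "f = site_vec (rot y)" using f by blast
      have "- f = site_vec (rot (- y))" by (simp add: y rot_minus site_vec_minus)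
      then show ?thesis using dirs_minus[OF y(1)] by blast
    qed
    show "det2 f u \<noteq> 0" if "f \<in> ?F" for f
      using that det generic_dirs[OF u] by auto
  qed (use finite_dirs[OF fam] in auto)
  then obtain e where e: "e \<in> rot ` dirs \<U>" "det2 (site_vec e) u > 0"
    "\<And>f. f \<in> ?F \<Longrightarrow> det2 f u > 0 \<Longrightarrow> det2 f (site_vec e) \<ge> 0" by blast
  have e0: "idot e e > 0" using e(1) dirs_nonzero[OF fam] by (intro idot_self_pos) auto
  have pos: "idot y e > 0 \<or> idot y e = 0 \<and> idot y (rot e) > 0"
    if y: "y \<in> dirs \<U>" "site_vec y \<bullet> u > 0" for y
  proof -
    have "det2 (site_vec (rot (- y))) u > 0" using y(2) by (simp add: det site_vec_minus)
    then have "det2 (site_vec (rot (- y))) (site_vec e) \<ge> 0" using e(3) dirs_minus[OF y(1)] by blast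
    moreover have "det2 (site_vec (rot (- y))) (site_vec e) = of_int (idot y e)"
      by (simp add: det2_def site_vec_def rot_def idot_def)
    ultimately have "idot y e \<ge> 0" by simp
    moreover have "idot y (rot e) > 0" if "idot y e = 0"
    proof -
      \<comment> \<open>Expansion in the orthogonal frame of \<open>e\<close> and
        \<open>rot e\<close>; the determinant is the inner product of \<open>rot e\<close> with
        \<open>u\<close>.\<close>
      have "of_int (idot e e) * (site_vec y \<bullet> u) =
          of_int (idot y e) * (site_vec e \<bullet> u) + of_int (idot y (rot e)) * det2 (site_vec e) u"
        by (simp add: det2_def site_vec_def rot_def idot_def inner_prod2 algebra_simps)
      moreover have "of_int (idot e e) * (site_vec y \<bullet> u) > 0" using e0 y(2) by simp
      ultimately have "of_int (idot y (rot e)) * det2 (site_vec e) u > 0" using that by simp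
      then show ?thesis using e(2) by (simp add: zero_less_mult_iff)
    qed
    ultimately show ?thesis by linarith
  qed
  have "site_vec y \<bullet> u < 0 \<longleftrightarrow> idot y e < 0 \<or> idot y e = 0 \<and> idot y (rot e) < 0"
    if y: "y \<in> dirs \<U>" for y
  proof -
    have "site_vec y \<bullet> u \<noteq> 0" using generic_dirs[OF u y] .
    then consider "site_vec y \<bullet> u < 0" | "site_vec y \<bullet> u > 0" by linarith
    then show ?thesis
      by cases (use pos[OF y] pos[OF dirs_minus[OF y]] in \<open>auto simp: site_vec_minus\<close>)
  qed
  then show ?thesis using e(1) by blast
qed

text \<open>A small counterclockwise rotation of \<open>e\<close> realises the lexicographic signs.
  It is generic because a nonzero \<open>y\<close> cannot be orthogonal to both \<open>e\<close> and
  \<open>rot e\<close>, and the assumption on \<open>w\<close> is the same lexicographic condition,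
  which puts it into the semicircle.\<close>

lemma lex_stable_direction:
  assumes fam: "update_family \<U>" and e: "e \<noteq> 0" "\<not> lex_unstable \<U> e"
    and w: "site_vec e \<bullet> w > 0 \<or> site_vec e \<bullet> w = 0 \<and> site_vec (rot e) \<bullet> w > 0"
  shows "\<exists>u\<in>S1. generic \<U> u \<and> \<not> unstable \<U> u \<and> u \<bullet> w > 0"
proof -
  define g where "g t = site_vec e + t *\<^sub>R site_vec (rot e)" for t
  have ev1: "\<forall>\<^sub>F t in at_right 0. \<forall>y\<in>dirs \<U>. (site_vec y \<bullet> g t < 0) \<longleftrightarrow>
      (site_vec y \<bullet> site_vec e < 0 \<or> site_vec y \<bullet> site_vec e = 0 \<and> site_vec y \<bullet> site_vec (rot e) < 0)"
    unfolding g_def by (rule eventually_sign_less[OF finite_dirs[OF fam]])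
  have ev2: "\<forall>\<^sub>F t in at_right 0. g t \<bullet> w > 0"
    using eventually_lex_less[of "- (site_vec e \<bullet> w)" "- (site_vec (rot e) \<bullet> w)"]
    by eventually_elim (use w in \<open>auto simp: g_def inner_add_left\<close>)
  have "\<exists>t. (\<forall>y\<in>dirs \<U>. (site_vec y \<bullet> g t < 0) \<longleftrightarrow>
      (site_vec y \<bullet> site_vec e < 0 \<or> site_vec y \<bullet> site_vec e = 0 \<and> site_vec y \<bullet> site_vec (rot e) < 0))
      \<and> g t \<bullet> w > 0"
    by (rule eventually_happens'[OF _ eventually_conj[OF ev1 ev2]]) simp
  then obtain t where t: "\<And>y. y \<in> dirs \<U> \<Longrightarrow> (site_vec y \<bullet> g t < 0) \<longleftrightarrow>
      (idot y e < 0 \<or> idot y e = 0 \<and> idot y (rot e) < 0)" and tw: "g t \<bullet> w > 0"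
    by (auto simp: inner_site_vec)
  have g0: "g t \<noteq> 0" using tw by auto
  define c where "c = inverse (norm (g t))"
  have c: "c > 0" using g0 by (simp add: c_def)
  have "generic \<U> (g t)"
    unfolding generic_def
  proof
    fix y assume "y \<in> \<Union>\<U>"
    then have y: "y \<in> dirs \<U>" by (rule Union_dirs)
    have "idot y e \<noteq> 0 \<or> idot y (rot e) \<noteq> 0"
      using idot_frame_eq_0[OF e(1)] dirs_nonzero[OF fam y] by blast
    then show "site_vec y \<bullet> g t \<noteq> 0"
      using t[OF y] t[OF dirs_minus[OF y]] by (auto simp: site_vec_minus)
  qed
  moreover have "\<not> unstable \<U> (g t)"
  proof
    assume "unstable \<U> (g t)"
    then obtain U where U: "U \<in> \<U>" "\<And>y. y \<in> U \<Longrightarrow> site_vec y \<bullet> g t < 0"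
      by (auto simp: unstable_def half_plane_def)
    have "lex_unstable \<U> e" unfolding lex_unstable_def
    proof (intro bexI[OF _ U(1)] ballI)
      fix y assume y: "y \<in> U"
      then have "y \<in> dirs \<U>" using U(1) unfolding dirs_iff by blast
      then show "idot y e < 0 \<or> idot y e = 0 \<and> idot y (rot e) < 0" using t U(2)[OF y] by blast
    qed
    then show False using e by blast
  qed
  moreover have "c *\<^sub>R g t \<in> S1" using g0 by (simp add: c_def)
  moreover have "(c *\<^sub>R g t) \<bullet> w > 0" using c tw by simp
  ultimately show ?thesis using generic_scale[OF c] unstable_scale[OF c] by blast
qed

section \<open>Reduction of the difficulty to finitely many semicircles\<close>

lemma enat_INF_le_iff: "(INF x\<in>A. f x) \<le> enat k \<longleftrightarrow> (\<exists>x\<in>A. f x \<le> enat k)"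
proof
  assume le: "(INF x\<in>A. f x) \<le> enat k"
  \<comment> \<open>An infimum over the empty set would be infinite; a nonempty one is attained
    because \<open>enat\<close> is well-ordered.\<close>
  have "A \<noteq> {}" using le by (auto simp: top_enat_def)
  then have "(INF x\<in>A. f x) \<in> f ` A"
    unfolding Inf_enat_def using LeastI_ex[of "\<lambda>x. x \<in> f ` A"] by auto
  then show "\<exists>x\<in>A. f x \<le> enat k" using le by auto
next
  assume "\<exists>x\<in>A. f x \<le> enat k"
  then show "(INF x\<in>A. f x) \<le> enat k" using INF_lower order_trans by metis
qed

lemma isolated_stable_site:
  assumes c: "c > 0" and iso: "isolated_stable \<U> (c *\<^sub>R site_vec e)"
  shows "direction_difficulty \<U> (c *\<^sub>R site_vec e) \<le> enat k \<longleftrightarrow> spread \<U> e k"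
proof -
  have "\<not> unstable \<U> (c *\<^sub>R site_vec e)" using iso by (simp add: isolated_stable_def stable_set_def)
  then show ?thesis using iso
    by (simp add: direction_difficulty_def enat_INF_le_iff half_plane_scale[OF c] half_plane_site
        spread_def disjoint_eq_subset_Compl) blast
qed

text \<open>Deleting the finitely many other stable directions from the open half space around
  \<open>w\<close> leaves an open set that meets the stable set only in \<open>u\<close>. Any second
  point in the component of \<open>u\<close> would disconnect it.\<close>

lemma isolated_if_finite:
  assumes fin: "finite (open_semicircle w \<inter> stable_set \<U>)" and u: "u \<in> open_semicircle w \<inter> stable_set \<U>"
  shows "isolated_stable \<U> u"
proof -
  let ?C = "connected_component_set (stable_set \<U>) u"
  let ?A = "{x. x \<bullet> w > 0} - (open_semicircle w \<inter> stable_set \<U> - {u})"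
  have CS: "?C \<subseteq> stable_set \<U>" by (rule connected_component_subset)
  have uC: "u \<in> ?C" using u by (simp add: connected_component_refl_eq)
  have "z = u" if z: "z \<in> ?C" for z
  proof (rule ccontr)
    assume zu: "z \<noteq> u"
    have "open {x. x \<bullet> w > 0}"
      using open_halfspace_gt[of 0 w] by (simp add: inner_commute)
    then have oA: "open ?A" using fin by (intro open_Diff finite_imp_closed) auto
    have AC: "?A \<inter> ?C = {u}"
    proof
      show "?A \<inter> ?C \<subseteq> {u}" using CS by (auto simp: open_semicircle_def stable_set_def)
      show "{u} \<subseteq> ?A \<inter> ?C" using u uC by (auto simp: open_semicircle_def)
    qed
    have oB: "open (- {u})" by (intro open_Compl closed_singleton)
    have "connected ?C" by (rule connected_connected_component)
    moreover have "?A \<inter> - {u} \<inter> ?C = {}" using AC by blast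
    moreover have "?C \<subseteq> ?A \<union> - {u}" using AC by blast
    moreover have "?A \<inter> ?C \<noteq> {}" "- {u} \<inter> ?C \<noteq> {}" using AC z zu by blast+
    ultimately show False using connectedD[OF _ oA oB] by blast
  qed
  then have "?C = {u}" using uC by blast
  then show ?thesis using u by (simp add: isolated_stable_def)
qed

text \<open>For \<open>w\<close> in \<open>dirs\<close> both ends of the semicircle are arc
  endpoints, so every arc lies inside or outside. A stable arc inside would contribute \<infinity>.
  Conversely, if all arcs inside are unstable, the stable directions inside are among finitely many
  endpoints and hence isolated, and their difficulty is governed by \<open>spread\<close>.\<close>

lemma sup_difficulty_le_iff:
  assumes fam: "update_family \<U>" and w: "w \<in> dirs \<U>"
  shows "(\<forall>u\<in>open_semicircle (site_vec w). direction_difficulty \<U> u \<le> enat k) \<longleftrightarrow> good \<U> k w"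
proof
  assume le: "\<forall>u\<in>open_semicircle (site_vec w). direction_difficulty \<U> u \<le> enat k"
  have "lex_unstable \<U> e" if e: "e \<in> rot ` dirs \<U>" "idot w e > 0 \<or> idot w e = 0 \<and> idot w (rot e) > 0" for e
  proof (rule ccontr)
    assume nl: "\<not> lex_unstable \<U> e"
    have e0: "e \<noteq> 0" using e(1) dirs_nonzero[OF fam] by auto
    have "site_vec e \<bullet> site_vec w > 0 \<or> site_vec e \<bullet> site_vec w = 0 \<and> site_vec (rot e) \<bullet> site_vec w > 0"
      using e(2) by (simp add: inner_commute[of _ "site_vec w"] inner_site_vec)
    then obtain u where u: "u \<in> S1" "generic \<U> u" "\<not> unstable \<U> u" "u \<bullet> site_vec w > 0"
      using lex_stable_direction[OF fam e0 nl] by blast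
    then have "direction_difficulty \<U> u = \<infinity>" using difficulty_generic_stable[OF fam] by blast
    moreover have "u \<in> open_semicircle (site_vec w)" using u by (simp add: open_semicircle_def)
    ultimately show False using le by auto
  qed
  moreover have "spread \<U> e k" if e: "e \<in> rot ` dirs \<U>" "idot w e > 0" "int_stable \<U> e" for e
  proof -
    have e0: "e \<noteq> 0" using e(1) dirs_nonzero[OF fam] by auto
    define c where "c = inverse (norm (site_vec e))"
    have c: "c > 0" using e0 by (simp add: c_def)
    let ?u = "c *\<^sub>R site_vec e"
    have "?u \<in> open_semicircle (site_vec w)"
      using e(2) c e0 by (simp add: open_semicircle_def c_def inner_commute[of _ "site_vec w"] inner_site_vec)
    then have dd: "direction_difficulty \<U> ?u \<le> enat k" using le by blast
    have "\<not> unstable \<U> ?u" using e(3) unstable_scale[OF c] unstable_site by blast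
    then have "isolated_stable \<U> ?u" using dd by (auto simp: direction_difficulty_def split: if_splits)
    then show ?thesis using isolated_stable_site[OF c] dd by blast
  qed
  ultimately show "good \<U> k w" by (simp add: good_def)
next
  assume g: "good \<U> k w"
  have ne: "\<Union>\<U> \<noteq> {}" using w by (auto simp: dirs_def)
  let ?C = "open_semicircle (site_vec w)"
  have nongen: "\<not> generic \<U> u" if u: "u \<in> ?C \<inter> stable_set \<U>" for u
  proof
    assume gen: "generic \<U> u"
    obtain e where e: "e \<in> rot ` dirs \<U>" "\<And>y. y \<in> dirs \<U> \<Longrightarrow>
      (site_vec y \<bullet> u < 0 \<longleftrightarrow> idot y e < 0 \<or> idot y e = 0 \<and> idot y (rot e) < 0)"
      using arc_rep[OF fam ne gen] by blast
    \<comment> \<open>The sign description of the arc applies to the midpoint too, because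
      \<open>dirs\<close> contains \<open>- w\<close>.\<close>
    have "site_vec (- w) \<bullet> u < 0" using u by (simp add: open_semicircle_def site_vec_minus inner_commute)
    then have "idot w e > 0 \<or> idot w e = 0 \<and> idot w (rot e) > 0" using e(2)[OF dirs_minus[OF w]] by auto
    then have "lex_unstable \<U> e" using g e(1) by (auto simp: good_def)
    then obtain U where U: "U \<in> \<U>" "\<And>y. y \<in> U \<Longrightarrow> idot y e < 0 \<or> idot y e = 0 \<and> idot y (rot e) < 0"
      unfolding lex_unstable_def by blast
    have "U \<subseteq> half_plane u"
    proof
      fix y assume y: "y \<in> U"
      then have "y \<in> dirs \<U>" using U(1) unfolding dirs_iff by blast
      then show "y \<in> half_plane u" using e(2) U(2)[OF y] by (simp add: half_plane_def)
    qed
    then have "unstable \<U> u" using U(1) by (auto simp: unstable_def)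
    then show False using u by (simp add: stable_set_def)
  qed
  have rep: "\<exists>e\<in>rot ` dirs \<U>. \<exists>c>0. u = c *\<^sub>R site_vec e" if u: "u \<in> ?C \<inter> stable_set \<U>" for u
  proof -
    have "u \<noteq> 0" using u by (auto simp: open_semicircle_def)
    then show ?thesis using nongeneric_rep[OF fam _ nongen[OF u]] by blast
  qed
  have "?C \<inter> stable_set \<U> \<subseteq> (\<lambda>e. sgn (site_vec e)) ` rot ` dirs \<U>"
  proof
    fix u assume u: "u \<in> ?C \<inter> stable_set \<U>"
    then obtain e c where e: "e \<in> rot ` dirs \<U>" "c > 0" "u = c *\<^sub>R site_vec e" using rep by blast
    have "norm u = 1" using u by (simp add: open_semicircle_def)
    then have "u = sgn u" by (simp add: sgn_div_norm)
    also have "\<dots> = sgn (site_vec e)" using e(2,3) by (simp add: sgn_scaleR)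
    finally show "u \<in> (\<lambda>e. sgn (site_vec e)) ` rot ` dirs \<U>" using e(1) by blast
  qed
  then have fin: "finite (?C \<inter> stable_set \<U>)" using finite_dirs[OF fam] finite_subset by blast
  show "\<forall>u\<in>?C. direction_difficulty \<U> u \<le> enat k"
  proof
    fix u assume u: "u \<in> ?C"
    show "direction_difficulty \<U> u \<le> enat k"
    proof (cases "unstable \<U> u")
      case True
      then show ?thesis by (simp add: direction_difficulty_def)
    next
      case False
      then have us: "u \<in> ?C \<inter> stable_set \<U>" using u by (simp add: stable_set_def open_semicircle_def)
      obtain e c where e: "e \<in> rot ` dirs \<U>" "c > 0" "u = c *\<^sub>R site_vec e" using rep[OF us] by blast
      have "site_vec e \<bullet> site_vec w > 0"
        using u e(2,3) by (simp add: open_semicircle_def zero_less_mult_iff)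
      then have "idot w e > 0" by (simp add: inner_commute[of _ "site_vec w"] inner_site_vec)
      moreover have "int_stable \<U> e" using False e(3) unstable_scale[OF e(2)] unstable_site by blast
      ultimately have "spread \<U> e k" using g e(1) unfolding good_def by blast
      then show ?thesis using isolated_stable_site[OF e(2)] isolated_if_finite[OF fin us] e(3) by blast
    qed
  qed
qed

text \<open>The midpoint is rotated clockwise to the nearest element \<open>v\<close> of
  \<open>dirs\<close>. A direction gained by this shares its arc with the clockwise end of the old
  semicircle, and part of that arc lies inside the old semicircle. A generic direction of finite
  difficulty is unstable, so the gained direction is unstable and costs nothing.\<close>

lemma semicircle_reduction:
  assumes fam: "update_family \<U>" and ne: "\<Union>\<U> \<noteq> {}" and w: "w \<noteq> 0"
    and le: "\<forall>u\<in>open_semicircle w. direction_difficulty \<U> u \<le> enat k"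
  shows "\<exists>w'\<in>dirs \<U>. \<forall>u\<in>open_semicircle (site_vec w'). direction_difficulty \<U> u \<le> enat k"
proof (cases "\<exists>y\<in>dirs \<U>. det2 (site_vec y) w = 0")
  case True
  then obtain y where y: "y \<in> dirs \<U>" "det2 (site_vec y) w = 0" by blast
  then obtain c where c: "c \<noteq> 0" "w = c *\<^sub>R site_vec y"
    using parallel_rep[of "site_vec y" w] dirs_nonzero[OF fam y(1)] w by auto
  show ?thesis
  proof (cases "c > 0")
    case True
    then show ?thesis using le c(2) open_semicircle_scale y(1) by metis
  next
    case False
    have "w = (- c) *\<^sub>R site_vec (- y)" "- c > 0" using c False by (simp_all add: site_vec_minus)
    then show ?thesis using le open_semicircle_scale dirs_minus[OF y(1)] by metis
  qed
next
  case False
  let ?F = "site_vec ` dirs \<U>"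
  have "\<exists>e\<in>?F. det2 e w > 0 \<and> (\<forall>f\<in>?F. det2 f w > 0 \<longrightarrow> det2 f e \<ge> 0)"
  proof (rule nearest_clockwise)
    show "- f \<in> ?F" if "f \<in> ?F" for f
      using that dirs_minus site_vec_minus by (metis (no_types, opaque_lifting) image_iff)
    show "?F \<noteq> {}" using ne by (simp add: dirs_def)
    show "det2 f w \<noteq> 0" if "f \<in> ?F" for f using that False by blast
  qed (use finite_dirs[OF fam] in simp)
  then obtain v where v: "v \<in> dirs \<U>" "det2 (site_vec v) w > 0"
    "\<And>y. y \<in> dirs \<U> \<Longrightarrow> det2 (site_vec y) w > 0 \<Longrightarrow> det2 (site_vec y) (site_vec v) \<ge> 0" by blast
  have "direction_difficulty \<U> u \<le> enat k" if u: "u \<in> open_semicircle (site_vec v)" for u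
  proof (cases "u \<bullet> w > 0")
    case True
    then have "u \<in> open_semicircle w" using u by (simp add: open_semicircle_def)
    then show ?thesis using le by blast
  next
    case uw: False
    have uv: "u \<bullet> site_vec v > 0" using u by (simp add: open_semicircle_def)
    have pos: "site_vec y \<bullet> u > 0" if y: "y \<in> dirs \<U>" "det2 (site_vec y) w > 0" for y
    proof -
      \<comment> \<open>The linear relation between the three plane vectors \<open>y\<close>,
        \<open>v\<close> and \<open>w\<close>, paired with \<open>u\<close>.\<close>
      have "det2 (site_vec v) w * (site_vec y \<bullet> u) =
          det2 (site_vec y) w * (u \<bullet> site_vec v) - det2 (site_vec y) (site_vec v) * (u \<bullet> w)"
        by (simp add: det2_def inner_prod2 algebra_simps)
      moreover have "det2 (site_vec y) w * (u \<bullet> site_vec v) > 0" using y uv by simp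
      moreover have "det2 (site_vec y) (site_vec v) * (u \<bullet> w) \<le> 0"
        using v(3)[OF y] uw by (simp add: mult_nonneg_nonpos)
      ultimately have "det2 (site_vec v) w * (site_vec y \<bullet> u) > 0" by linarith
      then show ?thesis using v(2) by (simp add: zero_less_mult_iff)
    qed
    have sgn_u: "site_vec y \<bullet> u < 0 \<longleftrightarrow> det2 (site_vec y) w < 0" "det2 (site_vec y) w \<noteq> 0"
      if y: "y \<in> dirs \<U>" for y
    proof -
      show n0: "det2 (site_vec y) w \<noteq> 0" using False y by blast
      have "det2 (site_vec (- y)) w = - det2 (site_vec y) w" by (simp add: site_vec_minus det2_def)
      then show "site_vec y \<bullet> u < 0 \<longleftrightarrow> det2 (site_vec y) w < 0"
        using pos[OF y] pos[OF dirs_minus[OF y]] n0 by (cases "det2 (site_vec y) w < 0") (auto simp: site_vec_minus)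
    qed
    \<comment> \<open>\<open>- rrot w\<close> is the clockwise end of the old semicircle, and adding
      a small multiple of \<open>w\<close> moves it inside.\<close>
    define g where "g t = - rrot w + t *\<^sub>R w" for t
    have ev1: "\<forall>\<^sub>F t in at_right 0. \<forall>y\<in>dirs \<U>. (site_vec y \<bullet> g t < 0) \<longleftrightarrow>
        (site_vec y \<bullet> (- rrot w) < 0 \<or> site_vec y \<bullet> (- rrot w) = 0 \<and> site_vec y \<bullet> w < 0)"
      unfolding g_def by (rule eventually_sign_less[OF finite_dirs[OF fam]])
    have ev2: "\<forall>\<^sub>F t :: real in at_right 0. t > 0" by (rule eventually_at_right_less)
    have "\<exists>t. (\<forall>y\<in>dirs \<U>. (site_vec y \<bullet> g t < 0) \<longleftrightarrow>
        (site_vec y \<bullet> (- rrot w) < 0 \<or> site_vec y \<bullet> (- rrot w) = 0 \<and> site_vec y \<bullet> w < 0)) \<and> t > 0"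
      by (rule eventually_happens'[OF _ eventually_conj[OF ev1 ev2]]) simp
    then obtain t where t: "t > 0" "\<And>y. y \<in> dirs \<U> \<Longrightarrow> (site_vec y \<bullet> g t < 0) \<longleftrightarrow>
        (site_vec y \<bullet> (- rrot w) < 0 \<or> site_vec y \<bullet> (- rrot w) = 0 \<and> site_vec y \<bullet> w < 0)" by blast
    have "site_vec y \<bullet> (- rrot w) = det2 (site_vec y) w" for y
      by (simp add: rrot_def det2_def inner_prod2 algebra_simps)
    then have gy: "site_vec y \<bullet> g t < 0 \<longleftrightarrow> site_vec y \<bullet> u < 0" if "y \<in> dirs \<U>" for y
      using t(2)[OF that] sgn_u[OF that] by simp
    have gw: "g t \<bullet> w > 0" using w t(1) by (simp add: g_def inner_diff_left)
    have g0: "g t \<noteq> 0" using gw by auto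
    define c where "c = inverse (norm (g t))"
    have c: "c > 0" using g0 by (simp add: c_def)
    have gen: "generic \<U> (g t)"
      unfolding generic_def
    proof
      fix y assume "y \<in> \<Union>\<U>"
      then have y: "y \<in> dirs \<U>" by (rule Union_dirs)
      have "site_vec (- y) \<bullet> u < 0 \<longleftrightarrow> site_vec (- y) \<bullet> g t < 0" using gy[OF dirs_minus[OF y]] by simp
      moreover have "site_vec y \<bullet> u \<noteq> 0"
        using sgn_u[OF y] sgn_u(1)[OF dirs_minus[OF y]] by (auto simp: site_vec_minus det2_def)
      ultimately show "site_vec y \<bullet> g t \<noteq> 0" using gy[OF y] by (auto simp: site_vec_minus)
    qed
    have S: "c *\<^sub>R g t \<in> S1" using g0 by (simp add: c_def)
    then have "c *\<^sub>R g t \<in> open_semicircle w" using gw c by (simp add: open_semicircle_def)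
    then have "direction_difficulty \<U> (c *\<^sub>R g t) \<le> enat k" using le by blast
    then have "unstable \<U> (c *\<^sub>R g t)"
      using difficulty_generic_stable[OF fam S] generic_scale[OF c] gen by fastforce
    then have "unstable \<U> u"
      using unstable_scale[OF c] unstable_cong[of \<U> "g t" u] gy Union_dirs by blast
    then show ?thesis by (simp add: direction_difficulty_def)
  qed
  then show ?thesis using v(1) by blast
qed

lemma difficulty_le_iff:
  assumes fam: "update_family \<U>" and ne: "\<Union>\<U> \<noteq> {}"
  shows "difficulty \<U> \<le> enat k \<longleftrightarrow> (\<exists>w\<in>dirs \<U>. good \<U> k w)"
proof
  assume "difficulty \<U> \<le> enat k"
  then obtain w where w: "w \<in> S1" "(SUP u\<in>open_semicircle w. direction_difficulty \<U> u) \<le> enat k"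
    by (auto simp: difficulty_def enat_INF_le_iff)
  then have "\<forall>u\<in>open_semicircle w. direction_difficulty \<U> u \<le> enat k" by (simp add: SUP_le_iff)
  moreover have "w \<noteq> 0" using w by auto
  ultimately show "\<exists>w\<in>dirs \<U>. good \<U> k w"
    using semicircle_reduction[OF fam ne] sup_difficulty_le_iff[OF fam] by blast
next
  assume "\<exists>w\<in>dirs \<U>. good \<U> k w"
  then obtain w where w: "w \<in> dirs \<U>" "good \<U> k w" by blast
  have w0: "site_vec w \<noteq> 0" using dirs_nonzero[OF fam w(1)] by simp
  let ?w = "inverse (norm (site_vec w)) *\<^sub>R site_vec w"
  have "\<forall>u\<in>open_semicircle ?w. direction_difficulty \<U> u \<le> enat k"
    using sup_difficulty_le_iff[OF fam w(1)] w(2) w0 by (subst open_semicircle_scale) simp_all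
  then have "(SUP u\<in>open_semicircle ?w. direction_difficulty \<U> u) \<le> enat k" by (simp add: SUP_le_iff)
  moreover have "?w \<in> S1" using w0 by simp
  ultimately show "difficulty \<U> \<le> enat k" unfolding difficulty_def enat_INF_le_iff by blast
qed

text \<open>A rule witnessing instability just counterclockwise of \<open>e\<close> has its sites in
  the half plane or strictly behind on the boundary line. A run of boundary sites of length
  \<open>M\<close>, the reach of the rule along the line, therefore extends itself forever in the
  direction \<open>rot e\<close>.\<close>

lemma spread_exists:
  assumes fam: "update_family \<U>" and e: "e \<noteq> 0" "lex_unstable \<U> e"
  shows "\<exists>k. spread \<U> e k"
proof -
  obtain U where U: "U \<in> \<U>" "\<And>y. y \<in> U \<Longrightarrow> idot y e < 0 \<or> idot y e = 0 \<and> idot y (rot e) < 0"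
    using e(2) unfolding lex_unstable_def by blast
  have finU: "finite U" using fam U(1) by (simp add: update_family_def)
  define M where "M = Max (insert 1 ((\<lambda>y. \<bar>idot y (rot e)\<bar>) ` U))"
  have M: "\<bar>idot y (rot e)\<bar> \<le> M" if "y \<in> U" for y
    unfolding M_def using that finU by (intro Max_ge) auto
  define Z where "Z = {z. idot z e = 0 \<and> 0 \<le> idot z (rot e) \<and> idot z (rot e) < M}"
  have "Z \<subseteq> {x. nrm x \<le> M}"
  proof
    fix z assume "z \<in> Z"
    then show "z \<in> {x. nrm x \<le> M}" using nrm_le_frame[OF e(1), of z] by (simp add: Z_def)
  qed
  then have finZ: "finite Z" by (rule finite_subset[OF _ finite_box])
  let ?C = "bp_closure \<U> (below e \<union> Z)"
  have line: "z \<in> ?C" if "idot z e = 0" "idot z (rot e) = int n" for z n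
    using that
  proof (induction n arbitrary: z rule: less_induct)
    case (less n)
    show ?case
    proof (cases "int n < M")
      case True
      then have "z \<in> Z" using less.prems by (simp add: Z_def)
      then show ?thesis using bp_closure_superset by blast
    next
      case False
      have "z + y \<in> ?C" if y: "y \<in> U" for y
      proof (cases "idot y e < 0")
        case True
        then have "z + y \<in> below e" using less.prems by (simp add: below_def)
        then show ?thesis using bp_closure_superset by blast
      next
        case nneg: False
        then have y0: "idot y e = 0" "idot y (rot e) < 0" using U(2)[OF y] by auto
        let ?n = "nat (int n + idot y (rot e))"
        have "?n < n" "idot (z + y) (rot e) = int ?n"
          using y0 M[OF y] False less.prems by auto
        then show ?thesis using less.IH[of ?n "z + y"] less.prems y0 by simp
      qed
      then show ?thesis using bp_closure_closed[OF fam] U(1) unfolding bp_closed_def by blast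
    qed
  qed
  define sh where "sh n = (int n * fst (rot e), int n * snd (rot e))" for n
  have she: "idot (sh n) e = 0" for n by (simp add: sh_def idot_def rot_def)
  have shr: "idot (sh n) (rot e) = int (n * nat (idot e e))" for n
    using idot_self_pos[OF e(1)] by (simp add: sh_def idot_def rot_def algebra_simps)
  have "inj sh" using e(1) by (auto intro!: injI simp: sh_def rot_def prod_eq_iff)
  then have "infinite (range sh)" using finite_imageD[of sh UNIV] by auto
  moreover have "range sh \<subseteq> ?C - below e" using line[OF she shr] she by (auto simp: below_def)
  ultimately have "infinite (?C - below e)" by (rule infinite_super[rotated])
  moreover have "Z \<inter> below e = {}" by (auto simp: Z_def below_def)
  ultimately show ?thesis using finZ unfolding spread_def by blast
qed

text \<open>This makes the search terminate. The semicircle given by criticality contains no generic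
  stable direction, so the arc just counterclockwise of each of its stable directions is unstable
  and \<open>spread_exists\<close> applies; finitely many bounds have a maximum.\<close>

lemma difficulty_finite:
  assumes fam: "update_family \<U>" and crit: "critical \<U>"
  shows "\<exists>k. difficulty \<U> \<le> enat k"
proof -
  obtain w where w: "w \<in> S1" "finite (open_semicircle w \<inter> stable_set \<U>)"
    using crit by (auto simp: critical_def)
  let ?S = "open_semicircle w \<inter> stable_set \<U>"
  have nogen: False if u: "u \<in> S1" "generic \<U> u" "\<not> unstable \<U> u" "u \<bullet> w > 0" for u
  proof -
    obtain T where "infinite T" "T \<subseteq> stable_set \<U>" "T \<subseteq> open_semicircle w"
      using generic_stable_arc[OF fam u] by blast
    then show False using w(2) by (meson Int_greatest finite_subset)
  qed
  have "\<exists>k. direction_difficulty \<U> u \<le> enat k" if u: "u \<in> ?S" for u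
  proof -
    have u': "u \<in> S1" "\<not> unstable \<U> u" "u \<bullet> w > 0"
      using u by (auto simp: open_semicircle_def stable_set_def)
    then have "\<not> generic \<U> u" using nogen by blast
    moreover have "u \<noteq> 0" using u' by auto
    ultimately obtain e c where e: "e \<in> rot ` dirs \<U>" "c > 0" "u = c *\<^sub>R site_vec e"
      using nongeneric_rep[OF fam] by blast
    have e0: "e \<noteq> 0" using e(1) dirs_nonzero[OF fam] by auto
    have "site_vec e \<bullet> w > 0" using u'(3) e by (simp add: zero_less_mult_iff)
    then have "lex_unstable \<U> e" using lex_stable_direction[OF fam e0] nogen by blast
    then obtain k where "spread \<U> e k" using spread_exists[OF fam e0] by blast
    then show ?thesis using isolated_stable_site[OF e(2)] isolated_if_finite[OF w(2) u] e(3) by blast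
  qed
  then obtain K where K: "\<And>u. u \<in> ?S \<Longrightarrow> direction_difficulty \<U> u \<le> enat (K u)" by metis
  have "direction_difficulty \<U> u \<le> enat (Max (insert 0 (K ` ?S)))" if u: "u \<in> open_semicircle w" for u
  proof (cases "unstable \<U> u")
    case True
    then show ?thesis by (simp add: direction_difficulty_def)
  next
    case False
    then have us: "u \<in> ?S" using u by (simp add: stable_set_def open_semicircle_def)
    then have "K u \<le> Max (insert 0 (K ` ?S))" using w(2) by (intro Max_ge) auto
    then show ?thesis using K[OF us] by (meson enat_ord_simps(1) order_trans)
  qed
  then have "(SUP u\<in>open_semicircle w. direction_difficulty \<U> u) \<le> enat (Max (insert 0 (K ` ?S)))"
    by (simp add: SUP_le_iff)
  then show ?thesis unfolding difficulty_def enat_INF_le_iff using w(1) by blast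
qed

text \<open>An empty rule would make every direction unstable.\<close>

lemma not_supercritical_nonempty_rules:
  assumes "\<not> supercritical \<U>"
  shows "int_stable \<U> 0"
proof -
  have "(1, 0) \<in> S1" by (simp add: norm_Pair)
  then obtain u where "\<not> unstable \<U> u" using assms unfolding supercritical_def by blast
  then have "{} \<notin> \<U>" by (auto simp: unstable_def)
  then show ?thesis unfolding int_stable_def by (metis all_not_in_conv idot_0(2) order_refl)
qed

lemma critical_nonempty:
  assumes fam: "update_family \<U>" and crit: "critical \<U>"
  shows "\<Union>\<U> \<noteq> {}"
proof
  assume emp: "\<Union>\<U> = {}"
  have "int_stable \<U> 0" using not_supercritical_nonempty_rules crit by (simp add: critical_def)
  then have "{} \<notin> \<U>" unfolding int_stable_def by blast
  moreover have "U = {}" if "U \<in> \<U>" for U using Union_upper[OF that] emp by simp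
  ultimately have E: "\<U> = {}" by (metis equals0I)
  obtain w where w: "w \<in> S1" "finite (open_semicircle w \<inter> stable_set \<U>)"
    using crit by (auto simp: critical_def)
  have "generic \<U> w" "\<not> unstable \<U> w" by (simp_all add: E generic_def unstable_def)
  moreover have "w \<bullet> w > 0" using w(1) by (simp add: dot_square_norm)
  ultimately obtain T where "infinite T" "T \<subseteq> stable_set \<U>" "T \<subseteq> open_semicircle w"
    using generic_stable_arc[OF fam w(1)] by blast
  then show False using w(2) by (meson Int_greatest finite_subset)
qed

text \<open>In an infinite closure the normalised sites would accumulate at a unit vector
  \<open>w\<close>. The open semicircle around \<open>w\<close> contains a stable \<open>u\<close>,
  and stability keeps the closure in a half plane bounded in direction \<open>u\<close>, which
  forces the inner product of \<open>w\<close> and \<open>u\<close> to be at most zero. As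
  \<open>u\<close> may be irrational, real inner products are used.\<close>

lemma not_supercritical_finite_closure:
  assumes fam: "update_family \<U>" and sup: "\<not> supercritical \<U>" and Z: "finite Z"
  shows "finite (bp_closure \<U> Z)"
proof (rule ccontr)
  assume inf: "infinite (bp_closure \<U> Z)"
  have "\<exists>x\<in>bp_closure \<U> Z. nrm x > int n" for n
  proof (rule ccontr)
    assume "\<not> ?thesis"
    then have "bp_closure \<U> Z \<subseteq> {x. nrm x \<le> int n}" by force
    then show False using inf finite_subset[OF _ finite_box] by blast
  qed
  then obtain x where x: "\<And>n. x n \<in> bp_closure \<U> Z" "\<And>n. nrm (x n) > int n" by metis
  have nx: "norm (site_vec (x n)) > real n" for n
  proof -
    have "real_of_int (nrm (x n)) \<le> norm (site_vec (x n))"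
      using norm_fst_le[of "fst (site_vec (x n))" "snd (site_vec (x n))"]
        norm_snd_le[of "snd (site_vec (x n))" "fst (site_vec (x n))"]
      by (simp add: nrm_def site_vec_def)
    moreover have "real n < real_of_int (nrm (x n))" using x(2)[of n] by linarith
    ultimately show ?thesis by linarith
  qed
  define v where "v n = inverse (norm (site_vec (x n))) *\<^sub>R site_vec (x n)" for n
  have vS: "v n \<in> S1" for n
  proof -
    have "norm (site_vec (x n)) > 0" using nx[of n] by (rule order_le_less_trans[rotated]) simp
    then have "site_vec (x n) \<noteq> 0" unfolding zero_less_norm_iff .
    then show ?thesis by (simp add: v_def)
  qed
  have "compact S1" by simp
  then obtain w r where w: "w \<in> S1" "strict_mono r" "(v \<circ> r) \<longlonglongrightarrow> w"
    using vS unfolding compact_def by metis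
  obtain u where u: "u \<in> S1" "u \<bullet> w > 0" "\<not> unstable \<U> u"
    using sup w(1) unfolding supercritical_def open_semicircle_def by blast
  define c where "c = Max (insert 0 ((\<lambda>z. site_vec z \<bullet> u) ` Z))"
  have "bp_closed \<U> {x. site_vec x \<bullet> u \<le> c}"
    unfolding bp_closed_def
  proof (intro ballI allI impI)
    fix U x assume U: "U \<in> \<U>" and x: "\<forall>y\<in>U. x + y \<in> {x. site_vec x \<bullet> u \<le> c}"
    have "\<not> U \<subseteq> half_plane u" using u(3) U unfolding unstable_def by blast
    then obtain y where y: "y \<in> U" "y \<notin> half_plane u" by blast
    then have y0: "site_vec y \<bullet> u \<ge> 0" by (simp add: half_plane_def)
    have "site_vec (x + y) = site_vec x + site_vec y" by (simp add: site_vec_def)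
    moreover have "site_vec (x + y) \<bullet> u \<le> c" using bspec[OF x y(1)] by simp
    ultimately show "x \<in> {x. site_vec x \<bullet> u \<le> c}" using y0 by (simp add: inner_add_left)
  qed
  moreover have "Z \<subseteq> {x. site_vec x \<bullet> u \<le> c}" unfolding c_def using Z by auto
  ultimately have cl: "bp_closure \<U> Z \<subseteq> {x. site_vec x \<bullet> u \<le> c}" by (rule bp_closure_least[rotated])
  have c0: "c \<ge> 0" unfolding c_def using Z by simp
  have "v n \<bullet> u \<le> c / real n" if "n > 0" for n
  proof -
    have "v n \<bullet> u = (site_vec (x n) \<bullet> u) / norm (site_vec (x n))" by (simp add: v_def divide_inverse)
    also have "\<dots> \<le> c / norm (site_vec (x n))" using cl x(1)[of n] by (intro divide_right_mono) auto
    also have "\<dots> \<le> c / real n" using less_imp_le[OF nx[of n]] c0 that by (intro frac_le) simp_all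
    finally show ?thesis .
  qed
  then have "v (r n) \<bullet> u \<le> c / real n" if "n > 0" for n
  proof -
    have "r n \<ge> n" using w(2) by (simp add: seq_suble)
    then have "c / real (r n) \<le> c / real n" using that c0 by (intro frac_le) simp_all
    then show ?thesis using \<open>\<And>n. n > 0 \<Longrightarrow> v n \<bullet> u \<le> c / real n\<close>[of "r n"] \<open>r n \<ge> n\<close> that by linarith
  qed
  then have "\<exists>N. \<forall>n\<ge>N. (v \<circ> r) n \<bullet> u \<le> c / real n" by (intro exI[of _ 1]) auto
  moreover have "(\<lambda>n. (v \<circ> r) n \<bullet> u) \<longlonglongrightarrow> w \<bullet> u" by (intro tendsto_intros w(3))
  moreover have "(\<lambda>n. c / real n) \<longlonglongrightarrow> 0" by (rule lim_const_over_n)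
  ultimately have "w \<bullet> u \<le> 0" by (intro LIMSEQ_le[of "\<lambda>n. (v \<circ> r) n \<bullet> u" _ "\<lambda>n. c / real n"])
  then show False using u(2) by (simp add: inner_commute)
qed

section \<open>Computable functions\<close>

text \<open>Arity is fixed, and the values of \<open>f\<close> on lists of other lengths are left
  open; \<open>comp_cong\<close> exploits this freedom.\<close>

definition computable :: "nat \<Rightarrow> (nat list \<Rightarrow> nat) \<Rightarrow> bool" where
  "computable n f \<longleftrightarrow> (\<exists>p. \<forall>xs. length xs = n \<longrightarrow> eval p xs (f xs))"

definition decidable :: "nat \<Rightarrow> (nat list \<Rightarrow> bool) \<Rightarrow> bool" where
  "decidable n P \<longleftrightarrow> computable n (\<lambda>xs. of_bool (P xs))"

lemma comp_cong:
  assumes "computable n f" "\<And>xs. length xs = n \<Longrightarrow> f xs = g xs"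
  shows "computable n g"
  using assms unfolding computable_def by (metis (full_types))

lemma comp_subst:
  assumes f: "computable m f" and gs: "\<forall>g\<in>set gs. computable n g" "length gs = m"
  shows "computable n (\<lambda>xs. f (map (\<lambda>g. g xs) gs))"
proof -
  obtain p where p: "\<And>ys. length ys = m \<Longrightarrow> eval p ys (f ys)" using f unfolding computable_def by blast
  have "\<exists>ps. \<forall>xs. length xs = n \<longrightarrow> list_all2 (\<lambda>q y. eval q xs y) ps (map (\<lambda>g. g xs) gs)"
    using gs(1)
  proof (induction gs)
    case Nil
    then show ?case by (intro exI[of _ "[]"]) simp
  next
    case (Cons g gs)
    obtain q where q: "\<And>xs. length xs = n \<Longrightarrow> eval q xs (g xs)"
      using Cons.prems unfolding computable_def by auto
    obtain ps where "\<And>xs. length xs = n \<Longrightarrow> list_all2 (\<lambda>q y. eval q xs y) ps (map (\<lambda>g. g xs) gs)"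
      using Cons by auto
    then show ?case using q by (intro exI[of _ "q # ps"]) simp
  qed
  then obtain ps where ps: "\<And>xs. length xs = n \<Longrightarrow>
      list_all2 (\<lambda>q y. eval q xs y) ps (map (\<lambda>g. g xs) gs)" by blast
  have "eval (Comp p ps) xs (f (map (\<lambda>g. g xs) gs))" if "length xs = n" for xs
    using ps[OF that] p[of "map (\<lambda>g. g xs) gs"] gs(2) by (auto intro: eval_Comp)
  then show ?thesis unfolding computable_def by blast
qed

lemma comp_nth: "i < n \<Longrightarrow> computable n (\<lambda>xs. xs ! i)"
  unfolding computable_def using eval_Proj by (intro exI[of _ "Proj i"]) auto

text \<open>Every bounded sum or quantifier puts its variable in front of the argument list, so
  outer variables are reached through iterated \<open>tl\<close>. This family of rules provides
  access under nested binders.\<close>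

lemma comp_tl: "Suc i < n \<Longrightarrow> computable n (\<lambda>xs. tl xs ! i)"
  by (rule comp_cong[OF comp_nth[of "Suc i"]]) (auto simp: nth_tl)

lemma comp_tl2: "Suc (Suc i) < n \<Longrightarrow> computable n (\<lambda>xs. tl (tl xs) ! i)"
  by (rule comp_cong[OF comp_tl[of "Suc i"]]) (auto simp: nth_tl)

lemma comp_tl3: "Suc (Suc (Suc i)) < n \<Longrightarrow> computable n (\<lambda>xs. tl (tl (tl xs)) ! i)"
  by (rule comp_cong[OF comp_tl2[of "Suc i"]]) (auto simp: nth_tl)

lemma comp_tl4: "Suc (Suc (Suc (Suc i))) < n \<Longrightarrow> computable n (\<lambda>xs. tl (tl (tl (tl xs))) ! i)"
  by (rule comp_cong[OF comp_tl3[of "Suc i"]]) (auto simp: nth_tl)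

lemma comp_tl5: "Suc (Suc (Suc (Suc (Suc i)))) < n \<Longrightarrow> computable n (\<lambda>xs. tl (tl (tl (tl (tl xs)))) ! i)"
  by (rule comp_cong[OF comp_tl4[of "Suc i"]]) (auto simp: nth_tl)

lemma comp_tl6: "Suc (Suc (Suc (Suc (Suc (Suc i))))) < n \<Longrightarrow>
    computable n (\<lambda>xs. tl (tl (tl (tl (tl (tl xs))))) ! i)"
  by (rule comp_cong[OF comp_tl5[of "Suc i"]]) (auto simp: nth_tl)

lemma comp_Suc:
  assumes "computable n f"
  shows "computable n (\<lambda>xs. Suc (f xs))"
proof -
  have "computable 1 (\<lambda>ys. Suc (ys ! 0))"
    unfolding computable_def
  proof (intro exI[of _ Succ] allI impI)
    fix xs :: "nat list" assume "length xs = 1"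
    then obtain x where "xs = [x]" by (auto simp: length_Suc_conv)
    then show "eval Succ xs (Suc (xs ! 0))" using eval_Succ by simp
  qed
  from comp_subst[OF this, of "[f]" n] show ?thesis using assms by simp
qed

lemma comp_const: "computable n (\<lambda>xs. c)"
proof (induction c)
  case 0
  show ?case unfolding computable_def using eval_Zero by blast
qed (rule comp_Suc)

text \<open>\<open>PrimRec\<close> recurses on its first argument; feeding it the bound
  \<open>b xs\<close> followed by all projections turns the recursion argument into a computed
  one.\<close>

lemma comp_rec:
  assumes b: "computable n b" and f: "computable n f" and g: "computable (Suc (Suc n)) (\<lambda>ys. g (ys ! 0) (ys ! 1) (tl (tl ys)))"
  shows "computable n (\<lambda>xs. rec_nat (f xs) (\<lambda>i y. g i y xs) (b xs))"
proof -
  obtain p where p: "\<And>xs. length xs = n \<Longrightarrow> eval p xs (f xs)" using f unfolding computable_def by blast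
  obtain q where q: "\<And>ys. length ys = Suc (Suc n) \<Longrightarrow> eval q ys (g (ys ! 0) (ys ! 1) (tl (tl ys)))"
    using g unfolding computable_def by blast
  have "eval (PrimRec p q) (m # xs) (rec_nat (f xs) (\<lambda>i y. g i y xs) m)" if "length xs = n" for m xs
  proof (induction m)
    case 0
    show ?case using p[OF that] by (auto intro: eval_PrimRec_0)
  next
    case (Suc m)
    have "eval q (m # rec_nat (f xs) (\<lambda>i y. g i y xs) m # xs) (g m (rec_nat (f xs) (\<lambda>i y. g i y xs) m) xs)"
      using q[of "m # rec_nat (f xs) (\<lambda>i y. g i y xs) m # xs"] that by simp
    then show ?case using Suc by (auto intro: eval_PrimRec_Suc)
  qed
  then have "computable (Suc n) (\<lambda>ys. rec_nat (f (tl ys)) (\<lambda>i y. g i y (tl ys)) (hd ys))"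
    unfolding computable_def by (intro exI[of _ "PrimRec p q"]) (auto simp: length_Suc_conv)
  from comp_subst[OF this, of "b # map (\<lambda>i xs. xs ! i) [0..<n]" n] b
  have "computable n (\<lambda>xs. rec_nat (f (map ((!) xs) [0..<n])) (\<lambda>i y. g i y (map ((!) xs) [0..<n])) (b xs))"
    by (auto simp: comp_nth o_def)
  then show ?thesis by (rule comp_cong) (metis map_nth)
qed

lemma comp_comp1: "computable 1 (\<lambda>ys. f (ys ! 0)) \<Longrightarrow> computable n a \<Longrightarrow> computable n (\<lambda>xs. f (a xs))"
  using comp_subst[of 1 "\<lambda>ys. f (ys ! 0)" "[a]" n] by simp

lemma comp_comp2:
  "computable 2 (\<lambda>ys. f (ys ! 0) (ys ! 1)) \<Longrightarrow> computable n a \<Longrightarrow> computable n b \<Longrightarrow> computable n (\<lambda>xs. f (a xs) (b xs))"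
  using comp_subst[of 2 "\<lambda>ys. f (ys ! 0) (ys ! 1)" "[a, b]" n] by auto

lemma dec_comp2:
  "decidable 2 (\<lambda>ys. f (ys ! 0) (ys ! 1)) \<Longrightarrow> computable n a \<Longrightarrow> computable n b \<Longrightarrow> decidable n (\<lambda>xs. f (a xs) (b xs))"
  unfolding decidable_def by (rule comp_comp2)

lemma dec_comp3:
  assumes "decidable 3 (\<lambda>ys. f (ys ! 0) (ys ! 1) (ys ! 2))" "computable n a" "computable n b" "computable n c"
  shows "decidable n (\<lambda>xs. f (a xs) (b xs) (c xs))"
  using assms comp_subst[of 3 "\<lambda>ys. of_bool (f (ys ! 0) (ys ! 1) (ys ! 2))" "[a, b, c]" n]
  unfolding decidable_def by (auto simp: eval_nat_numeral)

lemma dec_comp4: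
  assumes "decidable 4 (\<lambda>ys. f (ys ! 0) (ys ! 1) (ys ! 2) (ys ! 3))" "computable n a" "computable n b" "computable n c" "computable n d"
  shows "decidable n (\<lambda>xs. f (a xs) (b xs) (c xs) (d xs))"
  using assms comp_subst[of 4 "\<lambda>ys. of_bool (f (ys ! 0) (ys ! 1) (ys ! 2) (ys ! 3))" "[a, b, c, d]" n]
  unfolding decidable_def by (auto simp: eval_nat_numeral)

lemma dec_comp5:
  assumes "decidable 5 (\<lambda>ys. f (ys ! 0) (ys ! 1) (ys ! 2) (ys ! 3) (ys ! 4))"
    "computable n a" "computable n b" "computable n c" "computable n d" "computable n e"
  shows "decidable n (\<lambda>xs. f (a xs) (b xs) (c xs) (d xs) (e xs))"
  using assms comp_subst[of 5 "\<lambda>ys. of_bool (f (ys ! 0) (ys ! 1) (ys ! 2) (ys ! 3) (ys ! 4))" "[a, b, c, d, e]" n]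
  unfolding decidable_def by (auto simp: eval_nat_numeral)

lemmas comp_vars = comp_nth comp_tl comp_tl2 comp_tl3 comp_tl4 comp_tl5 comp_tl6

lemma comp_add:
  assumes "computable n f" "computable n g"
  shows "computable n (\<lambda>xs. f xs + g xs)"
proof (rule comp_comp2[of "(+)", OF _ assms])
  have "rec_nat b (\<lambda>i. Suc) a = a + b" for a b :: nat by (induction a) auto
  then show "computable 2 (\<lambda>ys. ys ! 0 + ys ! 1)"
    using comp_rec[of 2 "\<lambda>xs. xs ! 0" "\<lambda>xs. xs ! 1" "\<lambda>i y xs. Suc y"] by (simp add: comp_nth comp_Suc)
qed

lemma comp_mult:
  assumes "computable n f" "computable n g"
  shows "computable n (\<lambda>xs. f xs * g xs)"
proof (rule comp_comp2[of "(*)", OF _ assms])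
  have "rec_nat 0 (\<lambda>i y. y + b) a = a * b" for a b :: nat by (induction a) auto
  then show "computable 2 (\<lambda>ys. ys ! 0 * ys ! 1)"
    using comp_rec[of 2 "\<lambda>xs. xs ! 0" "\<lambda>xs. 0" "\<lambda>i y xs. y + xs ! 1"]
    by (simp add: comp_nth comp_const comp_add comp_tl2)
qed

lemma comp_power:
  assumes "computable n f" "computable n g"
  shows "computable n (\<lambda>xs. f xs ^ g xs)"
proof (rule comp_comp2[of "(^)", OF _ assms])
  have "rec_nat (Suc 0) (\<lambda>i y. b * y) a = b ^ a" for a b :: nat by (induction a) auto
  then show "computable 2 (\<lambda>ys. ys ! 0 ^ ys ! 1)"
    using comp_rec[of 2 "\<lambda>xs. xs ! 1" "\<lambda>xs. Suc 0" "\<lambda>i y xs. xs ! 0 * y"]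
    by (simp add: comp_nth comp_const comp_mult comp_tl2)
qed

lemma comp_diff:
  assumes "computable n f" "computable n g"
  shows "computable n (\<lambda>xs. f xs - g xs)"
proof (rule comp_comp2[of "(-)", OF _ assms])
  have "rec_nat 0 (\<lambda>i y. i) a = a - 1" for a :: nat by (induction a) auto
  then have pred: "computable 1 (\<lambda>ys. ys ! 0 - 1)"
    using comp_rec[of 1 "\<lambda>xs. xs ! 0" "\<lambda>xs. 0" "\<lambda>i y xs. i"] by (simp add: comp_nth comp_const)
  have "rec_nat b (\<lambda>i y. y - 1) a = b - a" for a b :: nat by (induction a) auto
  then show "computable 2 (\<lambda>ys. ys ! 0 - ys ! 1)"
    using comp_rec[of 2 "\<lambda>xs. xs ! 1" "\<lambda>xs. xs ! 0" "\<lambda>i y xs. y - 1"] comp_comp1[OF pred]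
    by (simp add: comp_nth)
qed

section \<open>Decidable predicates, bounded sums and bounded quantifiers\<close>

lemma dec_const: "decidable n (\<lambda>xs. c)"
  unfolding decidable_def by (rule comp_const)

lemma dec_not: "decidable n P \<Longrightarrow> decidable n (\<lambda>xs. \<not> P xs)"
  unfolding decidable_def using comp_diff[OF comp_const[of n 1], of "\<lambda>xs. of_bool (P xs)"]
  by (auto elim: comp_cong)

lemma dec_conj: "decidable n P \<Longrightarrow> decidable n Q \<Longrightarrow> decidable n (\<lambda>xs. P xs \<and> Q xs)"
  unfolding decidable_def using comp_mult[of n "\<lambda>xs. of_bool (P xs)" "\<lambda>xs. of_bool (Q xs)"]
  by (auto elim: comp_cong)

lemma dec_disj: "decidable n P \<Longrightarrow> decidable n Q \<Longrightarrow> decidable n (\<lambda>xs. P xs \<or> Q xs)"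
  using dec_not[OF dec_conj[OF dec_not dec_not, of n P Q]] by simp

lemma dec_imp: "decidable n P \<Longrightarrow> decidable n Q \<Longrightarrow> decidable n (\<lambda>xs. P xs \<longrightarrow> Q xs)"
  unfolding imp_conv_disj by (intro dec_disj dec_not)

lemma dec_le:
  assumes "computable n f" "computable n g"
  shows "decidable n (\<lambda>xs. f xs \<le> g xs)"
proof -
  have "computable n (\<lambda>xs. 1 - (f xs - g xs))" using assms by (intro comp_diff comp_const)
  then show ?thesis unfolding decidable_def by (rule comp_cong) auto
qed

lemma dec_less: "computable n f \<Longrightarrow> computable n g \<Longrightarrow> decidable n (\<lambda>xs. f xs < g xs)"
  using dec_not[OF dec_le[of n g f]] by (simp add: not_le)

lemma dec_eq: "computable n f \<Longrightarrow> computable n g \<Longrightarrow> decidable n (\<lambda>xs. f xs = g xs)"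
  using dec_conj[OF dec_le[of n f g] dec_le[of n g f]] by (simp add: eq_iff)

lemma comp_if:
  assumes "decidable n P" "computable n f" "computable n g"
  shows "computable n (\<lambda>xs. if P xs then f xs else g xs)"
proof -
  have "computable n (\<lambda>xs. of_bool (P xs) * f xs + (1 - of_bool (P xs)) * g xs)"
    using assms unfolding decidable_def by (intro comp_add comp_mult comp_diff comp_const)
  then show ?thesis by (rule comp_cong) auto
qed

lemma comp_weaken:
  assumes "computable n f"
  shows "computable (Suc n) (\<lambda>ys. f (tl ys))"
proof -
  have "computable (Suc n) (\<lambda>ys. f (map (\<lambda>i. ys ! Suc i) [0..<n]))"
    using comp_subst[OF assms, of "map (\<lambda>i ys. ys ! Suc i) [0..<n]" "Suc n"] by (auto simp: comp_nth o_def)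
  then show ?thesis
  proof (rule comp_cong)
    fix ys :: "nat list" assume "length ys = Suc n"
    then have "map (\<lambda>i. ys ! Suc i) [0..<n] = tl ys" by (intro nth_equalityI) (auto simp: nth_tl)
    then show "f (map (\<lambda>i. ys ! Suc i) [0..<n]) = f (tl ys)" by simp
  qed
qed

text \<open>Bounded sums are the main tool below: an existential quantifier is a positive sum of
  truth values, a quotient counts multiples, and decoding sums over a unique preimage.\<close>

lemma comp_sum:
  assumes "computable n b" "computable (Suc n) (\<lambda>ys. f (ys ! 0) (tl ys))"
  shows "computable n (\<lambda>xs. \<Sum>i<b xs. f i xs)"
proof -
  \<comment> \<open>A recursion step receives the accumulator as second argument; the summand does
    not take it, so the substitution skips that position.\<close>
  let ?sub = "(\<lambda>ys. ys ! 0) # map (\<lambda>i ys. ys ! (i + 2)) [0..<n]"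
  have "computable (Suc (Suc n)) (\<lambda>ys. f (ys ! 0) (map (\<lambda>i. ys ! (i + 2)) [0..<n]))"
    using comp_subst[OF assms(2), of ?sub "Suc (Suc n)"] by (auto simp: comp_nth o_def)
  then have "computable (Suc (Suc n)) (\<lambda>ys. f (ys ! 0) (tl (tl ys)))"
  proof (rule comp_cong)
    fix ys :: "nat list" assume "length ys = Suc (Suc n)"
    then have "map (\<lambda>i. ys ! (i + 2)) [0..<n] = tl (tl ys)"
      by (intro nth_equalityI) (auto simp: nth_tl)
    then show "f (ys ! 0) (map (\<lambda>i. ys ! (i + 2)) [0..<n]) = f (ys ! 0) (tl (tl ys))" by simp
  qed
  then have "computable n (\<lambda>xs. rec_nat 0 (\<lambda>i y. y + f i xs) (b xs))"
    using assms(1) by (intro comp_rec comp_add comp_const comp_nth) simp_all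
  moreover have "rec_nat 0 (\<lambda>i y. y + f i xs) m = (\<Sum>i<m. f i xs)" for m xs by (induction m) auto
  ultimately show ?thesis by simp
qed

lemma dec_ex:
  assumes "computable n b" "decidable (Suc n) (\<lambda>ys. P (ys ! 0) (tl ys))"
  shows "decidable n (\<lambda>xs. \<exists>i<b xs. P i xs)"
proof -
  have "decidable n (\<lambda>xs. 1 \<le> (\<Sum>i<b xs. of_bool (P i xs) :: nat))"
    using assms unfolding decidable_def[of "Suc n"] by (intro dec_le comp_const comp_sum)
  moreover have "1 \<le> (\<Sum>i<m. of_bool (Q i) :: nat) \<longleftrightarrow> (\<exists>i<m. Q i)" for m :: nat and Q
  proof -
    have "(\<Sum>i<m. of_bool (Q i) :: nat) = 0 \<longleftrightarrow> (\<forall>i<m. \<not> Q i)" by auto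
    then show ?thesis by (metis One_nat_def Suc_le_eq neq0_conv)
  qed
  ultimately show ?thesis by simp
qed

lemma dec_all:
  assumes "computable n b" "decidable (Suc n) (\<lambda>ys. P (ys ! 0) (tl ys))"
  shows "decidable n (\<lambda>xs. \<forall>i<b xs. P i xs)"
  using dec_not[OF dec_ex[OF assms(1) dec_not[OF assms(2)]]] by simp

text \<open>The quotient counts the positive multiples of the divisor up to the dividend, of which
  there are at most as many as the dividend. The test for a positive divisor reproduces the value
  \<open>0\<close> of division by zero.\<close>

lemma comp_div:
  assumes "computable n f" "computable n g"
  shows "computable n (\<lambda>xs. f xs div g xs)"
proof -
  have "computable n (\<lambda>xs. f xs div g xs)" if "n = 2" "f = (\<lambda>xs. xs ! 0)" "g = (\<lambda>xs. xs ! 1)" for n f g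
  proof -
    have "computable 2 (\<lambda>xs. \<Sum>i<xs ! 0. of_bool (0 < xs ! 1 \<and> Suc i * xs ! 1 \<le> xs ! 0))"
      by (intro comp_sum dec_conj[unfolded decidable_def] dec_less[unfolded decidable_def] dec_le[unfolded decidable_def]
          comp_mult comp_Suc comp_const comp_vars) simp_all
    moreover have "(\<Sum>i<a. of_bool (0 < b \<and> Suc i * b \<le> a)) = a div b" for a b :: nat
    proof (cases "b = 0")
      case False
      then have "{i. i < a \<and> Suc i * b \<le> a} = {..<a div b}"
        by (auto simp: less_eq_div_iff_mult_less_eq Suc_le_eq[symmetric] simp del: mult_Suc)
           (meson Suc_le_eq div_le_dividend less_eq_div_iff_mult_less_eq order_trans neq0_conv)
      then have "card ({i. i < a \<and> Suc i * b \<le> a}) = a div b" by simp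
      moreover have "(\<Sum>i<a. of_bool (0 < b \<and> Suc i * b \<le> a)) = card ({..<a} \<inter> {i. Suc i * b \<le> a})"
        using False by (simp add: sum_of_bool_eq)
      moreover have "{..<a} \<inter> {i. Suc i * b \<le> a} = {i. i < a \<and> Suc i * b \<le> a}" by auto
      ultimately show ?thesis by simp
    qed simp
    ultimately show ?thesis using that by simp
  qed
  then show ?thesis using comp_comp2[of "(div)", OF _ assms] by blast
qed

lemma comp_mod:
  assumes "computable n f" "computable n g"
  shows "computable n (\<lambda>xs. f xs mod g xs)"
proof -
  have "computable n (\<lambda>xs. f xs - (f xs div g xs) * g xs)"
    using assms by (intro comp_diff comp_mult comp_div)
  then show ?thesis by (simp add: minus_div_mult_eq_mod)
qed

lemmas comp_arith = comp_const comp_add comp_mult comp_power comp_diff comp_Suc comp_div comp_mod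

lemmas dec_logic = dec_const dec_not dec_conj dec_disj dec_imp dec_le dec_less dec_eq dec_ex dec_all

lemma comp_prod_encode:
  "computable n f \<Longrightarrow> computable n g \<Longrightarrow> computable n (\<lambda>xs. prod_encode (f xs, g xs))"
  unfolding prod_encode_def triangle_def by simp (intro comp_arith)

text \<open>Both components are at most the code, so each can be found by a sum with a single
  relevant term.\<close>

lemma comp_prod_decode:
  assumes "computable n f"
  shows "computable n (\<lambda>xs. fst (prod_decode (f xs)))" "computable n (\<lambda>xs. snd (prod_decode (f xs)))"
proof -
  have "computable 1 (\<lambda>ys. \<Sum>i<Suc (ys ! 0). of_bool (\<exists>j<Suc (ys ! 0). prod_encode (i, j) = ys ! 0) * i)"
    by (intro comp_sum comp_mult dec_ex[unfolded decidable_def] dec_eq[unfolded decidable_def] comp_prod_encode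
        comp_arith comp_vars) simp_all
  moreover have "(\<Sum>i<Suc c. of_bool (\<exists>j<Suc c. prod_encode (i, j) = c) * i) = fst (prod_decode c)" for c
  proof -
    obtain a b where ab: "c = prod_encode (a, b)" by (metis prod_decode_inverse surj_pair)
    have "(\<exists>j<Suc c. prod_encode (i, j) = c) \<longleftrightarrow> i = a" for i
      using le_prod_encode_2[of b a] by (auto simp: ab prod_encode_eq)
    then have "(\<Sum>i<Suc c. of_bool (\<exists>j<Suc c. prod_encode (i, j) = c) * i) =
        (\<Sum>i<Suc c. if i = a then a else 0)" by (intro sum.cong) auto
    also have "\<dots> = a" using le_prod_encode_1[of a b] by (simp add: ab)
    finally show ?thesis by (simp add: ab)
  qed
  ultimately have "computable 1 (\<lambda>ys. fst (prod_decode (ys ! 0)))" by simp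
  then show "computable n (\<lambda>xs. fst (prod_decode (f xs)))" by (rule comp_comp1[OF _ assms])
  have "computable 1 (\<lambda>ys. \<Sum>j<Suc (ys ! 0). of_bool (\<exists>i<Suc (ys ! 0). prod_encode (i, j) = ys ! 0) * j)"
    by (intro comp_sum comp_mult dec_ex[unfolded decidable_def] dec_eq[unfolded decidable_def] comp_prod_encode
        comp_arith comp_vars) simp_all
  moreover have "(\<Sum>j<Suc c. of_bool (\<exists>i<Suc c. prod_encode (i, j) = c) * j) = snd (prod_decode c)" for c
  proof -
    obtain a b where ab: "c = prod_encode (a, b)" by (metis prod_decode_inverse surj_pair)
    have "(\<exists>i<Suc c. prod_encode (i, j) = c) \<longleftrightarrow> j = b" for j
      using le_prod_encode_1[of a b] by (auto simp: ab prod_encode_eq)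
    then have "(\<Sum>j<Suc c. of_bool (\<exists>i<Suc c. prod_encode (i, j) = c) * j) =
        (\<Sum>j<Suc c. if j = b then b else 0)" by (intro sum.cong) auto
    also have "\<dots> = b" using le_prod_encode_2[of b a] by (simp add: ab)
    finally show ?thesis by (simp add: ab)
  qed
  ultimately have "computable 1 (\<lambda>ys. snd (prod_decode (ys ! 0)))" by simp
  then show "computable n (\<lambda>xs. snd (prod_decode (f xs)))" by (rule comp_comp1[OF _ assms])
qed

section \<open>Computing with integers, sites and finite sets\<close>

text \<open>Programs handle natural numbers only. An integer is split into its positive and negative
  part, one of which is zero.\<close>

definition computable_int :: "nat \<Rightarrow> (nat list \<Rightarrow> int) \<Rightarrow> bool" where
  "computable_int n f \<longleftrightarrow> computable n (\<lambda>xs. nat (f xs)) \<and> computable n (\<lambda>xs. nat (- f xs))"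

definition computable_site :: "nat \<Rightarrow> (nat list \<Rightarrow> site) \<Rightarrow> bool" where
  "computable_site n f \<longleftrightarrow> computable_int n (\<lambda>xs. fst (f xs)) \<and> computable_int n (\<lambda>xs. snd (f xs))"

lemma compi_int: "computable n f \<Longrightarrow> computable_int n (\<lambda>xs. int (f xs))"
  unfolding computable_int_def by (simp add: comp_const)

lemma compi_uminus: "computable_int n f \<Longrightarrow> computable_int n (\<lambda>xs. - f xs)"
  unfolding computable_int_def by simp

lemma compi_add:
  assumes "computable_int n f" "computable_int n g"
  shows "computable_int n (\<lambda>xs. f xs + g xs)"
proof -
  have "computable n (\<lambda>xs. (nat (f xs) + nat (g xs)) - (nat (- f xs) + nat (- g xs)))"
    "computable n (\<lambda>xs. (nat (- f xs) + nat (- g xs)) - (nat (f xs) + nat (g xs)))"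
    using assms unfolding computable_int_def by (intro comp_diff comp_add; blast)+
  moreover have "(nat a + nat b) - (nat (- a) + nat (- b)) = nat (a + b)"
    "(nat (- a) + nat (- b)) - (nat a + nat b) = nat (- (a + b))" for a b :: int
    by linarith+
  ultimately show ?thesis unfolding computable_int_def by simp
qed

lemma compi_diff: "computable_int n f \<Longrightarrow> computable_int n g \<Longrightarrow> computable_int n (\<lambda>xs. f xs - g xs)"
  using compi_add[OF _ compi_uminus, of n f g] by simp

lemma compi_mult:
  assumes "computable_int n f" "computable_int n g"
  shows "computable_int n (\<lambda>xs. f xs * g xs)"
proof -
  have *: "computable n (\<lambda>xs. nat (f xs) * nat (g xs) + nat (- f xs) * nat (- g xs))"
    "computable n (\<lambda>xs. nat (f xs) * nat (- g xs) + nat (- f xs) * nat (g xs))"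
    using assms unfolding computable_int_def by (intro comp_mult comp_add; blast)+
  have "nat a * nat b + nat (- a) * nat (- b) = nat (a * b)"
    "nat a * nat (- b) + nat (- a) * nat b = nat (- (a * b))" for a b :: int
    by (cases "a \<ge> 0"; cases "b \<ge> 0"; simp add: mult_nonneg_nonpos mult_nonpos_nonneg mult_nonpos_nonpos
        flip: nat_mult_distrib nat_mult_distrib_neg)+
  then show ?thesis using * unfolding computable_int_def by simp
qed

lemma compi_abs:
  assumes "computable_int n f"
  shows "computable_int n (\<lambda>xs. \<bar>f xs\<bar>)"
proof -
  have "computable n (\<lambda>xs. nat (f xs) + nat (- f xs))" using assms unfolding computable_int_def by (intro comp_add; blast)
  moreover have "nat a + nat (- a) = nat \<bar>a\<bar>" for a :: int by linarith
  ultimately show ?thesis unfolding computable_int_def by (simp add: comp_const)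
qed

lemma dec_le_int:
  assumes "computable_int n f" "computable_int n g"
  shows "decidable n (\<lambda>xs. f xs \<le> g xs)"
proof -
  have "decidable n (\<lambda>xs. nat (f xs) + nat (- g xs) \<le> nat (g xs) + nat (- f xs))"
    using assms unfolding computable_int_def by (intro dec_le comp_add; blast)
  moreover have "nat a + nat (- b) \<le> nat b + nat (- a) \<longleftrightarrow> a \<le> b" for a b :: int by linarith
  ultimately show ?thesis by simp
qed

lemma dec_less_int: "computable_int n f \<Longrightarrow> computable_int n g \<Longrightarrow> decidable n (\<lambda>xs. f xs < g xs)"
  using dec_not[OF dec_le_int[of n g f]] by (simp add: not_le)

lemma dec_eq_int: "computable_int n f \<Longrightarrow> computable_int n g \<Longrightarrow> decidable n (\<lambda>xs. f xs = g xs)"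
  using dec_conj[OF dec_le_int[of n f g] dec_le_int[of n g f]] by (simp add: eq_iff)

lemma compi_const: "computable_int n (\<lambda>xs. c)"
  unfolding computable_int_def by (simp add: comp_const)

lemma compi_int_decode:
  assumes "computable n f"
  shows "computable_int n (\<lambda>xs. int_decode (f xs))"
proof -
  have "computable n (\<lambda>xs. if f xs mod 2 = 0 then f xs div 2 else 0)"
    "computable n (\<lambda>xs. if f xs mod 2 = 0 then 0 else Suc (f xs div 2))"
    using assms by (intro comp_if comp_arith dec_eq; assumption)+
  moreover have "(if c mod 2 = 0 then c div 2 else 0) = nat (int_decode c)"
    "(if c mod 2 = 0 then 0 else Suc (c div 2)) = nat (- int_decode c)" for c
    by (auto simp: int_decode_def sum_decode_def even_iff_mod_2_eq_zero odd_iff_mod_2_eq_one)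
  ultimately show ?thesis unfolding computable_int_def by simp
qed

lemma comp_int_encode:
  assumes "computable_int n f"
  shows "computable n (\<lambda>xs. int_encode (f xs))"
proof -
  have "computable n (\<lambda>xs. 2 * nat (f xs) + (2 * nat (- f xs) - 1))"
    using assms unfolding computable_int_def by (intro comp_arith; blast)
  moreover have "2 * nat a + (2 * nat (- a) - 1) = int_encode a" for a
    by (auto simp: int_encode_def sum_encode_def)
  ultimately show ?thesis by simp
qed

text \<open>An internal numbering of all sites, unrelated to the binary input format. It is a
  bijection, so quantifiers over codes are quantifiers over sites.\<close>

definition site_of :: "nat \<Rightarrow> site" where
  "site_of c = (int_decode (fst (prod_decode c)), int_decode (snd (prod_decode c)))"

definition site_code :: "site \<Rightarrow> nat" where
  "site_code x = prod_encode (int_encode (fst x), int_encode (snd x))"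

lemma site_of_code [simp]: "site_of (site_code x) = x"
  by (simp add: site_of_def site_code_def)

lemma site_code_of [simp]: "site_code (site_of c) = c"
  by (simp add: site_of_def site_code_def)

lemma comps_site_of: "computable n f \<Longrightarrow> computable_site n (\<lambda>xs. site_of (f xs))"
  unfolding computable_site_def site_of_def by (simp add: compi_int_decode comp_prod_decode)

lemma comp_site_code: "computable_site n f \<Longrightarrow> computable n (\<lambda>xs. site_code (f xs))"
  unfolding computable_site_def site_code_def by (intro comp_prod_encode comp_int_encode) simp_all

lemma comps_add: "computable_site n f \<Longrightarrow> computable_site n g \<Longrightarrow> computable_site n (\<lambda>xs. f xs + g xs)"
  unfolding computable_site_def by (simp add: compi_add)

lemma comps_diff: "computable_site n f \<Longrightarrow> computable_site n g \<Longrightarrow> computable_site n (\<lambda>xs. f xs - g xs)"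
  unfolding computable_site_def by (simp add: compi_diff)

lemma comps_uminus: "computable_site n f \<Longrightarrow> computable_site n (\<lambda>xs. - f xs)"
  unfolding computable_site_def by (simp add: compi_uminus)

lemma comps_rot: "computable_site n f \<Longrightarrow> computable_site n (\<lambda>xs. rot (f xs))"
  unfolding computable_site_def rot_def by (simp add: compi_uminus)

lemma comps_const: "computable_site n (\<lambda>xs. c)"
  unfolding computable_site_def by (simp add: compi_const)

lemma compi_idot: "computable_site n f \<Longrightarrow> computable_site n g \<Longrightarrow> computable_int n (\<lambda>xs. idot (f xs) (g xs))"
  unfolding computable_site_def idot_def by (intro compi_add compi_mult) simp_all

lemma compi_nrm1: "computable_site n f \<Longrightarrow> computable_int n (\<lambda>xs. nrm1 (f xs))"
  unfolding computable_site_def nrm1_def by (intro compi_add compi_abs) simp_all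

lemma dec_nrm_le:
  assumes "computable_site n f" "computable_int n g"
  shows "decidable n (\<lambda>xs. nrm (f xs) \<le> g xs)"
proof -
  have "decidable n (\<lambda>xs. \<bar>fst (f xs)\<bar> \<le> g xs \<and> \<bar>snd (f xs)\<bar> \<le> g xs)"
    using assms unfolding computable_site_def by (intro dec_conj dec_le_int compi_abs) simp_all
  then show ?thesis by (simp add: nrm_def)
qed

lemma dec_eq_site: "computable_site n f \<Longrightarrow> computable_site n g \<Longrightarrow> decidable n (\<lambda>xs. f xs = g xs)"
  unfolding computable_site_def prod_eq_iff by (intro dec_conj dec_eq_int) simp_all

lemma dec_below: "computable_site n f \<Longrightarrow> computable_site n g \<Longrightarrow> decidable n (\<lambda>xs. f xs \<in> below (g xs))"
  unfolding below_def by simp (intro dec_less_int compi_idot compi_const)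

text \<open>The binary digits of \<open>c\<close> mark the codes of the members. The sets all of
  whose codes are below \<open>b\<close> are thus exactly those given by the numbers below
  \<open>2 ^ b\<close>.\<close>

definition sset :: "nat \<Rightarrow> site set" where
  "sset c = site_of ` set_decode c"

lemma in_sset: "x \<in> sset c \<longleftrightarrow> site_code x \<in> set_decode c"
  unfolding sset_def by (metis image_iff site_code_of site_of_code)

lemma set_decode_less: "i \<in> set_decode c \<Longrightarrow> 2 ^ i \<le> c"
  unfolding set_decode_def by (metis div_less even_zero mem_Collect_eq not_le)

lemma dec_sset:
  assumes "computable_site n f" "computable n c"
  shows "decidable n (\<lambda>xs. f xs \<in> sset (c xs))"
proof -
  have "decidable n (\<lambda>xs. (c xs div 2 ^ site_code (f xs)) mod 2 = 1)"
    using assms by (intro dec_eq comp_arith comp_site_code)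
  then show ?thesis by (simp add: in_sset set_decode_def odd_iff_mod_2_eq_one)
qed

text \<open>A member code \<open>i\<close> satisfies \<open>i < 2 ^ i\<close> and
  \<open>2 ^ i \<le> c\<close>, so the search for members can stop at \<open>c\<close>.\<close>

lemma dec_ball_sset:
  assumes "computable n c" "decidable (Suc n) (\<lambda>ys. P (site_of (ys ! 0)) (tl ys))"
  shows "decidable n (\<lambda>xs. \<forall>x\<in>sset (c xs). P x xs)"
proof -
  have "decidable n (\<lambda>xs. \<forall>i<c xs. site_of i \<in> sset (c xs) \<longrightarrow> P (site_of i) xs)"
    using assms by (intro dec_all dec_imp dec_sset comps_site_of comp_nth comp_weaken) simp_all
  moreover have "(\<forall>i<c. site_of i \<in> sset c \<longrightarrow> P (site_of i) xs) \<longleftrightarrow> (\<forall>x\<in>sset c. P x xs)" for c xs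
  proof -
    have "i < c" if "i \<in> set_decode c" for i
      using set_decode_less[OF that] less_exp[of i] by linarith
    then show ?thesis by (auto simp: in_sset) (metis in_sset site_of_code surj_pair)
  qed
  ultimately show ?thesis by simp
qed

lemma dec_bex_sset:
  assumes "computable n c" "decidable (Suc n) (\<lambda>ys. P (site_of (ys ! 0)) (tl ys))"
  shows "decidable n (\<lambda>xs. \<exists>x\<in>sset (c xs). P x xs)"
  using dec_not[OF dec_ball_sset[OF assms(1) dec_not[OF assms(2)]]] by simp

lemma comp_card_sset:
  assumes "computable n c"
  shows "computable n (\<lambda>xs. card (sset (c xs)))"
proof -
  have "computable 1 (\<lambda>xs. \<Sum>i<xs ! 0. of_bool (site_of i \<in> sset (xs ! 0)))"
    by (intro comp_sum dec_sset[unfolded decidable_def] comps_site_of comp_vars) simp_all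
  moreover have "(\<Sum>i<c. of_bool (site_of i \<in> sset c)) = card (sset c)" for c
  proof -
    have "i < c" if "i \<in> set_decode c" for i
      using set_decode_less[OF that] less_exp[of i] by linarith
    then have "{..<c} \<inter> {i. site_of i \<in> sset c} = set_decode c" by (auto simp: in_sset)
    moreover have "inj_on site_of (set_decode c)" by (metis inj_onI site_code_of)
    ultimately show ?thesis by (simp add: sum_of_bool_eq sset_def card_image)
  qed
  ultimately have "computable 1 (\<lambda>xs. card (sset (xs ! 0)))" by simp
  then show ?thesis by (rule comp_comp1[OF _ assms])
qed

section \<open>Decoding the input\<close>

text \<open>A nonempty list is coded by the successor of a pair, hence \<open>c - 1\<close>. The
  empty list has code \<open>0\<close>, on which head and tail are both \<open>0\<close>.\<close>

definition hd_code :: "nat \<Rightarrow> nat" where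
  "hd_code c = fst (prod_decode (c - 1))"

definition tl_code :: "nat \<Rightarrow> nat" where
  "tl_code c = snd (prod_decode (c - 1))"

definition drop_code :: "nat \<Rightarrow> nat \<Rightarrow> nat" where
  "drop_code i c = (tl_code ^^ i) c"

lemma prod_decode_0: "prod_decode 0 = (0, 0)"
  by (simp add: prod_decode_def prod_decode_aux.simps)

lemma tl_code_encode: "tl_code (list_encode xs) = list_encode (tl xs)"
  by (cases xs) (simp_all add: tl_code_def prod_decode_0)

lemma drop_code_encode: "drop_code i (list_encode xs) = list_encode (drop i xs)"
  unfolding drop_code_def by (induction i) (simp_all add: tl_code_encode drop_Suc tl_drop)

lemma list_encode_eq_0: "list_encode xs = 0 \<longleftrightarrow> xs = []"
  by (cases xs) auto

lemma hd_drop_code: "hd_code (drop_code i (list_encode xs)) = (if i < length xs then xs ! i else 0)"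
  by (cases "drop i xs")
    (auto simp: drop_code_encode hd_code_def prod_decode_0 hd_drop_conv_nth[symmetric] simp flip: hd_drop_conv_nth)

lemma comp_hd_code: "computable n f \<Longrightarrow> computable n (\<lambda>xs. hd_code (f xs))"
  unfolding hd_code_def by (intro comp_prod_decode comp_diff comp_const)

lemma comp_tl_code: "computable n f \<Longrightarrow> computable n (\<lambda>xs. tl_code (f xs))"
  unfolding tl_code_def by (intro comp_prod_decode comp_diff comp_const)

lemma comp_drop_code:
  assumes "computable n f" "computable n g"
  shows "computable n (\<lambda>xs. drop_code (f xs) (g xs))"
proof -
  have "rec_nat c (\<lambda>i. tl_code) i = drop_code i c" for i c
    unfolding drop_code_def by (induction i) auto
  then show ?thesis using comp_rec[OF assms, of "\<lambda>i y xs. tl_code y"]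
    by (simp add: comp_tl_code comp_nth)
qed

definition lset :: "nat \<Rightarrow> nat set" where
  "lset c = set (list_decode c)"

lemma length_le_list_encode: "length xs \<le> list_encode xs"
proof (induction xs)
  case (Cons x xs)
  then show ?case using le_prod_encode_2[of "list_encode xs" x] by simp
qed simp

lemma in_set_le_list_encode: "x \<in> set xs \<Longrightarrow> x \<le> list_encode xs"
proof (induction xs)
  case (Cons y xs)
  then show ?case using le_prod_encode_1[of y "list_encode xs"] le_prod_encode_2[of "list_encode xs" y] by auto
qed simp

text \<open>Length and entries of a list are bounded by its code, which gives membership a bounded
  form. A nonzero remainder after dropping \<open>i\<close> entries says that position
  \<open>i\<close> exists.\<close>

lemma in_lset_iff: "x \<in> lset c \<longleftrightarrow> x < Suc c \<and> (\<exists>i<c. drop_code i c \<noteq> 0 \<and> hd_code (drop_code i c) = x)"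
proof -
  obtain xs where c: "c = list_encode xs" by (metis list_decode_inverse)
  have "(\<exists>i<c. drop_code i c \<noteq> 0 \<and> hd_code (drop_code i c) = x) \<longleftrightarrow> (\<exists>i<length xs. xs ! i = x)"
    using length_le_list_encode[of xs] unfolding c hd_drop_code
    by (auto simp: drop_code_encode list_encode_eq_0 not_le split: if_splits intro: order_less_le_trans)
  moreover have "x \<in> lset c \<longleftrightarrow> (\<exists>i<length xs. xs ! i = x)" by (simp add: lset_def c in_set_conv_nth)
  moreover have "x < Suc c" if "x \<in> lset c"
    using that in_set_le_list_encode[of x xs] by (simp add: lset_def c)
  ultimately show ?thesis by (simp only:) blast
qed

lemma dec_ball_lset:
  assumes "computable n c" "decidable (Suc n) (\<lambda>ys. P (ys ! 0) (tl ys))"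
  shows "decidable n (\<lambda>xs. \<forall>x\<in>lset (c xs). P x xs)"
proof -
  have "decidable 2 (\<lambda>ys. \<exists>i<ys ! 1. drop_code i (ys ! 1) \<noteq> 0 \<and> hd_code (drop_code i (ys ! 1)) = ys ! 0)"
    by (intro dec_logic comp_hd_code comp_drop_code comp_arith comp_vars) simp_all
  from dec_comp2[OF this, of "Suc n" "\<lambda>ys. ys ! 0" "\<lambda>ys. c (tl ys)"]
  have "decidable n (\<lambda>xs. \<forall>x<Suc (c xs). (\<exists>i<c xs. drop_code i (c xs) \<noteq> 0 \<and> hd_code (drop_code i (c xs)) = x) \<longrightarrow> P x xs)"
    using assms by (intro dec_all dec_imp comp_Suc) (simp_all add: comp_nth comp_weaken)
  then show ?thesis unfolding Ball_def in_lset_iff by (simp only: imp_conjL)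
qed

lemma dec_bex_lset:
  assumes "computable n c" "decidable (Suc n) (\<lambda>ys. P (ys ! 0) (tl ys))"
  shows "decidable n (\<lambda>xs. \<exists>x\<in>lset (c xs). P x xs)"
  using dec_not[OF dec_ball_lset[OF assms(1) dec_not[OF assms(2)]]] by simp

text \<open>The first entry is the sign, the others are binary digits. Summing up to
  \<open>c\<close> avoids computing the length: positions past the end read as digit
  \<open>0\<close>.\<close>

definition dint :: "nat \<Rightarrow> int" where
  "dint c = (if hd_code c = 1 then - 1 else 1) * int (\<Sum>i<c. hd_code (drop_code (Suc i) c) * 2 ^ i)"

definition dsite :: "nat \<Rightarrow> site" where
  "dsite c = (dint (fst (prod_decode c)), dint (snd (prod_decode c)))"

definition rset :: "nat \<Rightarrow> site set" where
  "rset r = dsite ` lset r"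

definition fam :: "nat \<Rightarrow> site set set" where
  "fam x = rset ` lset x"

lemma bits_value: "(\<Sum>i<length (bits n). bits n ! i * 2 ^ i) = n"
proof (induction n rule: bits.induct)
  case (1 n)
  show ?case
  proof (cases "n = 0")
    case True
    then show ?thesis by (simp add: bits.simps)
  next
    case False
    then have b: "bits n = n mod 2 # bits (n div 2)" by (simp add: bits.simps)
    have "(\<Sum>i<length (bits n). bits n ! i * 2 ^ i) =
        n mod 2 + (\<Sum>i<length (bits (n div 2)). bits (n div 2) ! i * 2 ^ Suc i)"
      unfolding b by (simp add: sum.lessThan_Suc_shift del: sum.lessThan_Suc)
    also have "(\<Sum>i<length (bits (n div 2)). bits (n div 2) ! i * 2 ^ Suc i) = 2 * (n div 2)"
      using 1[OF False] by (simp add: sum_distrib_left[symmetric] mult.left_commute)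
    finally show ?thesis by simp
  qed
qed

lemma dint_int_bits: "dint (list_encode (int_bits z)) = z"
proof -
  let ?b = "bits (nat \<bar>z\<bar>)" and ?c = "list_encode (int_bits z)"
  have c: "int_bits z = (if z < 0 then 1 else 0) # ?b" by (simp add: int_bits_def)
  have hd: "hd_code (drop_code (Suc i) ?c) = (if i < length ?b then ?b ! i else 0)" for i
    unfolding hd_drop_code c by simp
  have len: "length ?b \<le> ?c" using length_le_list_encode[of "int_bits z"] by (simp add: c)
  have "(\<Sum>i<?c. hd_code (drop_code (Suc i) ?c) * 2 ^ i) = (\<Sum>i<length ?b. ?b ! i * 2 ^ i)"
    unfolding hd using len by (intro sum.mono_neutral_cong_right) auto
  moreover have "hd_code ?c = (if z < 0 then 1 else 0)" by (simp add: c hd_code_def)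
  ultimately show ?thesis unfolding dint_def bits_value by simp
qed

lemma dsite_encode: "dsite (encode_site y) = y"
  by (simp add: dsite_def encode_site_def dint_int_bits)

lemma fam_encode: "fam (encode_input rs) = family_of rs"
  by (simp add: fam_def rset_def lset_def encode_input_def family_of_def image_image dsite_encode)

lemma compi_dint:
  assumes "computable n f"
  shows "computable_int n (\<lambda>xs. dint (f xs))"
proof -
  have "computable 1 (\<lambda>ys. \<Sum>i<ys ! 0. hd_code (drop_code (Suc i) (ys ! 0)) * 2 ^ i)"
    by (intro comp_sum comp_hd_code comp_drop_code comp_arith comp_vars) simp_all
  from comp_comp1[OF this assms]
  have s: "computable n (\<lambda>xs. \<Sum>i<f xs. hd_code (drop_code (Suc i) (f xs)) * 2 ^ i)" .
  have "computable_int n (\<lambda>xs. int (if hd_code (f xs) = 1 then 0 else \<Sum>i<f xs. hd_code (drop_code (Suc i) (f xs)) * 2 ^ i)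
      - int (if hd_code (f xs) = 1 then \<Sum>i<f xs. hd_code (drop_code (Suc i) (f xs)) * 2 ^ i else 0))"
    by (intro compi_diff compi_int comp_if dec_eq comp_hd_code comp_const s assms)
  moreover have "int (if h then 0 else s) - int (if h then s else 0) = (if h then - 1 else 1) * int s" for h s
    by simp
  ultimately show ?thesis unfolding dint_def by (simp only:)
qed

lemma comps_dsite: "computable n f \<Longrightarrow> computable_site n (\<lambda>xs. dsite (f xs))"
  unfolding computable_site_def dsite_def by (simp add: compi_dint comp_prod_decode)

lemma dec_ball_rset:
  "computable n c \<Longrightarrow> decidable (Suc n) (\<lambda>ys. P (dsite (ys ! 0)) (tl ys)) \<Longrightarrow> decidable n (\<lambda>xs. \<forall>y\<in>rset (c xs). P y xs)"
  using dec_ball_lset[of n c "\<lambda>i. P (dsite i)"] by (simp add: rset_def)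

lemma dec_bex_rset:
  "computable n c \<Longrightarrow> decidable (Suc n) (\<lambda>ys. P (dsite (ys ! 0)) (tl ys)) \<Longrightarrow> decidable n (\<lambda>xs. \<exists>y\<in>rset (c xs). P y xs)"
  using dec_bex_lset[of n c "\<lambda>i. P (dsite i)"] by (simp add: rset_def)

lemma dec_ball_fam:
  "computable n c \<Longrightarrow> decidable (Suc n) (\<lambda>ys. P (rset (ys ! 0)) (tl ys)) \<Longrightarrow> decidable n (\<lambda>xs. \<forall>U\<in>fam (c xs). P U xs)"
  using dec_ball_lset[of n c "\<lambda>i. P (rset i)"] by (simp add: fam_def)

lemma dec_bex_fam:
  "computable n c \<Longrightarrow> decidable (Suc n) (\<lambda>ys. P (rset (ys ! 0)) (tl ys)) \<Longrightarrow> decidable n (\<lambda>xs. \<exists>U\<in>fam (c xs). P U xs)"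
  using dec_bex_lset[of n c "\<lambda>i. P (rset i)"] by (simp add: fam_def)

lemmas dec_site_rules = dec_ball_fam dec_bex_fam dec_ball_rset dec_bex_rset dec_ball_sset dec_bex_sset
  dec_sset dec_below dec_nrm_le dec_eq_site dec_le_int dec_less_int dec_eq_int

lemmas comp_site_rules = comps_add comps_diff comps_uminus comps_rot comps_site_of comps_dsite comps_const
  compi_idot compi_nrm1 compi_int compi_const comp_card_sset comp_site_code

section \<open>Certificates\<close>

text \<open>A rule application that could violate closedness uses a site \<open>w\<close> of
  \<open>W\<close>, since a stable half plane is closed by itself. The new site is then of the form
  \<open>w - y\<close>, which leaves finitely many cases although the half plane is
  infinite.\<close>

definition local_closed :: "nat \<Rightarrow> nat \<Rightarrow> nat \<Rightarrow> bool" where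
  "local_closed x u W \<longleftrightarrow> (\<forall>U\<in>fam x. \<forall>y\<in>U. \<forall>w\<in>sset W.
     (\<forall>y'\<in>U. w - y + y' \<in> below (site_of u) \<or> w - y + y' \<in> sset W) \<longrightarrow>
       w - y \<in> below (site_of u) \<or> w - y \<in> sset W)"

definition cont_check :: "nat \<Rightarrow> nat \<Rightarrow> nat \<Rightarrow> nat \<Rightarrow> nat \<Rightarrow> bool" where
  "cont_check x u D Z W \<longleftrightarrow> (\<forall>z\<in>sset Z. z \<in> sset W) \<and>
     (\<forall>w\<in>sset W. \<exists>z\<in>sset Z. nrm (w - z) \<le> int D) \<and> local_closed x u W"

text \<open>All sites of norm at most \<open>M\<close> have a code below \<open>(4 * M + 1)\<^sup>2 + 1\<close>.\<close>

definition finite_check :: "nat \<Rightarrow> nat \<Rightarrow> nat \<Rightarrow> nat \<Rightarrow> bool" where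
  "finite_check x u k b \<longleftrightarrow> (\<exists>D<b. (\<forall>U\<in>fam x. \<forall>y\<in>U. nrm y \<le> int D) \<and> nrm1 (site_of u) \<le> int D \<and>
     (\<forall>Z<2 ^ ((4 * (4 * k * D + 4 * D * D) + 1) ^ 2 + 1).
        card (sset Z) \<le> k \<longrightarrow>
          (\<exists>W<b. cont_check x (site_code 0) D Z W) \<and>
          ((\<forall>z\<in>sset Z. z \<notin> below (site_of u)) \<longrightarrow> (\<exists>W<b. cont_check x u D Z W))))"

text \<open>Instead of coding derivations, \<open>w\<close> is required to lie in every set
  \<open>V\<close> of sites with codes below \<open>b\<close> that contains \<open>Z\<close> and is
  closed at those sites. A failing \<open>V\<close> refutes membership only within this window, so a
  large \<open>b\<close> is needed to recognise a site of the closure.\<close>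

definition derives :: "nat \<Rightarrow> nat \<Rightarrow> nat \<Rightarrow> nat \<Rightarrow> nat \<Rightarrow> bool" where
  "derives x u b Z w \<longleftrightarrow> (\<forall>V<2 ^ b. (\<forall>z\<in>sset Z. z \<in> sset V) \<and>
     (\<forall>s<b. (\<exists>U\<in>fam x. \<forall>y\<in>U. site_of s + y \<in> below (site_of u) \<or> site_of s + y \<in> sset V) \<longrightarrow>
        site_of s \<in> sset V) \<longrightarrow>
     site_of w \<in> below (site_of u) \<or> site_of w \<in> sset V)"

definition spread_at :: "nat \<Rightarrow> nat \<Rightarrow> nat \<Rightarrow> nat \<Rightarrow> bool" where
  "spread_at x u k b \<longleftrightarrow> (\<exists>Z<2 ^ b. \<exists>W<2 ^ b. \<exists>v<b. card (sset Z) \<le> k \<and>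
     (\<forall>z\<in>sset Z. z \<notin> below (site_of u)) \<and> 1 \<le> card (sset W) \<and>
     (\<forall>w\<in>sset W. w \<notin> below (site_of u)) \<and> idot (site_of v) (site_of u) = 0 \<and> site_of v \<noteq> 0 \<and>
     (\<forall>w\<in>sset W. derives x u b Z (site_code w) \<and> derives x u b W (site_code (w + site_of v))))"

text \<open>Allowing any smaller bound makes the certificate monotone in \<open>b\<close> by
  construction.\<close>

definition spread_check :: "nat \<Rightarrow> nat \<Rightarrow> nat \<Rightarrow> nat \<Rightarrow> bool" where
  "spread_check x u k b \<longleftrightarrow> (\<exists>b'<b. spread_at x u k b')"

definition lex_pos :: "site \<Rightarrow> site \<Rightarrow> bool" where
  "lex_pos w e \<longleftrightarrow> idot w e > 0 \<or> idot w e = 0 \<and> idot w (rot e) > 0"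

definition edge_good :: "nat \<Rightarrow> nat \<Rightarrow> nat \<Rightarrow> nat \<Rightarrow> nat \<Rightarrow> bool" where
  "edge_good x k b w e \<longleftrightarrow>
     (lex_pos (site_of w) (site_of e) \<longrightarrow> lex_unstable (fam x) (site_of e)) \<and>
     (idot (site_of w) (site_of e) > 0 \<and> int_stable (fam x) (site_of e) \<longrightarrow> spread_check x e k b)"

text \<open>Not the negation of \<open>edge_good\<close>: the absence of a spreading set is replaced
  by the positive certificate \<open>finite_check\<close>, since failing to find a spreading set
  below \<open>b\<close> proves nothing.\<close>

definition edge_bad :: "nat \<Rightarrow> nat \<Rightarrow> nat \<Rightarrow> nat \<Rightarrow> nat \<Rightarrow> bool" where
  "edge_bad x k b w e \<longleftrightarrow>
     lex_pos (site_of w) (site_of e) \<and> \<not> lex_unstable (fam x) (site_of e) \<or>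
     idot (site_of w) (site_of e) > 0 \<and> int_stable (fam x) (site_of e) \<and> finite_check x e k b"

text \<open>The quantifier over the \<open>rot\<close> images of \<open>dirs\<close> is written out
  over rules and their elements, matching the decidable quantifiers at hand.\<close>

definition all_good :: "nat \<Rightarrow> nat \<Rightarrow> nat \<Rightarrow> nat \<Rightarrow> bool" where
  "all_good x k b w \<longleftrightarrow> (\<forall>U\<in>fam x. \<forall>y\<in>U.
     edge_good x k b w (site_code (rot y)) \<and> edge_good x k b w (site_code (rot (- y))))"

definition some_bad :: "nat \<Rightarrow> nat \<Rightarrow> nat \<Rightarrow> nat \<Rightarrow> bool" where
  "some_bad x k b w \<longleftrightarrow> (\<exists>U\<in>fam x. \<exists>y\<in>U.
     edge_bad x k b w (site_code (rot y)) \<or> edge_bad x k b w (site_code (rot (- y))))"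

definition upper_check :: "nat \<Rightarrow> nat \<Rightarrow> nat \<Rightarrow> bool" where
  "upper_check x k b \<longleftrightarrow> (\<exists>U\<in>fam x. \<exists>y\<in>U. all_good x k b (site_code y) \<or> all_good x k b (site_code (- y)))"

text \<open>For positive \<open>k\<close> it refutes the bound \<open>k - 1\<close> on every
  candidate semicircle; for \<open>k = 0\<close> the lower bound is automatic, and truncated
  subtraction must be kept out.\<close>

definition lower_check :: "nat \<Rightarrow> nat \<Rightarrow> nat \<Rightarrow> bool" where
  "lower_check x k b \<longleftrightarrow> k = 0 \<or>
     (\<forall>U\<in>fam x. \<forall>y\<in>U. some_bad x (k - 1) b (site_code y) \<and> some_bad x (k - 1) b (site_code (- y)))"

text \<open>\<open>c\<close> codes the candidate value together with the bound for its certificates,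
  so that a single unbounded search covers both.\<close>

definition check :: "nat \<Rightarrow> nat \<Rightarrow> bool" where
  "check c x \<longleftrightarrow> upper_check x (fst (prod_decode c)) (snd (prod_decode c)) \<and>
     lower_check x (fst (prod_decode c)) (snd (prod_decode c))"

lemmas dec_rules = dec_site_rules dec_logic comp_site_rules comp_arith comp_prod_decode comp_vars

lemma dec_local_closed: "decidable 3 (\<lambda>ys. local_closed (ys ! 0) (ys ! 1) (ys ! 2))"
  unfolding local_closed_def by (intro dec_rules) simp_all

lemma dec_cont_check: "decidable 5 (\<lambda>ys. cont_check (ys ! 0) (ys ! 1) (ys ! 2) (ys ! 3) (ys ! 4))"
  unfolding cont_check_def by (intro dec_comp3[OF dec_local_closed] dec_rules) simp_all

lemma dec_finite_check: "decidable 4 (\<lambda>ys. finite_check (ys ! 0) (ys ! 1) (ys ! 2) (ys ! 3))"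
  unfolding finite_check_def by (intro dec_comp5[OF dec_cont_check] dec_rules) simp_all

lemma dec_derives: "decidable 5 (\<lambda>ys. derives (ys ! 0) (ys ! 1) (ys ! 2) (ys ! 3) (ys ! 4))"
  unfolding derives_def by (intro dec_rules) simp_all

lemma dec_spread_at: "decidable 4 (\<lambda>ys. spread_at (ys ! 0) (ys ! 1) (ys ! 2) (ys ! 3))"
  unfolding spread_at_def by (intro dec_comp5[OF dec_derives] dec_rules) simp_all

lemma dec_spread_check: "decidable 4 (\<lambda>ys. spread_check (ys ! 0) (ys ! 1) (ys ! 2) (ys ! 3))"
  unfolding spread_check_def by (intro dec_comp4[OF dec_spread_at] dec_rules) simp_all

lemma dec_lex_pos: "computable_site n f \<Longrightarrow> computable_site n g \<Longrightarrow> decidable n (\<lambda>xs. lex_pos (f xs) (g xs))"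
  unfolding lex_pos_def by (intro dec_rules) simp_all

lemma dec_lex_unstable: "decidable 2 (\<lambda>ys. lex_unstable (fam (ys ! 0)) (site_of (ys ! 1)))"
  unfolding lex_unstable_def by (intro dec_rules) simp_all

lemma dec_int_stable: "decidable 2 (\<lambda>ys. int_stable (fam (ys ! 0)) (site_of (ys ! 1)))"
  unfolding int_stable_def by (intro dec_rules) simp_all

lemma dec_edge_good: "decidable 5 (\<lambda>ys. edge_good (ys ! 0) (ys ! 1) (ys ! 2) (ys ! 3) (ys ! 4))"
  unfolding edge_good_def
  by (intro dec_comp4[OF dec_spread_check] dec_comp2[OF dec_lex_unstable] dec_comp2[OF dec_int_stable]
      dec_lex_pos dec_rules) simp_all

lemma dec_edge_bad: "decidable 5 (\<lambda>ys. edge_bad (ys ! 0) (ys ! 1) (ys ! 2) (ys ! 3) (ys ! 4))"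
  unfolding edge_bad_def
  by (intro dec_comp4[OF dec_finite_check] dec_comp2[OF dec_lex_unstable] dec_comp2[OF dec_int_stable]
      dec_lex_pos dec_rules) simp_all

lemma dec_all_good: "decidable 4 (\<lambda>ys. all_good (ys ! 0) (ys ! 1) (ys ! 2) (ys ! 3))"
  unfolding all_good_def by (intro dec_comp5[OF dec_edge_good] dec_rules) simp_all

lemma dec_some_bad: "decidable 4 (\<lambda>ys. some_bad (ys ! 0) (ys ! 1) (ys ! 2) (ys ! 3))"
  unfolding some_bad_def by (intro dec_comp5[OF dec_edge_bad] dec_rules) simp_all

lemma dec_check: "decidable 2 (\<lambda>ys. check (ys ! 0) (ys ! 1))"
  unfolding check_def upper_check_def lower_check_def
  by (intro dec_comp4[OF dec_all_good] dec_comp4[OF dec_some_bad] dec_rules) simp_all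

section \<open>Correctness of the certificates\<close>

lemma sset_code_exists:
  assumes "finite F"
  shows "\<exists>c. sset c = F \<and> (\<forall>b. (\<forall>x\<in>F. site_code x < b) \<longrightarrow> c < 2 ^ b)"
proof (intro exI conjI allI impI)
  let ?c = "set_encode (site_code ` F)"
  show "sset ?c = F" using assms by (simp add: sset_def image_image)
  fix b assume "\<forall>x\<in>F. site_code x < b"
  then have "site_code ` F \<subseteq> {..<b}" by blast
  then have "?c \<le> (\<Sum>i<b. 2 ^ i)" unfolding set_encode_def by (intro sum_mono2) auto
  also have "\<dots> < 2 ^ b" by (induction b) auto
  finally show "?c < 2 ^ b" .
qed

lemma finite_sset [simp]: "finite (sset c)"
  by (simp add: sset_def)

lemma sset_bound: "c < 2 ^ b \<Longrightarrow> x \<in> sset c \<Longrightarrow> site_code x < b"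
  unfolding in_sset using set_decode_less[of "site_code x" c]
  by (metis not_le order_le_less_trans one_less_numeral_iff power_increasing_iff semiring_norm(76))

lemma local_closed_iff:
  assumes "int_stable (fam x) (site_of u)"
  shows "local_closed x u W \<longleftrightarrow> bp_closed (fam x) (below (site_of u) \<union> sset W)"
proof
  assume lc: "local_closed x u W"
  show "bp_closed (fam x) (below (site_of u) \<union> sset W)"
    unfolding bp_closed_def
  proof (intro ballI allI impI)
    fix U s assume U: "U \<in> fam x" and s: "\<forall>y\<in>U. s + y \<in> below (site_of u) \<union> sset W"
    show "s \<in> below (site_of u) \<union> sset W"
    proof (cases "\<exists>y\<in>U. s + y \<in> sset W")
      case True
      then obtain y where y: "y \<in> U" "s + y \<in> sset W" by blast
      have "(s + y) - y + y' \<in> below (site_of u) \<or> (s + y) - y + y' \<in> sset W" if "y' \<in> U" for y'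
        using bspec[OF s that] by simp
      then have "(s + y) - y \<in> below (site_of u) \<or> (s + y) - y \<in> sset W"
        using lc[unfolded local_closed_def, rule_format, OF U y] by blast
      then show ?thesis by simp
    next
      case False
      then show ?thesis using bp_closed_below'[OF assms] U s unfolding bp_closed_def by blast
    qed
  qed
next
  assume "bp_closed (fam x) (below (site_of u) \<union> sset W)"
  then show "local_closed x u W" unfolding bp_closed_def local_closed_def by blast
qed

text \<open>A witness stays within distance \<open>D\<close> of a finite set, so it is finite and
  has a code.\<close>

lemma contained_iff:
  assumes "int_stable (fam x) (site_of u)"
  shows "contained (fam x) (site_of u) (int D) (sset Z) \<longleftrightarrow> (\<exists>W. cont_check x u D Z W)"
proof
  assume "contained (fam x) (site_of u) (int D) (sset Z)"
  then obtain W where W: "sset Z \<subseteq> W" "\<forall>w\<in>W. \<exists>z\<in>sset Z. nrm (w - z) \<le> int D"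
    "bp_closed (fam x) (below (site_of u) \<union> W)" unfolding contained_def by blast
  have "finite W" using finite_thickening[OF finite_sset W(2)] .
  then obtain c where "sset c = W" using sset_code_exists by blast
  then have "cont_check x u D Z c" unfolding cont_check_def local_closed_iff[OF assms] using W by blast
  then show "\<exists>W. cont_check x u D Z W" ..
next
  assume "\<exists>W. cont_check x u D Z W"
  then show "contained (fam x) (site_of u) (int D) (sset Z)"
    unfolding cont_check_def local_closed_iff[OF assms] contained_def by blast
qed

lemma int_encode_le: "int_encode a \<le> 2 * nat \<bar>a\<bar>"
  by (auto simp: int_encode_def sum_encode_def)

text \<open>Each coordinate has a code of at most \<open>2 * M\<close>, so the two codes sum to at
  most \<open>4 * M\<close>; the pairing function is quadratic in this sum.\<close>

lemma site_code_box:
  assumes "nrm z \<le> int M"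
  shows "site_code z < (4 * M + 1) ^ 2 + 1"
proof -
  let ?a = "int_encode (fst z)" and ?b = "int_encode (snd z)"
  have ab: "?a \<le> 2 * M" "?b \<le> 2 * M"
    using int_encode_le[of "fst z"] int_encode_le[of "snd z"] assms by (auto simp: nrm_def)
  have "site_code z = triangle (?a + ?b) + ?a" by (simp add: site_code_def prod_encode_def)
  also have "triangle (?a + ?b) \<le> (?a + ?b) * Suc (?a + ?b)" by (simp add: triangle_def)
  also have "(?a + ?b) * Suc (?a + ?b) \<le> (4 * M) * Suc (4 * M)" using ab by (intro mult_le_mono) auto
  also have "(4 * M) * Suc (4 * M) + ?a < (4 * M + 1) ^ 2 + 1"
    using ab by (simp add: power2_eq_square algebra_simps)
  finally show ?thesis by simp
qed

text \<open>Every subset of the box of radius \<open>4 * k * D + 4 * D * D\<close> has a code in the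
  range inspected by the check, so the hypotheses of \<open>contained_from_box\<close> are verified
  and all closures are finite.\<close>

lemma finite_check_sound:
  assumes st: "int_stable (fam x) (site_of u)" "int_stable (fam x) 0" and chk: "finite_check x u k b"
  shows "\<not> spread (fam x) (site_of u) k"
proof -
  obtain D where D: "\<forall>U\<in>fam x. \<forall>y\<in>U. nrm y \<le> int D" "nrm1 (site_of u) \<le> int D"
    and Z: "\<And>Z. Z < 2 ^ ((4 * (4 * k * D + 4 * D * D) + 1) ^ 2 + 1) \<Longrightarrow> card (sset Z) \<le> k \<Longrightarrow>
          (\<exists>W<b. cont_check x (site_code 0) D Z W) \<and>
          ((\<forall>z\<in>sset Z. z \<notin> below (site_of u)) \<longrightarrow> (\<exists>W<b. cont_check x u D Z W))"
    using chk unfolding finite_check_def by blast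
  define M where "M = 4 * k * D + 4 * D * D"
  have code: "\<exists>c. sset c = A \<and> c < 2 ^ ((4 * M + 1) ^ 2 + 1)" if A: "A \<subseteq> {x. nrm x \<le> int M}" for A
  proof -
    obtain c where "sset c = A" "\<And>b. (\<forall>x\<in>A. site_code x < b) \<longrightarrow> c < 2 ^ b"
      using sset_code_exists[OF finite_subset[OF A finite_box]] by blast
    moreover have "\<forall>x\<in>A. site_code x < (4 * M + 1) ^ 2 + 1" using A site_code_box by blast
    ultimately show ?thesis by blast
  qed
  have "contained (fam x) (site_of u) (int D) A"
    if A: "finite A" "A \<inter> below (site_of u) = {}" "card A \<le> k" for A
  proof (rule contained_from_box[OF st(1) _ D(2), of k "int M", OF _ _ _ _ A])
    show "range_le (fam x) (int D)" using D(1) by (simp add: range_le_def)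
    show "4 * int k * int D + 4 * int D * int D \<le> int M" by (simp add: M_def)
    show "contained (fam x) 0 (int D) A" if A: "A \<subseteq> {x. nrm x \<le> int M}" "card A \<le> k" for A
    proof -
      obtain c where c: "sset c = A" "c < 2 ^ ((4 * M + 1) ^ 2 + 1)" using code[OF A(1)] by blast
      then have "\<exists>W. cont_check x (site_code 0) D c W" using Z[of c] A(2) unfolding M_def by blast
      then show ?thesis using contained_iff[of x "site_code 0" D c] st(2) c(1) by simp
    qed
    show "contained (fam x) (site_of u) (int D) A"
      if A: "A \<subseteq> {x. nrm x \<le> int M}" "A \<inter> below (site_of u) = {}" "card A \<le> k" for A
    proof -
      obtain c where c: "sset c = A" "c < 2 ^ ((4 * M + 1) ^ 2 + 1)" using code[OF A(1)] by blast
      then have "\<exists>W. cont_check x u D c W" using Z[of c] A(2,3) unfolding M_def by blast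
      then show ?thesis using contained_iff[OF st(1), of D c] c(1) by simp
    qed
  qed
  then show ?thesis unfolding spread_def using contained_finite by blast
qed

text \<open>Uniform containment is used twice, for \<open>u\<close> and for \<open>0\<close>; the
  latter rests on the family not being supercritical. The number \<open>D\<close> then dominates
  both distances, the range and \<open>nrm1\<close> of the direction.\<close>

lemma finite_check_complete:
  assumes fam: "update_family (fam x)" and sup: "\<not> supercritical (fam x)"
    and st: "int_stable (fam x) (site_of u)" and ns: "\<not> spread (fam x) (site_of u) k"
  shows "\<exists>b0. \<forall>b\<ge>b0. finite_check x u k b"
proof -
  have st0: "int_stable (fam x) 0" using not_supercritical_nonempty_rules[OF sup] .
  have fin0: "\<And>Z. finite Z \<Longrightarrow> finite (bp_closure (fam x) Z)"
    using not_supercritical_finite_closure[OF fam sup] .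
  obtain D1 where D1: "\<And>Z. finite Z \<Longrightarrow> Z \<inter> below (site_of u) = {} \<Longrightarrow> card Z \<le> k \<Longrightarrow>
      contained (fam x) (site_of u) D1 Z"
    using contained_exists[OF fam st st0 fin0, of k] ns unfolding spread_def by blast
  have "\<exists>D\<ge>0. \<forall>Z. finite Z \<longrightarrow> Z \<inter> below 0 = {} \<longrightarrow> card Z \<le> k \<longrightarrow> contained (fam x) 0 D Z"
    by (rule contained_exists[OF fam st0 st0 fin0]) (simp_all add: fin0)
  then obtain D2 where D2: "\<And>Z. finite Z \<Longrightarrow> card Z \<le> k \<Longrightarrow> contained (fam x) 0 D2 Z" by auto
  have "finite (\<Union>(fam x))" using fam by (auto simp: update_family_def)
  then have "\<exists>R\<ge>0. \<forall>y\<in>\<Union>(fam x). nrm y \<le> R" by (rule uniform_bound) auto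
  then obtain R where R: "\<forall>y\<in>\<Union>(fam x). nrm y \<le> R" by blast
  define D where "D = nat (max (max D1 D2) (max R (nrm1 (site_of u))))"
  have D: "D1 \<le> int D" "D2 \<le> int D" "R \<le> int D" "nrm1 (site_of u) \<le> int D" unfolding D_def by linarith+
  let ?N = "2 ^ ((4 * (4 * k * D + 4 * D * D) + 1) ^ 2 + 1) :: nat"
  have c0: "\<exists>W. cont_check x (site_code 0) D Z W" if "card (sset Z) \<le> k" for Z
    using contained_mono[OF D2[OF finite_sset that] D(2)] contained_iff[of x "site_code 0" D Z] st0 by simp
  have cu: "\<exists>W. cont_check x u D Z W" if "card (sset Z) \<le> k" "\<forall>z\<in>sset Z. z \<notin> below (site_of u)" for Z
  proof -
    have "sset Z \<inter> below (site_of u) = {}" using that(2) by blast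
    then show ?thesis
      using contained_mono[OF D1[OF finite_sset _ that(1)] D(1)] contained_iff[OF st] by blast
  qed
  define W0 where "W0 Z = (SOME W. cont_check x (site_code 0) D Z W)" for Z
  define Wu where "Wu Z = (SOME W. cont_check x u D Z W)" for Z
  have W0: "cont_check x (site_code 0) D Z (W0 Z)" if "card (sset Z) \<le> k" for Z
    unfolding W0_def using c0[OF that] by (rule someI_ex)
  have Wu: "cont_check x u D Z (Wu Z)" if "card (sset Z) \<le> k" "\<forall>z\<in>sset Z. z \<notin> below (site_of u)" for Z
    unfolding Wu_def using cu[OF that] by (rule someI_ex)
  \<comment> \<open>For this \<open>D\<close> only finitely many codes \<open>Z\<close> are
    inspected, and the sum of the chosen witnesses exceeds or equals each of them.\<close>
  define b0 where "b0 = Suc (D + (\<Sum>Z<?N. W0 Z + Wu Z))"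
  have b0: "W0 Z < b0" "Wu Z < b0" if "Z < ?N" for Z
    using member_le_sum[of Z "{..<?N}" "\<lambda>Z. W0 Z + Wu Z"] that unfolding b0_def by auto
  have "finite_check x u k b" if b: "b \<ge> b0" for b
    unfolding finite_check_def
  proof (rule exI[of _ D], intro conjI allI impI)
    show "D < b" using b by (simp add: b0_def)
    show "\<forall>U\<in>fam x. \<forall>y\<in>U. nrm y \<le> int D" using R D(3) by (meson UnionI order_trans)
    show "nrm1 (site_of u) \<le> int D" by (rule D(4))
    fix Z assume Z: "Z < ?N" "card (sset Z) \<le> k"
    show "\<exists>W<b. cont_check x (site_code 0) D Z W" using W0[OF Z(2)] b0(1)[OF Z(1)] b order_less_le_trans by blast
    assume "\<forall>z\<in>sset Z. z \<notin> below (site_of u)"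
    then show "\<exists>W<b. cont_check x u D Z W" using Wu[OF Z(2)] b0(2)[OF Z(1)] b order_less_le_trans by blast
  qed
  then show ?thesis by blast
qed

text \<open>The true closure, cut down to sites with codes below \<open>b\<close>, is one of the
  sets \<open>V\<close> that are tested. The bound on \<open>Z\<close> guarantees that the cut keeps
  all of \<open>Z\<close>.\<close>

lemma derives_sound:
  assumes fam: "update_family (fam x)" and Z: "Z < 2 ^ b" and der: "derives x u b Z w"
  shows "site_of w \<in> bp_closure (fam x) (below (site_of u) \<union> sset Z)"
proof -
  let ?C = "bp_closure (fam x) (below (site_of u) \<union> sset Z)"
  have sup: "below (site_of u) \<union> sset Z \<subseteq> ?C" by (rule bp_closure_superset)
  let ?V = "?C \<inter> site_of ` {..<b}"
  have "finite ?V" by simp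
  from sset_code_exists[OF this] obtain c where c: "sset c = ?V"
    "\<forall>b. (\<forall>x\<in>?V. site_code x < b) \<longrightarrow> c < 2 ^ b"
    by (elim exE conjE)
  have "\<forall>x\<in>?V. site_code x < b"
  proof
    fix x assume "x \<in> ?V"
    then obtain s where "s < b" "x = site_of s" by blast
    then show "site_code x < b" by simp
  qed
  then have cb: "c < 2 ^ b" using c(2) by simp
  have Zc: "\<forall>z\<in>sset Z. z \<in> sset c"
  proof
    fix z assume z: "z \<in> sset Z"
    then have "site_code z < b" using sset_bound[OF Z] by blast
    then have "z \<in> site_of ` {..<b}" by (metis imageI lessThan_iff site_of_code)
    then show "z \<in> sset c" using z sup c(1) by blast
  qed
  have step: "\<forall>s<b. (\<exists>U\<in>fam x. \<forall>y\<in>U. site_of s + y \<in> below (site_of u) \<or> site_of s + y \<in> sset c) \<longrightarrow>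
        site_of s \<in> sset c"
  proof (intro allI impI)
    fix s assume s: "s < b" "\<exists>U\<in>fam x. \<forall>y\<in>U. site_of s + y \<in> below (site_of u) \<or> site_of s + y \<in> sset c"
    then obtain U where U: "U \<in> fam x" "\<forall>y\<in>U. site_of s + y \<in> below (site_of u) \<or> site_of s + y \<in> sset c" by blast
    have "\<forall>y\<in>U. site_of s + y \<in> ?C" using U(2) sup unfolding c(1) by blast
    then have "site_of s \<in> ?C" using bp_closure_closed[OF fam] U(1) unfolding bp_closed_def by blast
    then show "site_of s \<in> sset c" using s(1) unfolding c(1) by blast
  qed
  have "site_of w \<in> below (site_of u) \<or> site_of w \<in> sset c"
    using der cb Zc step unfolding derives_def by blast
  then show ?thesis using sup unfolding c(1) by blast
qed

text \<open>The sites derivable for all large bounds form a closed set containing the half plane and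
  \<open>Z\<close>, hence contain the closure. In the closing step the new bound exceeds the bounds
  of all premises and also the code of the new site, so that \<open>V\<close> is obliged to be
  closed there.\<close>

lemma derives_complete:
  assumes fam: "update_family (fam x)" and w: "w \<in> bp_closure (fam x) (below (site_of u) \<union> sset Z)"
  shows "\<exists>b0. \<forall>b\<ge>b0. derives x u b Z (site_code w)"
proof -
  let ?P = "\<lambda>b0 w. \<forall>b\<ge>b0. derives x u b Z (site_code w)"
  have "bp_closed (fam x) {w. \<exists>b0. ?P b0 w}"
    unfolding bp_closed_def
  proof (intro ballI allI impI)
    fix U s assume U: "U \<in> fam x" and s: "\<forall>y\<in>U. s + y \<in> {w. \<exists>b0. ?P b0 w}"
    then have "\<forall>y\<in>U. \<exists>b0. ?P b0 (s + y)" by simp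
    then obtain f where f: "\<And>y. y \<in> U \<Longrightarrow> ?P (f y) (s + y)" by metis
    have finU: "finite U" using fam U by (simp add: update_family_def)
    let ?b0 = "Suc (site_code s + (\<Sum>y\<in>U. f y))"
    have "derives x u b Z (site_code s)" if b: "b \<ge> ?b0" for b
      unfolding derives_def
    proof (intro allI impI, elim conjE)
      fix V :: nat assume V: "V < 2 ^ b" "\<forall>z\<in>sset Z. z \<in> sset V"
        "\<forall>s<b. (\<exists>U\<in>fam x. \<forall>y\<in>U. site_of s + y \<in> below (site_of u) \<or> site_of s + y \<in> sset V) \<longrightarrow>
          site_of s \<in> sset V"
      have "s + y \<in> below (site_of u) \<or> s + y \<in> sset V" if y: "y \<in> U" for y
      proof -
        have "f y \<le> b" using member_le_sum[OF y _ finU, of f] b by simp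
        then have "derives x u b Z (site_code (s + y))" using f[OF y] by blast
        then show ?thesis using V unfolding derives_def by (simp only: site_of_code)
      qed
      then have "\<exists>U\<in>fam x. \<forall>y\<in>U. site_of (site_code s) + y \<in> below (site_of u) \<or> site_of (site_code s) + y \<in> sset V"
        using U unfolding site_of_code by blast
      moreover have "site_code s < b" using b by simp
      ultimately have "site_of (site_code s) \<in> sset V" using V(3) by blast
      then show "site_of (site_code s) \<in> below (site_of u) \<or> site_of (site_code s) \<in> sset V" ..
    qed
    then show "s \<in> {w. \<exists>b0. ?P b0 w}" by blast
  qed
  moreover have "below (site_of u) \<union> sset Z \<subseteq> {w. \<exists>b0. ?P b0 w}"
    unfolding derives_def by auto
  ultimately have "bp_closure (fam x) (below (site_of u) \<union> sset Z) \<subseteq> {w. \<exists>b0. ?P b0 w}"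
    by (rule bp_closure_least[rotated])
  then show ?thesis using w by blast
qed

lemma spread_check_sound:
  assumes fam: "update_family (fam x)" and chk: "spread_check x u k b"
  shows "spread (fam x) (site_of u) k"
proof -
  obtain b' where "spread_at x u k b'" using chk unfolding spread_check_def by blast
  then obtain Z W v where Z: "Z < 2 ^ b'" "card (sset Z) \<le> k" "\<forall>z\<in>sset Z. z \<notin> below (site_of u)"
    and W: "W < 2 ^ b'" "1 \<le> card (sset W)" "\<forall>w\<in>sset W. w \<notin> below (site_of u)"
    and v: "idot (site_of v) (site_of u) = 0" "site_of v \<noteq> 0"
    and der: "\<forall>w\<in>sset W. derives x u b' Z (site_code w) \<and> derives x u b' W (site_code (w + site_of v))"
    unfolding spread_at_def by blast
  have "infinite (bp_closure (fam x) (below (site_of u) \<union> sset Z) - below (site_of u))"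
  proof (rule infinite_closureI[OF fam _ _ _ v])
    show "sset W \<noteq> {}" using W(2) by auto
    show "sset W \<inter> below (site_of u) = {}" using W(3) by blast
    show "sset W \<subseteq> bp_closure (fam x) (below (site_of u) \<union> sset Z)"
    proof
      fix w assume "w \<in> sset W"
      then show "w \<in> bp_closure (fam x) (below (site_of u) \<union> sset Z)"
        using der derives_sound[OF fam Z(1), of u "site_code w"] by simp
    qed
    show "w + site_of v \<in> bp_closure (fam x) (below (site_of u) \<union> sset W)" if "w \<in> sset W" for w
      using der that derives_sound[OF fam W(1), of u "site_code (w + site_of v)"] by simp
  qed
  moreover have "sset Z \<inter> below (site_of u) = {}" using Z(3) by blast
  ultimately show ?thesis using Z(2) finite_sset unfolding spread_def by blast
qed

text \<open>Certificates valid for all large bounds can be combined: finitely many of them have a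
  common threshold.\<close>

lemma eventually_bound:
  fixes P :: "nat \<Rightarrow> 'a \<Rightarrow> bool"
  assumes "finite F" "\<And>z. z \<in> F \<Longrightarrow> \<exists>b0. \<forall>b\<ge>b0. P b z"
  shows "\<exists>b0. \<forall>b\<ge>b0. \<forall>z\<in>F. P b z"
proof -
  have "\<forall>\<^sub>F b in sequentially. \<forall>z\<in>F. P b z"
    using assms by (intro eventually_ball_finite) (auto simp: eventually_sequentially)
  then show ?thesis by (simp add: eventually_sequentially)
qed

lemma spread_check_complete:
  assumes fam: "update_family (fam x)" and st: "int_stable (fam x) (site_of u)" and u: "site_of u \<noteq> 0"
    and sp: "spread (fam x) (site_of u) k"
  shows "\<exists>b0. \<forall>b\<ge>b0. spread_check x u k b"
proof -
  obtain A where A: "finite A" "A \<inter> below (site_of u) = {}" "card A \<le> k"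
    "infinite (bp_closure (fam x) (below (site_of u) \<union> A) - below (site_of u))"
    using sp unfolding spread_def by blast
  obtain B v where B: "finite B" "B \<noteq> {}" "B \<inter> below (site_of u) = {}"
    "B \<subseteq> bp_closure (fam x) (below (site_of u) \<union> A)" and v: "idot v (site_of u) = 0" "v \<noteq> 0"
    and shift: "\<forall>w\<in>B. w + v \<in> bp_closure (fam x) (below (site_of u) \<union> B)"
    using infinite_closureD[OF fam st u A(1,4)] by blast
  obtain Z where Z: "sset Z = A" "\<forall>b. (\<forall>x\<in>A. site_code x < b) \<longrightarrow> Z < 2 ^ b"
    using sset_code_exists[OF A(1)] by blast
  obtain W where W: "sset W = B" "\<forall>b. (\<forall>x\<in>B. site_code x < b) \<longrightarrow> W < 2 ^ b"
    using sset_code_exists[OF B(1)] by blast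
  have "\<exists>b0. \<forall>b\<ge>b0. \<forall>w\<in>B. derives x u b Z (site_code w)"
    using B(4) derives_complete[OF fam, of _ u Z] unfolding Z(1) by (intro eventually_bound[OF B(1)]) blast
  then obtain b1 where b1: "\<forall>b\<ge>b1. \<forall>w\<in>B. derives x u b Z (site_code w)" by blast
  have "\<exists>b0. \<forall>b\<ge>b0. \<forall>w\<in>B. derives x u b W (site_code (w + v))"
    using shift derives_complete[OF fam, of _ u W] unfolding W(1) by (intro eventually_bound[OF B(1)]) blast
  then obtain b2 where b2: "\<forall>b\<ge>b2. \<forall>w\<in>B. derives x u b W (site_code (w + v))" by blast
  have "\<exists>b0. \<forall>b\<ge>b0. \<forall>x\<in>insert v (A \<union> B). site_code x < b"
    using A(1) B(1) by (intro eventually_bound) (auto intro: Suc_le_lessD)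
  then obtain b3 where b3: "\<forall>b\<ge>b3. \<forall>x\<in>insert v (A \<union> B). site_code x < b" by blast
  define b0 where "b0 = max b1 (max b2 b3)"
  have b: "b0 \<ge> b1" "b0 \<ge> b2" "b0 \<ge> b3" by (simp_all add: b0_def)
  have "spread_at x u k b0"
    unfolding spread_at_def
  proof (rule exI[of _ Z], rule conjI)
    show "Z < 2 ^ b0" using Z(2) b3 b(3) by blast
    show "\<exists>W<2 ^ b0. \<exists>v<b0. card (sset Z) \<le> k \<and>
     (\<forall>z\<in>sset Z. z \<notin> below (site_of u)) \<and> 1 \<le> card (sset W) \<and>
     (\<forall>w\<in>sset W. w \<notin> below (site_of u)) \<and> idot (site_of v) (site_of u) = 0 \<and> site_of v \<noteq> 0 \<and>
     (\<forall>w\<in>sset W. derives x u b0 Z (site_code w) \<and> derives x u b0 W (site_code (w + site_of v)))"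
    proof (rule exI[of _ W], rule conjI, goal_cases)
      case 1
      show ?case using W(2) b3 b(3) by blast
    next
      case 2
      have "site_code v < b0" using b3 b(3) by blast
      moreover have "1 \<le> card B" using B(1,2) by (simp add: Suc_le_eq card_gt_0_iff)
      moreover have "\<forall>z\<in>A. z \<notin> below (site_of u)" using A(2) by blast
      moreover have "\<forall>z\<in>B. z \<notin> below (site_of u)" using B(3) by blast
      moreover have "\<forall>w\<in>B. derives x u b0 Z (site_code w) \<and> derives x u b0 W (site_code (w + v))"
        using b1 b2 b by blast
      ultimately show ?case
        using A(3) v by (intro exI[of _ "site_code v"] conjI) (simp_all only: Z(1) W(1) site_of_code not_False_eq_True)
    qed
  qed
  then have "spread_check x u k b" if "b \<ge> Suc b0" for b
    using that unfolding spread_check_def by (intro exI[of _ b0]) simp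
  then show ?thesis by blast
qed

lemma ball_rot_dirs: "(\<forall>e\<in>rot ` dirs \<U>. P e) \<longleftrightarrow> (\<forall>U\<in>\<U>. \<forall>y\<in>U. P (rot y) \<and> P (rot (- y)))"
  unfolding dirs_def by blast

lemma bex_dirs: "(\<exists>w\<in>dirs \<U>. P w) \<longleftrightarrow> (\<exists>U\<in>\<U>. \<exists>y\<in>U. P y \<or> P (- y))"
  unfolding dirs_def by (simp add: bex_Un) metis

lemma good_iff:
  "good \<U> k w \<longleftrightarrow> (\<forall>e\<in>rot ` dirs \<U>. (lex_pos w e \<longrightarrow> lex_unstable \<U> e) \<and>
     (idot w e > 0 \<and> int_stable \<U> e \<longrightarrow> spread \<U> e k))"
  unfolding good_def lex_pos_def by blast

lemma all_good_iff:
  "all_good x k b w \<longleftrightarrow> (\<forall>e\<in>rot ` dirs (fam x). edge_good x k b w (site_code e))"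
  unfolding all_good_def ball_rot_dirs ..

lemma some_bad_iff:
  "some_bad x k b w \<longleftrightarrow> (\<exists>e\<in>rot ` dirs (fam x). edge_bad x k b w (site_code e))"
  using ball_rot_dirs[of "fam x" "\<lambda>e. \<not> edge_bad x k b w (site_code e)"] unfolding some_bad_def by blast

lemma all_good_sound:
  assumes fam: "update_family (fam x)" and g: "all_good x k b (site_code w)"
  shows "good (fam x) k w"
  unfolding good_iff
proof (intro ballI conjI impI)
  fix e assume "e \<in> rot ` dirs (fam x)"
  then have eg: "edge_good x k b (site_code w) (site_code e)" using g unfolding all_good_iff by blast
  show "lex_unstable (fam x) e" if "lex_pos w e" using eg that by (simp add: edge_good_def)
  show "spread (fam x) e k" if "0 < idot w e \<and> int_stable (fam x) e"
    using eg that spread_check_sound[OF fam, of "site_code e" k b] by (simp add: edge_good_def)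
qed

lemma all_good_complete:
  assumes fam: "update_family (fam x)" and g: "good (fam x) k w"
  shows "\<exists>b0. \<forall>b\<ge>b0. all_good x k b (site_code w)"
  unfolding all_good_iff
proof (rule eventually_bound)
  show "finite (rot ` dirs (fam x))" using finite_dirs[OF fam] by simp
  fix e assume e: "e \<in> rot ` dirs (fam x)"
  have e0: "e \<noteq> 0" using e dirs_nonzero[OF fam] by auto
  have g1: "lex_pos w e \<longrightarrow> lex_unstable (fam x) e"
    "idot w e > 0 \<and> int_stable (fam x) e \<longrightarrow> spread (fam x) e k"
    using g e unfolding good_iff by blast+
  show "\<exists>b0. \<forall>b\<ge>b0. edge_good x k b (site_code w) (site_code e)"
  proof (cases "idot w e > 0 \<and> int_stable (fam x) e")
    case True
    then obtain b0 where "\<forall>b\<ge>b0. spread_check x (site_code e) k b"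
      using spread_check_complete[OF fam, of "site_code e" k] e0 g1 by auto
    then show ?thesis using g1 by (auto simp: edge_good_def)
  next
    case False
    then show ?thesis using g1 by (auto simp: edge_good_def)
  qed
qed

lemma some_bad_sound:
  assumes st: "int_stable (fam x) 0" and bad: "some_bad x k b (site_code w)"
  shows "\<not> good (fam x) k w"
proof
  assume g: "good (fam x) k w"
  obtain e where e: "e \<in> rot ` dirs (fam x)" "edge_bad x k b (site_code w) (site_code e)"
    using bad unfolding some_bad_iff by blast
  have g1: "lex_pos w e \<longrightarrow> lex_unstable (fam x) e"
    "idot w e > 0 \<and> int_stable (fam x) e \<longrightarrow> spread (fam x) e k"
    using g e unfolding good_iff by blast+
  show False using e(2) g1 finite_check_sound[OF _ st, of "site_code e" k b] by (auto simp: edge_bad_def)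
qed

lemma some_bad_complete:
  assumes fam: "update_family (fam x)" and sup: "\<not> supercritical (fam x)" and g: "\<not> good (fam x) k w"
  shows "\<exists>b0. \<forall>b\<ge>b0. some_bad x k b (site_code w)"
proof -
  obtain e where e: "e \<in> rot ` dirs (fam x)" "lex_pos w e \<and> \<not> lex_unstable (fam x) e \<or>
      (idot w e > 0 \<and> int_stable (fam x) e) \<and> \<not> spread (fam x) e k"
    using g unfolding good_iff by blast
  have "\<exists>b0. \<forall>b\<ge>b0. edge_bad x k b (site_code w) (site_code e)"
  proof (cases "lex_pos w e \<and> \<not> lex_unstable (fam x) e")
    case True
    then show ?thesis by (simp add: edge_bad_def)
  next
    case False
    then have e': "idot w e > 0" "int_stable (fam x) e" "\<not> spread (fam x) e k" using e(2) by blast+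
    then obtain b0 where "\<forall>b\<ge>b0. finite_check x (site_code e) k b"
      using finite_check_complete[OF fam sup, of "site_code e" k] by auto
    then show ?thesis using e' by (auto simp: edge_bad_def)
  qed
  then show ?thesis using e(1) unfolding some_bad_iff by blast
qed

text \<open>Any accepted code gives the exact value, whatever bound it contains: one half of the
  check shows that the difficulty is at most the coded value, the other excludes its
  predecessor.\<close>

lemma check_sound:
  assumes fam: "update_family (fam x)" and crit: "critical (fam x)" and chk: "check c x"
  shows "difficulty (fam x) = enat (fst (prod_decode c))"
proof -
  let ?k = "fst (prod_decode c)" and ?b = "snd (prod_decode c)"
  have ne: "\<Union>(fam x) \<noteq> {}" using critical_nonempty[OF fam crit] .
  have st: "int_stable (fam x) 0"
    using not_supercritical_nonempty_rules crit by (simp add: critical_def)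
  have "\<exists>w\<in>dirs (fam x). all_good x ?k ?b (site_code w)"
    using chk unfolding check_def upper_check_def bex_dirs by blast
  then have "difficulty (fam x) \<le> enat ?k"
    unfolding difficulty_le_iff[OF fam ne] using all_good_sound[OF fam] by blast
  moreover have "\<not> difficulty (fam x) \<le> enat (?k - 1)" if "?k \<noteq> 0"
  proof -
    have "\<not> (\<exists>w\<in>dirs (fam x). \<not> some_bad x (?k - 1) ?b (site_code w))"
      using chk that unfolding check_def lower_check_def bex_dirs by blast
    then show ?thesis unfolding difficulty_le_iff[OF fam ne] using some_bad_sound[OF st] by blast
  qed
  ultimately show ?thesis
    by (cases "difficulty (fam x)"; cases "?k = 0") (auto simp: not_le)
qed

lemma check_complete:
  assumes fam: "update_family (fam x)" and crit: "critical (fam x)"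
  shows "\<exists>c. check c x"
proof -
  have ne: "\<Union>(fam x) \<noteq> {}" using critical_nonempty[OF fam crit] .
  have sup: "\<not> supercritical (fam x)" using crit by (simp add: critical_def)
  obtain k where k: "difficulty (fam x) = enat k"
    using difficulty_finite[OF fam crit] by (cases "difficulty (fam x)") auto
  obtain w where w: "w \<in> dirs (fam x)" "good (fam x) k w"
    using k difficulty_le_iff[OF fam ne, of k] by auto
  obtain b1 where b1: "\<forall>b\<ge>b1. all_good x k b (site_code w)" using all_good_complete[OF fam w(2)] by blast
  have "\<exists>b0. \<forall>b\<ge>b0. \<forall>w\<in>dirs (fam x). k = 0 \<or> some_bad x (k - 1) b (site_code w)"
  proof (rule eventually_bound[OF finite_dirs[OF fam]])
    fix w assume w: "w \<in> dirs (fam x)"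
    show "\<exists>b0. \<forall>b\<ge>b0. k = 0 \<or> some_bad x (k - 1) b (site_code w)"
    proof (cases "k = 0")
      case False
      then have "\<not> difficulty (fam x) \<le> enat (k - 1)" using k by simp
      then have "\<not> good (fam x) (k - 1) w" using difficulty_le_iff[OF fam ne] w by blast
      then show ?thesis using some_bad_complete[OF fam sup] by blast
    qed simp
  qed
  then obtain b2 where b2: "\<forall>b\<ge>b2. \<forall>w\<in>dirs (fam x). k = 0 \<or> some_bad x (k - 1) b (site_code w)" by blast
  define b where "b = max b1 b2"
  have "all_good x k b (site_code w)" using b1 by (simp add: b_def)
  then have "upper_check x k b" using w(1) bex_dirs[of "fam x" "\<lambda>w. all_good x k b (site_code w)"]
    unfolding upper_check_def by blast
  moreover have "\<forall>w\<in>dirs (fam x). k = 0 \<or> some_bad x (k - 1) b (site_code w)" using b2 by (simp add: b_def)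
  then have "lower_check x k b"
    using bex_dirs[of "fam x" "\<lambda>w. \<not> some_bad x (k - 1) b (site_code w)"] unfolding lower_check_def by blast
  ultimately have "check (prod_encode (k, b)) x" by (simp add: check_def)
  then show ?thesis ..
qed

theorem theorem1p1:
  "\<exists>p. \<forall>rs :: site list list.
     update_family (family_of rs) \<and> critical (family_of rs) \<longrightarrow>
       (\<exists>n. eval p [encode_input rs] n \<and> difficulty (family_of rs) = enat n)"
proof -
  \<comment> \<open>Minimisation looks for the value \<open>0\<close>, hence the negated
    check.\<close>
  have "decidable 2 (\<lambda>ys. \<not> check (ys ! 0) (ys ! 1))" by (intro dec_not dec_check)
  then obtain q where q: "\<And>ys. length ys = 2 \<Longrightarrow> eval q ys (of_bool (\<not> check (ys ! 0) (ys ! 1)))"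
    unfolding decidable_def computable_def by blast
  have "computable 1 (\<lambda>ys. fst (prod_decode (ys ! 0)))" by (intro comp_prod_decode comp_nth) simp
  then obtain d where d: "\<And>ys. length ys = 1 \<Longrightarrow> eval d ys (fst (prod_decode (ys ! 0)))"
    unfolding computable_def by blast
  have "\<exists>n. eval (Comp d [Mu q]) [encode_input rs] n \<and> difficulty (family_of rs) = enat n"
    if fam: "update_family (family_of rs)" and crit: "critical (family_of rs)" for rs
  proof -
    let ?x = "encode_input rs"
    have ex: "\<exists>c. check c ?x" using check_complete[of ?x] fam crit by (simp add: fam_encode)
    define c where "c = (LEAST c. check c ?x)"
    have c: "check c ?x" unfolding c_def using ex by (rule LeastI_ex)
    have "eval q [c, ?x] 0" using q[of "[c, ?x]"] c by simp
    \<comment> \<open>The decision program is total, so before the least accepted code it halts with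
      a positive value, as minimisation demands.\<close>
    moreover have "\<exists>k. eval q [m, ?x] (Suc k)" if "m < c" for m
      using q[of "[m, ?x]"] not_less_Least[of m "\<lambda>c. check c ?x"] that by (auto simp: c_def)
    ultimately have "eval (Mu q) [?x] c" by (intro eval_Mu) auto
    \<comment> \<open>The pair found by the search is projected to the value, discarding the
      certificate bound.\<close>
    then have "eval (Comp d [Mu q]) [?x] (fst (prod_decode c))" using d[of "[c]"] by (intro eval_Comp[of _ _ "[c]"]) auto
    moreover have "difficulty (family_of rs) = enat (fst (prod_decode c))"
      using check_sound[OF _ _ c] fam crit by (simp add: fam_encode)
    ultimately show ?thesis by blast
  qed
  then show ?thesis by blast
qed

end
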